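(* Let $V\in L^\infty(\mathbb R^3)$ be complex-valued, and in $L^2(\mathbb R^3,\mathbb C^2)\oplus L^2(\mathbb R^3,\mathbb C^2)$ let $$\mathcal T=\begin{pmatrix} I+V&\sigma\cdot(-i\nabla)\\ \sigma\cdot(-i\nabla)&-I+V\end{pmatrix},\qquad \operatorname{dom}(\mathcal T)=W^{1,2}(\mathbb R^3,\mathbb C^2)\oplus W^{1,2}(\mathbb R^3,\mathbb C^2).$$ Define $$\Sigma^-=(-\infty,-1]+\operatorname{conv}(\operatorname{essran}(V)),\quad \Sigma^+=[1,\infty)+\operatorname{conv}(\operatorname{essran}(V)),\quad \Sigma=\Sigma^-\cup\Sigma^+ .$$ (i) Let $z\in\mathbb C$ be such that there exists $\varphi\in[0,\frac\pi2)$ for which either the sector $\mathcal S:=\mathcal S_{\varphi,\pi-\varphi}(z)$ or the sector $\mathcal S:=\mathcal S_{-\pi+\varphi,-\varphi}(z)$ satisfies: $\mathcal S\subset\mathbb C\setminus\Sigma$, with left boundary ray tangential to $\partial\Sigma^-$ and right boundary ray tangential to $\partial\Sigma^+$. Let $\mathcal B:=\mathcal B_\varphi$ or $\mathcal B:=\mathcal B_{-\varphi}$, respectively. Then $\mathcal S\subseteq\big(\mathbb C\setminus W(\mathcal B\mathcal T,\mathcal B)\big)\cap\rho(\mathcal T)$ and $$\|(\mathcal T-\lambda)^{-1}\|\le\frac{1}{\cos(\varphi)\,\operatorname{dist}(\lambda,\partial\mathcal S)},\qquad \lambda\in\mathcal S.$$ (ii) Let $\mathcal F$ be the set of all sectors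 $\mathcal S$ having the properties in part (i), and let $\widetilde\Sigma:=\mathbb C\setminus\bigcup_{\mathcal S\in\mathcal F}\mathcal S$. Then $\sigma(\mathcal T)\subseteq\widetilde\Sigma$.
   Context: $\sigma=(\sigma_1,\sigma_2,\sigma_3)$ is the vector of the $2\times2$ Pauli matrices, so $\sigma\cdot(-i\nabla)=-i\sum_{j=1}^3\sigma_j\partial_j$. $\operatorname{essran}(V)$ is the essential range of $V$ and $\operatorname{conv}$ denotes convex hull. For $\theta\in(-\pi/2,\pi/2)$, $\mathcal B_\theta=\operatorname{diag}(e^{-i\theta},e^{i\theta})$ on $L^2(\mathbb R^3,\mathbb C^2)\oplus L^2(\mathbb R^3,\mathbb C^2)$. For $z\in\mathbb C$ and $-\pi\le\theta_1<\theta_2\le\pi$, $\mathcal S_{\theta_1,\theta_2}(z)=\{z+w: w\in\mathbb C\setminus\{0\},\ \arg(w)\in(\theta_1,\theta_2)\}$ (open sector). Its boundary consists of two rays emanating from $z$; for $\mathcal S_{\varphi,\pi-\varphi}(z)$ the right one is $z+e^{i\varphi}[0,\infty)$ and the left one is $z+e^{i(\pi-\varphi)}[0,\infty)$; for $\mathcal S_{-\pi+\varphi,-\varphi}(z)$ the right one is $z+e^{-i\varphi}[0,\infty)$ and the left one is $z+e^{-i(\pi-\varphi)}[0,\infty)$. A boundary ray is tangential to $\partial\Sigma^\pm$ if it meets $\Sigma^\pm$ and the line containing it is a supporting line of the closed convex set $\Sigma^\pm$. For linear operators $A,B$ with $\operatorname{dom}(A)\subseteq\operatorname{dom}(B)$,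 $W(A,B)=\{\lambda\in\mathbb C:0\in\overline{W(A-\lambda B)}\}$, where $W(S)=\{\langle Sx,x\rangle:x\in\operatorname{dom}(S),\|x\|=1\}$. *)

theory Defs
  imports "HOL-Analysis.Analysis"
begin

section \<open>Complex inner product spaces\<close>

text \<open>The inner product \<open>cinner\<close> is linear in the first argument, so that
  \<open>cinner (S x) x\<close> is the quantity \<open>\<langle>Sx,x\<rangle>\<close> of the numerical range.\<close>

class complex_inner = real_inner +
  fixes scaleC :: "complex \<Rightarrow> 'a \<Rightarrow> 'a" (infixr "*\<^sub>C" 75)
    and cinner :: "'a \<Rightarrow> 'a \<Rightarrow> complex"
  assumes scaleC_add_right: "c *\<^sub>C (x + y) = c *\<^sub>C x + c *\<^sub>C y"
    and scaleC_add_left: "(c + d) *\<^sub>C x = c *\<^sub>C x + d *\<^sub>C x"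
    and scaleC_scaleC: "c *\<^sub>C d *\<^sub>C x = (c * d) *\<^sub>C x"
    and scaleR_scaleC: "r *\<^sub>R x = complex_of_real r *\<^sub>C x"
    and cinner_commute: "cinner x y = cnj (cinner y x)"
    and cinner_add_left: "cinner (x + y) z = cinner x z + cinner y z"
    and cinner_scaleC_left: "cinner (c *\<^sub>C x) y = c * cinner x y"
    and Re_cinner: "Re (cinner x y) = inner x y"

instantiation prod :: (complex_inner, complex_inner) complex_inner
begin

definition scaleC_prod_def: "c *\<^sub>C p = (c *\<^sub>C fst p, c *\<^sub>C snd p)"

definition cinner_prod_def: "cinner p q = cinner (fst p) (fst q) + cinner (snd p) (snd q)"

instance
proof
  fix x y z :: "'a \<times> 'b" and c d :: complex and r :: real
  show "c *\<^sub>C (x + y) = c *\<^sub>C x + c *\<^sub>C y"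
    by (simp add: scaleC_prod_def scaleC_add_right)
  show "(c + d) *\<^sub>C x = c *\<^sub>C x + d *\<^sub>C x"
    by (simp add: scaleC_prod_def scaleC_add_left)
  show "c *\<^sub>C d *\<^sub>C x = (c * d) *\<^sub>C x"
    by (simp add: scaleC_prod_def scaleC_scaleC)
  show "r *\<^sub>R x = complex_of_real r *\<^sub>C x"
    by (simp add: scaleC_prod_def scaleR_prod_def scaleR_scaleC)
  show "cinner x y = cnj (cinner y x)"
    by (simp add: cinner_prod_def flip: cinner_commute)
  show "cinner (x + y) z = cinner x z + cinner y z"
    by (simp add: cinner_prod_def cinner_add_left)
  show "cinner (c *\<^sub>C x) y = c * cinner x y"
    by (simp add: cinner_prod_def scaleC_prod_def cinner_scaleC_left algebra_simps)
  show "Re (cinner x y) = inner x y"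
    by (simp add: cinner_prod_def inner_prod_def Re_cinner)
qed

end

section \<open>Unbounded operators\<close>

text \<open>The values of \<open>op_app A\<close> outside \<open>op_dom A\<close> are irrelevant.\<close>

datatype 'a operator = Operator (op_dom: "'a set") (op_app: "'a \<Rightarrow> 'a")

definition op_diff :: "'a::complex_inner operator \<Rightarrow> 'a operator \<Rightarrow> 'a operator" where
  "op_diff A B = Operator (op_dom A \<inter> op_dom B) (\<lambda>x. op_app A x - op_app B x)"

definition op_scale :: "complex \<Rightarrow> 'a::complex_inner operator \<Rightarrow> 'a operator" where
  "op_scale c A = Operator (op_dom A) (\<lambda>x. c *\<^sub>C op_app A x)"

definition op_mult :: "'a::complex_inner operator \<Rightarrow> 'a operator \<Rightarrow> 'a operator" where
  "op_mult A B = Operator {x \<in> op_dom B. op_app B x \<in> op_dom A} (\<lambda>x. op_app A (op_app B x))"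

definition op_ident :: "'a::complex_inner operator" where
  "op_ident = Operator UNIV (\<lambda>x. x)"

definition numerical_range :: "'a::complex_inner operator \<Rightarrow> complex set" where
  "numerical_range S = {cinner (op_app S x) x | x. x \<in> op_dom S \<and> norm x = 1}"

definition pencil_numerical_range ::
    "'a::complex_inner operator \<Rightarrow> 'a operator \<Rightarrow> complex set" where
  "pencil_numerical_range A B =
     {l. 0 \<in> closure (numerical_range (op_diff A (op_scale l B)))}"

definition resolvent :: "'a::complex_inner operator \<Rightarrow> complex \<Rightarrow> 'a \<Rightarrow> 'a" where
  "resolvent A l =
     (let R = op_diff A (op_scale l op_ident) in inv_into (op_dom R) (op_app R))"

definition resolvent_set :: "'a::complex_inner operator \<Rightarrow> complex set" where
  "resolvent_set A =
     {l. let R = op_diff A (op_scale l op_ident) in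
           bij_betw (op_app R) (op_dom R) UNIV \<and> bounded_linear (resolvent A l)}"

definition spectrum :: "'a::complex_inner operator \<Rightarrow> complex set" where
  "spectrum A = - resolvent_set A"

section \<open>The Hilbert space of square-integrable two-component spinors\<close>

definition square_integrable :: "(real^3 \<Rightarrow> complex^2) \<Rightarrow> bool" where
  "square_integrable f \<longleftrightarrow>
     f \<in> borel_measurable lebesgue \<and> integrable lebesgue (\<lambda>x. (norm (f x))\<^sup>2)"

definition L2_rel :: "(real^3 \<Rightarrow> complex^2) \<Rightarrow> (real^3 \<Rightarrow> complex^2) \<Rightarrow> bool" where
  "L2_rel f g \<longleftrightarrow> square_integrable f \<and> square_integrable g \<and> (AE x in lebesgue. f x = g x)"

lemma square_integrable_zero: "square_integrable (\<lambda>x. 0)"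
  by (simp add: square_integrable_def)

lemma L2_rel_refl_iff: "L2_rel f f \<longleftrightarrow> square_integrable f"
  by (simp add: L2_rel_def)

quotient_type L2 = "real^3 \<Rightarrow> complex^2" / partial: L2_rel
proof (rule part_equivpI)
  show "\<exists>f. L2_rel f f"
    using square_integrable_zero L2_rel_refl_iff by blast
  show "symp L2_rel"
    unfolding symp_def L2_rel_def by (auto elim: eventually_mono)
  show "transp L2_rel"
  proof (rule transpI)
    fix f g h assume fg: "L2_rel f g" and gh: "L2_rel g h"
    have "AE x in lebesgue. f x = g x" "AE x in lebesgue. g x = h x"
      using fg gh by (auto simp: L2_rel_def)
    then have "AE x in lebesgue. f x = h x"
      by eventually_elim simp
    then show "L2_rel f h"
      using fg gh by (simp add: L2_rel_def)
  qed
qed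

definition cdot :: "complex^2 \<Rightarrow> complex^2 \<Rightarrow> complex" where
  "cdot u v = (\<Sum>k\<in>UNIV. u $ k * cnj (v $ k))"

lemma Re_cdot: "Re (cdot u v) = inner u v"
  by (simp add: cdot_def inner_vec_def inner_complex_def)

lemma norm_vec_sq: "(norm (u :: complex^2))\<^sup>2 = (\<Sum>k\<in>UNIV. (norm (u $ k))\<^sup>2)"
  by (simp add: norm_vec_def L2_set_def sum_nonneg)

lemma norm_cdot_le: "norm (cdot u v) \<le> (norm u)\<^sup>2 + (norm v)\<^sup>2"
proof -
  have *: "a * b \<le> a\<^sup>2 + b\<^sup>2" for a b :: real
    using sum_squares_bound[of a b] zero_le_power2[of a] zero_le_power2[of b] by linarith
  have "norm (cdot u v) \<le> (\<Sum>k\<in>UNIV. norm (u $ k * cnj (v $ k)))"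
    unfolding cdot_def by (rule norm_sum)
  also have "\<dots> \<le> (\<Sum>k\<in>UNIV. (norm (u $ k))\<^sup>2 + (norm (v $ k))\<^sup>2)"
    by (rule sum_mono) (simp add: norm_mult *)
  also have "\<dots> = (norm u)\<^sup>2 + (norm v)\<^sup>2"
    by (simp add: norm_vec_sq sum.distrib)
  finally show ?thesis .
qed

lemma borel_measurable_compose_cont:
  fixes f :: "real^3 \<Rightarrow> complex^2" and h :: "complex^2 \<Rightarrow> 'b::topological_space"
  assumes "f \<in> borel_measurable lebesgue" "continuous_on UNIV h"
  shows "(\<lambda>x. h (f x)) \<in> borel_measurable lebesgue"
  using measurable_compose[OF assms(1) borel_measurable_continuous_onI[OF assms(2)]] .

lemma measurable_component:
  fixes f :: "real^3 \<Rightarrow> complex^2"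
  assumes "f \<in> borel_measurable lebesgue"
  shows "(\<lambda>x. f x $ k) \<in> borel_measurable lebesgue"
  by (rule borel_measurable_compose_cont[OF assms]) (intro continuous_intros)

lemma measurable_cdot:
  fixes f g :: "real^3 \<Rightarrow> complex^2"
  assumes "f \<in> borel_measurable lebesgue" "g \<in> borel_measurable lebesgue"
  shows "(\<lambda>x. cdot (f x) (g x)) \<in> borel_measurable lebesgue"
proof -
  have "(\<lambda>x. cnj (g x $ k)) \<in> borel_measurable lebesgue" for k
    by (rule borel_measurable_compose_cont[OF assms(2)]) (intro continuous_intros)
  then show ?thesis
    unfolding cdot_def using measurable_component[OF assms(1)]
    by (intro borel_measurable_sum borel_measurable_times) auto
qed

lemma integrable_cdot:
  assumes "square_integrable f" "square_integrable g"
  shows "integrable lebesgue (\<lambda>x. cdot (f x) (g x))"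
proof (rule Bochner_Integration.integrable_bound)
  show "integrable lebesgue (\<lambda>x. (norm (f x))\<^sup>2 + (norm (g x))\<^sup>2)"
    using assms by (simp add: square_integrable_def)
  show "(\<lambda>x. cdot (f x) (g x)) \<in> borel_measurable lebesgue"
    using assms by (simp add: measurable_cdot square_integrable_def)
  show "AE x in lebesgue. norm (cdot (f x) (g x)) \<le> norm ((norm (f x))\<^sup>2 + (norm (g x))\<^sup>2)"
    using norm_cdot_le by (intro AE_I2) simp
qed

lemma square_integrable_bound:
  assumes "square_integrable f" "g \<in> borel_measurable lebesgue"
    and "AE x in lebesgue. norm (g x) \<le> C * norm (f x)"
  shows "square_integrable g"
  unfolding square_integrable_def
proof
  show "integrable lebesgue (\<lambda>x. (norm (g x))\<^sup>2)"
  proof (rule Bochner_Integration.integrable_bound)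
    show "integrable lebesgue (\<lambda>x. C\<^sup>2 * (norm (f x))\<^sup>2)"
      using assms(1) by (simp add: square_integrable_def)
    show "(\<lambda>x. (norm (g x))\<^sup>2) \<in> borel_measurable lebesgue"
      using assms(2) by simp
    show "AE x in lebesgue. norm ((norm (g x))\<^sup>2) \<le> norm (C\<^sup>2 * (norm (f x))\<^sup>2)"
      using assms(3)
    proof eventually_elim
      case (elim x)
      then have "(norm (g x))\<^sup>2 \<le> (C * norm (f x))\<^sup>2"
        by (intro power_mono) auto
      then show ?case by (simp add: power_mult_distrib)
    qed
  qed
qed (fact assms(2))

lemma square_integrable_add:
  assumes "square_integrable f" "square_integrable g"
  shows "square_integrable (\<lambda>x. f x + g x)"
  unfolding square_integrable_def
proof
  show m: "(\<lambda>x. f x + g x) \<in> borel_measurable lebesgue"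
    using assms by (intro borel_measurable_add) (auto simp: square_integrable_def)
  show "integrable lebesgue (\<lambda>x. (norm (f x + g x))\<^sup>2)"
  proof (rule Bochner_Integration.integrable_bound)
    show "integrable lebesgue (\<lambda>x. 2 * (norm (f x))\<^sup>2 + 2 * (norm (g x))\<^sup>2)"
      using assms by (simp add: square_integrable_def)
    show "(\<lambda>x. (norm (f x + g x))\<^sup>2) \<in> borel_measurable lebesgue"
      using m by simp
    have "(norm (u + v))\<^sup>2 \<le> 2 * (norm u)\<^sup>2 + 2 * (norm v)\<^sup>2" for u v :: "complex^2"
    proof -
      have "(norm (u + v))\<^sup>2 \<le> (norm u + norm v)\<^sup>2"
        by (intro power_mono norm_triangle_ineq) simp
      also have "\<dots> \<le> 2 * (norm u)\<^sup>2 + 2 * (norm v)\<^sup>2"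
        using sum_squares_bound[of "norm u" "norm v"] by (simp add: power2_sum)
      finally show ?thesis .
    qed
    then show "AE x in lebesgue.
        norm ((norm (f x + g x))\<^sup>2) \<le> norm (2 * (norm (f x))\<^sup>2 + 2 * (norm (g x))\<^sup>2)"
      by (intro AE_I2) simp
  qed
qed

lemma norm_matrix_mult_le:
  "norm ((M :: complex^2^2) *v u) \<le> onorm ((*v) M) * norm u"
proof (rule onorm)
  have "linear ((*v) M)"
    by (rule linearI) (auto simp: vec_eq_iff matrix_vector_mult_def sum.distrib
        scaleR_sum_right algebra_simps)
  then show "bounded_linear ((*v) M)"
    by (simp only: linear_conv_bounded_linear)
qed

lemma square_integrable_matrix:
  assumes "square_integrable f"
  shows "square_integrable (\<lambda>x. (M :: complex^2^2) *v f x)"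
proof (rule square_integrable_bound[OF assms])
  have "continuous_on UNIV ((*v) M)"
    unfolding matrix_vector_mult_def by (intro continuous_intros)
  then show "(\<lambda>x. M *v f x) \<in> borel_measurable lebesgue"
    using assms borel_measurable_compose_cont by (auto simp: square_integrable_def)
  show "AE x in lebesgue. norm (M *v f x) \<le> onorm ((*v) M) * norm (f x)"
    using norm_matrix_mult_le by simp
qed

definition L_infinity :: "(real^3 \<Rightarrow> complex) set" where
  "L_infinity =
     {V \<in> borel_measurable lebesgue. \<exists>C. AE x in lebesgue. norm (V x) \<le> C}"

lemma norm_vector_scalar_mult: "norm (c *s (u :: complex^2)) = norm c * norm u"
  by (simp add: norm_vec_def norm_mult L2_set_right_distrib)

lemma square_integrable_mult:
  assumes V: "V \<in> L_infinity" and f: "square_integrable f"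
  shows "square_integrable (\<lambda>x. V x *s f x)"
proof -
  obtain C where C: "AE x in lebesgue. norm (V x) \<le> C"
    using V by (auto simp: L_infinity_def)
  show ?thesis
  proof (rule square_integrable_bound[OF f])
    have "(\<lambda>x. V x * f x $ k) \<in> borel_measurable lebesgue" for k
      using V f measurable_component
      by (intro borel_measurable_times) (auto simp: L_infinity_def square_integrable_def)
    then show "(\<lambda>x. V x *s f x) \<in> borel_measurable lebesgue"
      by (subst borel_measurable_euclidean_space)
        (auto simp: Basis_vec_def inner_axis intro!: borel_measurable_inner)
    show "AE x in lebesgue. norm (V x *s f x) \<le> C * norm (f x)"
      using C by eventually_elim (simp add: norm_vector_scalar_mult mult_right_mono)
  qed
qed

lemma square_integrable_scaleC:
  "square_integrable f \<Longrightarrow> square_integrable (\<lambda>x. c *s f x)"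
  by (rule square_integrable_mult[where V = "\<lambda>x. c"]) (auto simp: L_infinity_def)

instantiation L2 :: complex_inner
begin

lift_definition zero_L2 :: L2 is "\<lambda>x. 0"
  by (simp add: L2_rel_def square_integrable_zero)

lift_definition plus_L2 :: "L2 \<Rightarrow> L2 \<Rightarrow> L2" is "\<lambda>f g x. f x + g x"
  by (auto simp: L2_rel_def square_integrable_add elim: eventually_elim2)

lift_definition scaleC_L2 :: "complex \<Rightarrow> L2 \<Rightarrow> L2" is "\<lambda>c f x. c *s f x"
  by (auto simp: L2_rel_def square_integrable_scaleC elim: eventually_mono)

definition scaleR_L2 :: "real \<Rightarrow> L2 \<Rightarrow> L2" where
  "scaleR_L2 r f = complex_of_real r *\<^sub>C f"

definition uminus_L2 :: "L2 \<Rightarrow> L2" where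
  "uminus_L2 f = (-1) *\<^sub>C f"

definition minus_L2 :: "L2 \<Rightarrow> L2 \<Rightarrow> L2" where
  "minus_L2 f g = f + - g"

lift_definition cinner_L2 :: "L2 \<Rightarrow> L2 \<Rightarrow> complex"
  is "\<lambda>f g. \<integral>x. (\<Sum>k\<in>UNIV. f x $ k * cnj (g x $ k)) \<partial>lebesgue"
proof -
  fix f f' g g' assume f: "L2_rel f f'" and g: "L2_rel g g'"
  have "AE x in lebesgue. f x = f' x" "AE x in lebesgue. g x = g' x"
    using f g by (auto simp: L2_rel_def)
  then have "AE x in lebesgue. cdot (f x) (g x) = cdot (f' x) (g' x)"
    by eventually_elim simp
  then have "(\<integral>x. cdot (f x) (g x) \<partial>lebesgue) = (\<integral>x. cdot (f' x) (g' x) \<partial>lebesgue)"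
    using f g by (intro integral_cong_AE measurable_cdot)
      (auto simp: L2_rel_def square_integrable_def)
  then show "(\<integral>x. (\<Sum>k\<in>UNIV. f x $ k * cnj (g x $ k)) \<partial>lebesgue)
      = (\<integral>x. (\<Sum>k\<in>UNIV. f' x $ k * cnj (g' x $ k)) \<partial>lebesgue)"
    by (simp add: cdot_def)
qed

definition inner_L2 :: "L2 \<Rightarrow> L2 \<Rightarrow> real" where
  "inner_L2 f g = Re (cinner f g)"

definition norm_L2 :: "L2 \<Rightarrow> real" where
  "norm_L2 f = sqrt (inner f f)"

definition sgn_L2 :: "L2 \<Rightarrow> L2" where
  "sgn_L2 f = inverse (norm f) *\<^sub>R f"

definition dist_L2 :: "L2 \<Rightarrow> L2 \<Rightarrow> real" where
  "dist_L2 f g = norm (f - g)"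

definition uniformity_L2 :: "(L2 \<times> L2) filter" where
  "uniformity_L2 = (INF e\<in>{0<..}. principal {(f, g). dist f g < e})"

definition open_L2 :: "L2 set \<Rightarrow> bool" where
  "open_L2 U \<longleftrightarrow> (\<forall>f\<in>U. \<forall>\<^sub>F (f', g) in uniformity. f' = f \<longrightarrow> g \<in> U)"

instance
proof
  have sub: "(f - g :: L2) = f + (-1) *\<^sub>C g" for f g
    by (simp add: minus_L2_def uminus_L2_def)
  have comm: "f + g = g + f" for f g :: L2
    by transfer (simp add: L2_rel_def square_integrable_add add.commute)
  have zero: "0 + f = f" for f :: L2
    by transfer (simp add: L2_rel_def)
  have scadd: "c *\<^sub>C (f + g) = c *\<^sub>C f + c *\<^sub>C g" for c and f g :: L2
    by transfer (simp add: L2_rel_def square_integrable_add square_integrable_scaleC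
        vector_add_ldistrib)
  have addsc: "(c + d) *\<^sub>C f = c *\<^sub>C f + d *\<^sub>C f" for c d and f :: L2
    by transfer (simp add: L2_rel_def square_integrable_add square_integrable_scaleC
        vector_sadd_rdistrib)
  have scsc: "c *\<^sub>C d *\<^sub>C f = (c * d) *\<^sub>C f" for c d and f :: L2
    by transfer (simp add: L2_rel_def square_integrable_scaleC vector_smult_assoc)
  have sc1: "1 *\<^sub>C f = f" for f :: L2
    by transfer (simp add: L2_rel_def square_integrable_scaleC)
  have sc0: "0 *\<^sub>C f = 0" for f :: L2
    by transfer (simp add: L2_rel_def square_integrable_scaleC square_integrable_zero)
  have cadd: "cinner (f + g) h = cinner f h + cinner g h" for f g h :: L2
    by (transfer, subst Bochner_Integration.integral_add[symmetric])
      (auto simp: L2_rel_def integrable_cdot[unfolded cdot_def] algebra_simps sum.distrib)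
  have cscale: "cinner (c *\<^sub>C f) g = c * cinner f g" for c and f g :: L2
    by (transfer, subst integral_mult_right_zero[symmetric])
      (simp add: sum_distrib_left mult.assoc)
  have ccomm: "cinner f g = cnj (cinner g f)" for f g :: L2
  proof transfer
    fix f g :: "real^3 \<Rightarrow> complex^2"
    have "cnj (\<integral>x. (\<Sum>k\<in>UNIV. g x $ k * cnj (f x $ k)) \<partial>lebesgue)
        = (\<integral>x. cnj (\<Sum>k\<in>UNIV. g x $ k * cnj (f x $ k)) \<partial>lebesgue)"
      by (rule Bochner_Integration.integral_cnj[symmetric])
    also have "\<dots> = (\<integral>x. (\<Sum>k\<in>UNIV. f x $ k * cnj (g x $ k)) \<partial>lebesgue)"
      by (simp add: mult.commute)
    finally show "(\<integral>x. (\<Sum>k\<in>UNIV. f x $ k * cnj (g x $ k)) \<partial>lebesgue)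
        = cnj (\<integral>x. (\<Sum>k\<in>UNIV. g x $ k * cnj (f x $ k)) \<partial>lebesgue)"
      by simp
  qed
  have self: "inner f f = 0 \<longleftrightarrow> f = 0" "0 \<le> inner f f" for f :: L2
  proof -
    have eq: "inner f f = Re (cinner f f)" by (simp add: inner_L2_def)
    have "(Re (cinner f f) = 0 \<longleftrightarrow> f = 0) \<and> 0 \<le> Re (cinner f f)"
    proof (transfer)
      fix f :: "real^3 \<Rightarrow> complex^2" assume "L2_rel f f"
      then have f: "square_integrable f" by (simp add: L2_rel_refl_iff)
      have "Re (\<integral>x. (\<Sum>k\<in>UNIV. f x $ k * cnj (f x $ k)) \<partial>lebesgue)
          = Re (\<integral>x. cdot (f x) (f x) \<partial>lebesgue)"
        by (simp add: cdot_def)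
      also have "\<dots> = (\<integral>x. Re (cdot (f x) (f x)) \<partial>lebesgue)"
        by (rule integral_Re[symmetric]) (rule integrable_cdot[OF f f])
      also have "\<dots> = (\<integral>x. (norm (f x))\<^sup>2 \<partial>lebesgue)"
        by (simp add: Re_cdot power2_norm_eq_inner)
      finally have 1: "Re (\<integral>x. (\<Sum>k\<in>UNIV. f x $ k * cnj (f x $ k)) \<partial>lebesgue)
          = (\<integral>x. (norm (f x))\<^sup>2 \<partial>lebesgue)" .
      have "(\<integral>x. (norm (f x))\<^sup>2 \<partial>lebesgue) = 0 \<longleftrightarrow> (AE x in lebesgue. f x = 0)"
        using f by (subst integral_nonneg_eq_0_iff_AE) (auto simp: square_integrable_def)
      then show "(Re (\<integral>x. (\<Sum>k\<in>UNIV. f x $ k * cnj (f x $ k)) \<partial>lebesgue) = 0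
          \<longleftrightarrow> L2_rel f (\<lambda>x. 0))
          \<and> 0 \<le> Re (\<integral>x. (\<Sum>k\<in>UNIV. f x $ k * cnj (f x $ k)) \<partial>lebesgue)"
        unfolding 1 by (auto simp: L2_rel_def f square_integrable_zero)
    qed
    then show "inner f f = 0 \<longleftrightarrow> f = 0" "0 \<le> inner f f" by (simp_all add: eq)
  qed
  fix f g h :: L2 and c d :: complex and a b :: real
  show "f + g + h = f + (g + h)"
    by transfer (simp add: L2_rel_def square_integrable_add add.assoc)
  show "f + g = g + f" by (rule comm)
  show "0 + f = f" by (rule zero)
  show "- f + f = 0"
    using addsc[of "-1" 1 f] by (simp add: uminus_L2_def sc1 sc0)
  show "f - g = f + - g" by (simp add: minus_L2_def)
  show "a *\<^sub>R (f + g) = a *\<^sub>R f + a *\<^sub>R g" by (simp add: scaleR_L2_def scadd)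
  show "(a + b) *\<^sub>R f = a *\<^sub>R f + b *\<^sub>R f" by (simp add: scaleR_L2_def addsc)
  show "a *\<^sub>R b *\<^sub>R f = (a * b) *\<^sub>R f" by (simp add: scaleR_L2_def scsc)
  show "1 *\<^sub>R f = f" by (simp add: scaleR_L2_def sc1)
  show "sgn f = inverse (norm f) *\<^sub>R f" by (rule sgn_L2_def)
  show "dist f g = norm (f - g)" by (rule dist_L2_def)
  show "(uniformity :: (L2 \<times> L2) filter) = (INF e\<in>{0<..}. principal {(x, y). dist x y < e})"
    by (rule uniformity_L2_def)
  show "open U \<longleftrightarrow> (\<forall>x\<in>U. \<forall>\<^sub>F (x', y) in uniformity. x' = x \<longrightarrow> y \<in> U)" for U :: "L2 set"
    by (rule open_L2_def)
  show "inner f g = inner g f"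
    using ccomm[of f g] by (simp add: inner_L2_def)
  show "inner (f + g) h = inner f h + inner g h" by (simp add: inner_L2_def cadd)
  show "inner (a *\<^sub>R f) g = a * inner f g"
    by (simp add: inner_L2_def scaleR_L2_def cscale)
  show "0 \<le> inner f f" "inner f f = 0 \<longleftrightarrow> f = 0" by (rule self)+
  show "norm f = sqrt (inner f f)" by (rule norm_L2_def)
  show "c *\<^sub>C (f + g) = c *\<^sub>C f + c *\<^sub>C g" by (rule scadd)
  show "(c + d) *\<^sub>C f = c *\<^sub>C f + d *\<^sub>C f" by (rule addsc)
  show "c *\<^sub>C d *\<^sub>C f = (c * d) *\<^sub>C f" by (rule scsc)
  show "a *\<^sub>R f = complex_of_real a *\<^sub>C f" by (rule scaleR_L2_def)
  show "cinner f g = cnj (cinner g f)" by (rule ccomm)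
  show "cinner (f + g) h = cinner f h + cinner g h" by (rule cadd)
  show "cinner (c *\<^sub>C f) g = c * cinner f g" by (rule cscale)
  show "Re (cinner f g) = inner f g" by (simp add: inner_L2_def)
qed

end

lift_definition L2_matrix :: "complex^2^2 \<Rightarrow> L2 \<Rightarrow> L2" is "\<lambda>M f x. M *v f x"
  by (auto simp: L2_rel_def square_integrable_matrix elim: eventually_mono)

text \<open>For a multiplier outside \<open>L_infinity\<close> the product with an element of \<open>L2\<close> need not
  lie in \<open>L2\<close>; the totalised function is then \<open>0\<close>.\<close>

lift_definition L2_mult :: "(real^3 \<Rightarrow> complex) \<Rightarrow> L2 \<Rightarrow> L2"
  is "\<lambda>V f x. if V \<in> L_infinity then V x *s f x else 0"
proof -
  fix V and f g :: "real^3 \<Rightarrow> complex^2" assume "L2_rel f g"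
  then show "L2_rel (\<lambda>x. if V \<in> L_infinity then V x *s f x else 0)
      (\<lambda>x. if V \<in> L_infinity then V x *s g x else 0)"
    by (cases "V \<in> L_infinity")
      (auto simp: L2_rel_def square_integrable_mult square_integrable_zero elim: eventually_mono)
qed

section \<open>Weak derivatives and the Sobolev space\<close>

definition partial_deriv :: "'n::finite \<Rightarrow> (real^'n \<Rightarrow> real) \<Rightarrow> real^'n \<Rightarrow> real" where
  "partial_deriv j \<phi> x = frechet_derivative \<phi> (at x) (axis j 1)"

primrec C_k :: "nat \<Rightarrow> (real^'n::finite \<Rightarrow> real) \<Rightarrow> bool" where
  "C_k 0 \<phi> \<longleftrightarrow> continuous_on UNIV \<phi>"
| "C_k (Suc k) \<phi> \<longleftrightarrow> \<phi> differentiable_on UNIV \<and> (\<forall>j. C_k k (partial_deriv j \<phi>))"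

definition test_function :: "(real^'n::finite \<Rightarrow> real) \<Rightarrow> bool" where
  "test_function \<phi> \<longleftrightarrow> (\<forall>k. C_k k \<phi>) \<and> compact (closure {x. \<phi> x \<noteq> 0})"

text \<open>Testing against real-valued functions is the same as testing against complex-valued
  ones, since both sides are linear in the test function.\<close>

definition has_weak_partial_fun ::
    "3 \<Rightarrow> (real^3 \<Rightarrow> complex^2) \<Rightarrow> (real^3 \<Rightarrow> complex^2) \<Rightarrow> bool" where
  "has_weak_partial_fun j f g \<longleftrightarrow> (\<forall>\<phi>. test_function \<phi> \<longrightarrow>
     (\<integral>x. partial_deriv j \<phi> x *\<^sub>R f x \<partial>lebesgue) = - (\<integral>x. \<phi> x *\<^sub>R g x \<partial>lebesgue))"

lemma has_weak_partial_fun_cong: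
  assumes f: "L2_rel f f'" and g: "L2_rel g g'"
  shows "has_weak_partial_fun j f g = has_weak_partial_fun j f' g'"
proof -
  have *: "(\<integral>x. h x *\<^sub>R u x \<partial>lebesgue) = (\<integral>x. h x *\<^sub>R v x \<partial>lebesgue)"
    if h: "continuous_on UNIV h" and uv: "L2_rel u v" for h :: "real^3 \<Rightarrow> real" and u v
  proof (rule integral_cong_AE)
    have "h \<in> borel_measurable lebesgue"
      using borel_measurable_continuous_onI[OF h] by (simp add: measurable_completion)
    then show "(\<lambda>x. h x *\<^sub>R u x) \<in> borel_measurable lebesgue"
      "(\<lambda>x. h x *\<^sub>R v x) \<in> borel_measurable lebesgue"
      using uv by (auto simp: L2_rel_def square_integrable_def)
    show "AE x in lebesgue. h x *\<^sub>R u x = h x *\<^sub>R v x"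
      using uv by (auto simp: L2_rel_def elim: eventually_mono)
  qed
  have cont: "continuous_on UNIV \<phi>" "continuous_on UNIV (partial_deriv j \<phi>)"
    if "test_function \<phi>" for \<phi> :: "real^3 \<Rightarrow> real"
  proof -
    have "C_k 0 \<phi>" "C_k (Suc 0) \<phi>"
      using that unfolding test_function_def by blast+
    then show "continuous_on UNIV \<phi>" "continuous_on UNIV (partial_deriv j \<phi>)" by simp_all
  qed
  have eq: "(\<integral>x. partial_deriv j \<phi> x *\<^sub>R f x \<partial>lebesgue)
        = (\<integral>x. partial_deriv j \<phi> x *\<^sub>R f' x \<partial>lebesgue)"
      "(\<integral>x. \<phi> x *\<^sub>R g x \<partial>lebesgue) = (\<integral>x. \<phi> x *\<^sub>R g' x \<partial>lebesgue)"
    if "test_function \<phi>" for \<phi>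
    by (rule *[OF cont(2)[OF that] f], rule *[OF cont(1)[OF that] g])
  show ?thesis
    unfolding has_weak_partial_fun_def using eq by simp
qed

lift_definition has_weak_partial :: "3 \<Rightarrow> L2 \<Rightarrow> L2 \<Rightarrow> bool" is has_weak_partial_fun
  by (rule has_weak_partial_fun_cong)

text \<open>Weak derivatives are unique, so \<open>weak_partial j f\<close> is the weak derivative whenever
  one exists.\<close>

definition weak_partial :: "3 \<Rightarrow> L2 \<Rightarrow> L2" where
  "weak_partial j f = (THE g. has_weak_partial j f g)"

definition W12 :: "L2 set" where
  "W12 = {f. \<forall>j. \<exists>g. has_weak_partial j f g}"

section \<open>The Dirac operator\<close>

definition pauli :: "3 \<Rightarrow> complex^2^2" where
  "pauli j =
     (if j = 1 then vector [vector [0, 1], vector [1, 0]]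
      else if j = 2 then vector [vector [0, - \<i>], vector [\<i>, 0]]
      else vector [vector [1, 0], vector [0, - 1]])"

definition sigma_p :: "L2 \<Rightarrow> L2" where
  "sigma_p f = (- \<i>) *\<^sub>C (\<Sum>j\<in>UNIV. L2_matrix (pauli j) (weak_partial j f))"

definition dirac :: "(real^3 \<Rightarrow> complex) \<Rightarrow> (L2 \<times> L2) operator" where
  "dirac V = Operator (W12 \<times> W12)
     (\<lambda>(f, g). ((f + L2_mult V f) + sigma_p g, sigma_p f + (- g + L2_mult V g)))"

definition B_rot :: "real \<Rightarrow> (L2 \<times> L2) operator" where
  "B_rot \<theta> = Operator UNIV
     (\<lambda>(f, g). (exp (- (\<i> * complex_of_real \<theta>)) *\<^sub>C f, exp (\<i> * complex_of_real \<theta>) *\<^sub>C g))"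

section \<open>Essential range, sectors and supporting lines\<close>

definition essran :: "(real^3 \<Rightarrow> complex) \<Rightarrow> complex set" where
  "essran V = {w. \<forall>\<epsilon>>0. emeasure lebesgue {x. dist (V x) w < \<epsilon>} > 0}"

definition Sigma_minus :: "(real^3 \<Rightarrow> complex) \<Rightarrow> complex set" where
  "Sigma_minus V = {complex_of_real t + w | t w. t \<le> -1 \<and> w \<in> convex hull (essran V)}"

definition Sigma_plus :: "(real^3 \<Rightarrow> complex) \<Rightarrow> complex set" where
  "Sigma_plus V = {complex_of_real t + w | t w. t \<ge> 1 \<and> w \<in> convex hull (essran V)}"

definition Sigma_set :: "(real^3 \<Rightarrow> complex) \<Rightarrow> complex set" where
  "Sigma_set V = Sigma_minus V \<union> Sigma_plus V"

definition sector :: "real \<Rightarrow> real \<Rightarrow> complex \<Rightarrow> complex set" where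
  "sector \<theta>1 \<theta>2 z = {z + w | w. w \<noteq> 0 \<and> \<theta>1 < Arg w \<and> Arg w < \<theta>2}"

definition ray :: "complex \<Rightarrow> real \<Rightarrow> complex set" where
  "ray z \<theta> = {z + exp (\<i> * complex_of_real \<theta>) * complex_of_real t | t. t \<ge> 0}"

text \<open>A supporting line is not required to be proper: it may contain \<open>C\<close>. This happens for
  instance for real constant \<open>V\<close>, where \<open>Sigma_plus V\<close> and \<open>Sigma_minus V\<close> are
  subsets of the real line.\<close>

definition supporting_line :: "complex set \<Rightarrow> complex set \<Rightarrow> bool" where
  "supporting_line L C \<longleftrightarrow>
     (\<exists>a b. a \<noteq> 0 \<and> L = {w. inner a w = b} \<and> C \<subseteq> {w. inner a w \<le> b} \<and> L \<inter> C \<noteq> {})"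

definition tangential :: "complex set \<Rightarrow> complex set \<Rightarrow> bool" where
  "tangential R C \<longleftrightarrow> R \<inter> C \<noteq> {} \<and> supporting_line (affine hull R) C"

definition upper_sector :: "real \<Rightarrow> complex \<Rightarrow> complex set" where
  "upper_sector \<phi> z = sector \<phi> (pi - \<phi>) z"

definition lower_sector :: "real \<Rightarrow> complex \<Rightarrow> complex set" where
  "lower_sector \<phi> z = sector (- pi + \<phi>) (- \<phi>) z"

definition upper_admissible :: "(real^3 \<Rightarrow> complex) \<Rightarrow> complex \<Rightarrow> real \<Rightarrow> bool" where
  "upper_admissible V z \<phi> \<longleftrightarrow>
     0 \<le> \<phi> \<and> \<phi> < pi / 2 \<and> upper_sector \<phi> z \<subseteq> - Sigma_set V
     \<and> tangential (ray z (pi - \<phi>)) (Sigma_minus V) \<and> tangential (ray z \<phi>) (Sigma_plus V)"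

definition lower_admissible :: "(real^3 \<Rightarrow> complex) \<Rightarrow> complex \<Rightarrow> real \<Rightarrow> bool" where
  "lower_admissible V z \<phi> \<longleftrightarrow>
     0 \<le> \<phi> \<and> \<phi> < pi / 2 \<and> lower_sector \<phi> z \<subseteq> - Sigma_set V
     \<and> tangential (ray z (- (pi - \<phi>))) (Sigma_minus V)
     \<and> tangential (ray z (- \<phi>)) (Sigma_plus V)"

definition admissible_sectors :: "(real^3 \<Rightarrow> complex) \<Rightarrow> complex set set" where
  "admissible_sectors V =
     {upper_sector \<phi> z | z \<phi>. upper_admissible V z \<phi>}
     \<union> {lower_sector \<phi> z | z \<phi>. lower_admissible V z \<phi>}"

definition Sigma_tilde :: "(real^3 \<Rightarrow> complex) \<Rightarrow> complex set" where
  "Sigma_tilde V = - \<Union> (admissible_sectors V)"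

end

theory Submission
  imports Defs
begin

text \<open>Put \<open>P = \<sigma> \<cdot> (- i \<nabla>)\<close>. Rotating the two components of the equation by \<open>B\<^sub>\<phi>\<close> turns the
  off-diagonal part of the form of \<open>B\<^sub>\<phi> (T - \<lambda>)\<close> into a real number, because \<open>P\<close> is symmetric. The
  imaginary part is then an integral against \<open>1 + V - \<lambda>\<close> and \<open>- 1 + V - \<lambda>\<close>, whose values are kept on
  one side of the boundary lines of the sector; it is bounded away from \<open>0\<close> by the distance of
  \<open>\<lambda>\<close> to the boundary. This gives the statement on the pencil and a lower bound for \<open>T - \<lambda>\<close>. If
  \<open>v\<close> is orthogonal to the range of \<open>T - \<lambda>\<close>, self-adjointness of \<open>P\<close> puts \<open>v\<close> into the domain, and
  testing against \<open>B\<^sub>\<phi> v\<close> yields \<open>v = 0\<close>; hence \<open>T - \<lambda>\<close> is onto.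

  Self-adjointness of \<open>P\<close> is obtained without the Fourier transform. A weak derivative is the weak
  limit of difference quotients of translations, so the weak derivatives are skew, commute with all
  translation-invariant operators, and satisfy \<open>\<parallel>P f\<parallel>\<^sup>2 = \<Sum>\<^sub>j \<parallel>\<partial>\<^sub>j f\<parallel>\<^sup>2\<close>, whence \<open>P\<close> is closed on the
  Sobolev space. The resolvents \<open>(1 - \<partial>\<^sub>j)\<^sup>-\<^sup>1\<close> exist since \<open>1 - \<partial>\<^sub>j\<close> is bounded below and its adjoint on
  test functions is again a weak derivative. Their product maps into the Sobolev space and commutes
  with \<open>P\<close>, so it moves a vector orthogonal to the range of \<open>P \<mp> i\<close> into the domain.\<close>

section \<open>Hilbert space preliminaries\<close>

text \<open>Orthogonality always refers to the real inner product, and imaginary parts are recovered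
  by inserting \<open>\<i>\<close> in one factor. Hence a criterion for real-linear operators is
  enough for all three surjectivity statements. The obstacle is that integration by parts is known
  at first only when one factor is a test function, whereas symmetry and closedness of
  \<open>P\<close> concern arbitrary elements of the Sobolev space. Density of test functions in the
  graph norm is bypassed: the adjoint of a difference quotient is minus the quotient for the
  opposite step, so weak convergence with the other factor held fixed extends the identity to all
  pairs. Second derivatives are avoided in the same way: in a mixed term one derivative is replaced
  by a difference quotient before anything is moved. The smoothing operator is not symmetric,
  because the adjoint of \<open>(1 - \<partial>\<^sub>j)\<^sup>-\<^sup>1\<close> is
  \<open>(1 + \<partial>\<^sub>j)\<^sup>-\<^sup>1\<close>. This is why translation-invariant
  operators are carried in pairs with an adjoint.\<close>

lemma subspace_eq_UNIV_if_no_orthogonal: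
  fixes M :: "'a::{real_inner, complete_space} set"
  assumes M: "subspace M" "closed M"
    and orth: "\<And>v. (\<And>m. m \<in> M \<Longrightarrow> inner v m = 0) \<Longrightarrow> v = 0"
  shows "M = UNIV"
proof -
  have "x \<in> M" for x
  proof -
    have ne: "M \<noteq> {}" using subspace_0[OF M(1)] by blast
    define d where "d = infdist x M"
    have d0: "0 \<le> d" by (simp add: d_def infdist_nonneg)
    have dle: "d \<le> norm (x - m)" if "m \<in> M" for m
      using infdist_le[OF that, of x] by (simp add: d_def dist_norm)
    have "\<exists>m\<in>M. norm (x - m) < d + 1 / real (Suc n)" for n
    proof (rule ccontr)
      assume "\<not> ?thesis"
      then have "d + 1 / real (Suc n) \<le> infdist x M"
        unfolding infdist_notempty[OF ne] using ne
        by (intro cINF_greatest) (auto simp: dist_norm not_less)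
      then show False by (simp add: d_def)
    qed
    then obtain s where s: "\<And>n. s n \<in> M" "\<And>n. norm (x - s n) < d + 1 / real (Suc n)"
      by metis
    define \<delta> where "\<delta> n = 1 / real (Suc n)" for n
    have lim\<delta>: "\<delta> \<longlonglongrightarrow> 0"
      unfolding \<delta>_def by (rule LIMSEQ_inverse_real_of_nat[unfolded inverse_eq_divide])
    have est: "(norm (s m - s n))\<^sup>2 \<le> 2 * (d + \<delta> m)\<^sup>2 + 2 * (d + \<delta> n)\<^sup>2 - 4 * d\<^sup>2" for m n
    proof -
      have "(1/2) *\<^sub>R (s m + s n) \<in> M"
        using s(1) M(1) by (simp add: subspace_add subspace_scale)
      then have "d\<^sup>2 \<le> (norm (x - (1/2) *\<^sub>R (s m + s n)))\<^sup>2"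
        using dle d0 by (intro power_mono) auto
      moreover have "(norm (x - s m))\<^sup>2 \<le> (d + \<delta> m)\<^sup>2" "(norm (x - s n))\<^sup>2 \<le> (d + \<delta> n)\<^sup>2"
        using s(2)[of m] s(2)[of n] by (auto simp: \<delta>_def intro!: power_mono)
      \<comment> \<open>Parallelogram law for \<open>x - s m\<close> and \<open>x - s n\<close>. The
        midpoint of \<open>s m\<close> and \<open>s n\<close> stays in \<open>M\<close>, so its
        distance to \<open>x\<close> is at least \<open>d\<close>; this makes the minimizing
        sequence Cauchy.\<close>
      moreover have "(norm (s m - s n))\<^sup>2 = 2 * (norm (x - s m))\<^sup>2 + 2 * (norm (x - s n))\<^sup>2
          - 4 * (norm (x - (1/2) *\<^sub>R (s m + s n)))\<^sup>2"
      proof -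
        have par: "(norm (b - a))\<^sup>2 = 2 * (norm a)\<^sup>2 + 2 * (norm b)\<^sup>2
            - 4 * (norm ((1/2) *\<^sub>R (a + b)))\<^sup>2" for a b :: 'a
          unfolding power2_norm_eq_inner
          by (simp add: inner_diff_left inner_diff_right inner_add_left inner_add_right
              inner_commute[of b a] field_simps)
        have "(x - s m) + (x - s n) = 2 *\<^sub>R x - (s m + s n)"
          by (simp add: scaleR_2)
        then have "s m - s n = (x - s n) - (x - s m)"
          "x - (1/2) *\<^sub>R (s m + s n) = (1/2) *\<^sub>R ((x - s m) + (x - s n))"
          by (simp_all only: scaleR_right_diff_distrib) simp_all
        then show ?thesis by (simp only: par)
      qed
      ultimately show ?thesis by linarith
    qed
    have "Cauchy s"
    proof (rule metric_CauchyI)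
      fix e :: real assume e: "0 < e"
      have "(\<lambda>n. 4 * (d + \<delta> n)\<^sup>2 - 4 * d\<^sup>2) \<longlonglongrightarrow> 4 * (d + 0)\<^sup>2 - 4 * d\<^sup>2"
        by (intro tendsto_intros lim\<delta>)
      then have "\<forall>\<^sub>F n in sequentially. 4 * (d + \<delta> n)\<^sup>2 - 4 * d\<^sup>2 < e\<^sup>2"
        using e by (intro order_tendstoD(2)) auto
      then obtain N where N: "4 * (d + \<delta> N)\<^sup>2 - 4 * d\<^sup>2 < e\<^sup>2"
        by (auto simp: eventually_sequentially)
      have "dist (s m) (s n) < e" if "m \<ge> N" "n \<ge> N" for m n
      proof -
        have "\<delta> m \<le> \<delta> N" "\<delta> n \<le> \<delta> N" "0 \<le> \<delta> m" "0 \<le> \<delta> n"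
          using that by (auto simp: \<delta>_def field_simps)
        then have "(d + \<delta> m)\<^sup>2 \<le> (d + \<delta> N)\<^sup>2" "(d + \<delta> n)\<^sup>2 \<le> (d + \<delta> N)\<^sup>2"
          using d0 by (auto intro!: power_mono)
        then have "(norm (s m - s n))\<^sup>2 < e\<^sup>2" using est[of m n] N by linarith
        then show ?thesis using e by (simp add: dist_norm power_less_imp_less_base)
      qed
      then show "\<exists>N. \<forall>m\<ge>N. \<forall>n\<ge>N. dist (s m) (s n) < e" by blast
    qed
    then obtain p where p: "s \<longlonglongrightarrow> p" using Cauchy_convergent convergent_def by blast
    have pM: "p \<in> M" using closed_sequentially[OF M(2)] s(1) p by blast
    have "norm (x - p) \<le> d + 0"
    proof (rule LIMSEQ_le)
      show "(\<lambda>n. norm (x - s n)) \<longlonglongrightarrow> norm (x - p)" by (intro tendsto_intros p)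
      show "(\<lambda>n. d + \<delta> n) \<longlonglongrightarrow> d + 0" by (intro tendsto_intros lim\<delta>)
      show "\<exists>N. \<forall>n\<ge>N. norm (x - s n) \<le> d + \<delta> n"
        using s(2) by (auto simp: \<delta>_def less_imp_le)
    qed
    then have np: "norm (x - p) \<le> norm (x - q)" if "q \<in> M" for q using dle[OF that] by simp
    have "inner (x - p) w = 0" if w: "w \<in> M" for w
    proof (cases "w = 0")
      case False
      \<comment> \<open>The minimizer of the quadratic function
        \<open>norm (x - (p + t *\<^sub>R w))\<close> squared. Since \<open>p\<close> is already
        nearest, the gain at this \<open>t\<close> must vanish.\<close>
      define t where "t = inner (x - p) w / inner w w"
      have ww: "inner w w > 0" using False by simp
      have "p + t *\<^sub>R w \<in> M" using pM w M(1) by (simp add: subspace_add subspace_scale)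
      then have "(norm (x - p))\<^sup>2 \<le> (norm (x - (p + t *\<^sub>R w)))\<^sup>2"
        using np by (intro power_mono) auto
      also have "\<dots> = (norm (x - p))\<^sup>2 - 2 * t * inner (x - p) w + t\<^sup>2 * inner w w"
      proof -
        have "(norm (q - t *\<^sub>R w))\<^sup>2 = (norm q)\<^sup>2 - 2 * t * inner q w + t\<^sup>2 * inner w w" for q
          unfolding power2_norm_eq_inner
          by (simp add: inner_diff_left inner_diff_right inner_commute[of w q] power2_eq_square algebra_simps)
        then show ?thesis by (simp only: diff_diff_eq[symmetric])
      qed
      also have "\<dots> = (norm (x - p))\<^sup>2 - (inner (x - p) w)\<^sup>2 / inner w w"
        using ww by (simp add: t_def power2_eq_square field_simps)
      finally have "(inner (x - p) w)\<^sup>2 / inner w w \<le> 0" by simp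
      then show ?thesis using ww by (simp add: divide_le_0_iff)
    qed simp
    then have "x - p = 0" by (rule orth)
    then show "x \<in> M" using pM by simp
  qed
  then show ?thesis by blast
qed

text \<open>The lower bound makes preimages of a convergent sequence Cauchy. The hypothesis
  \<open>graph\<close> is closedness of the operator \<open>X\<close> with domain \<open>D\<close>,
  which takes the place of continuity.\<close>

lemma closed_image_if_bounded_below:
  fixes X :: "'a::{real_normed_vector, complete_space} \<Rightarrow> 'b::real_normed_vector"
  assumes D: "subspace D" and c: "0 < c"
    and diff: "\<And>u v. u \<in> D \<Longrightarrow> v \<in> D \<Longrightarrow> X (u - v) = X u - X v"
    and below: "\<And>u. u \<in> D \<Longrightarrow> c * norm u \<le> norm (X u)"
    and graph: "\<And>s u y. (\<And>n::nat. s n \<in> D) \<Longrightarrow> s \<longlonglongrightarrow> u \<Longrightarrow> (\<lambda>n. X (s n)) \<longlonglongrightarrow> y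
      \<Longrightarrow> u \<in> D \<and> X u = y"
  shows "closed (X ` D)"
  unfolding closed_sequential_limits
proof (intro allI impI, elim conjE)
  fix t y assume t: "\<forall>n. t n \<in> X ` D" and ty: "t \<longlonglongrightarrow> y"
  then have "\<forall>n. \<exists>u. u \<in> D \<and> t n = X u" by blast
  then obtain s where s: "\<And>n. s n \<in> D" "\<And>n. t n = X (s n)" by (auto dest!: choice)
  have "Cauchy s"
  proof (rule metric_CauchyI)
    fix e :: real assume "0 < e"
    then have "0 < c * e" using c by simp
    then obtain N where N: "\<forall>m\<ge>N. \<forall>n\<ge>N. dist (t m) (t n) < c * e"
      using LIMSEQ_imp_Cauchy[OF ty] metric_CauchyD by blast
    have "dist (s m) (s n) < e" if "m \<ge> N" "n \<ge> N" for m n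
    proof -
      have "c * norm (s m - s n) \<le> norm (X (s m - s n))"
        using D s(1) by (intro below subspace_diff)
      also have "\<dots> = dist (t m) (t n)" using s diff by (simp add: dist_norm)
      also have "\<dots> < c * e" using N that by blast
      finally show ?thesis using c by (simp add: dist_norm)
    qed
    then show "\<exists>N. \<forall>m\<ge>N. \<forall>n\<ge>N. dist (s m) (s n) < e" by blast
  qed
  then obtain u where "s \<longlonglongrightarrow> u" using Cauchy_convergent convergent_def by blast
  moreover have "t = (\<lambda>n. X (s n))" using s(2) by auto
  ultimately have "u \<in> D \<and> X u = y" using ty s(1) by (intro graph[of s]) auto
  then show "y \<in> X ` D" by blast
qed

text \<open>The range is closed and has trivial orthogonal complement. Applied to the resolvents of
  a single derivative, to \<open>P \<mp> \<i>\<close> and to the shifted Dirac operator; each time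
  the substance lies in \<open>orth\<close>, where a vector must first be shown to belong to the
  domain.\<close>

lemma surj_if_bounded_below:
  fixes X :: "'a::{real_normed_vector, complete_space} \<Rightarrow> 'b::{real_inner, complete_space}"
  assumes D: "subspace D" and c: "0 < c"
    and add: "\<And>u v. u \<in> D \<Longrightarrow> v \<in> D \<Longrightarrow> X (u + v) = X u + X v"
    and scale: "\<And>r u. u \<in> D \<Longrightarrow> X (r *\<^sub>R u) = r *\<^sub>R X u"
    and below: "\<And>u. u \<in> D \<Longrightarrow> c * norm u \<le> norm (X u)"
    and graph: "\<And>s u y. (\<And>n::nat. s n \<in> D) \<Longrightarrow> s \<longlonglongrightarrow> u \<Longrightarrow> (\<lambda>n. X (s n)) \<longlonglongrightarrow> y
      \<Longrightarrow> u \<in> D \<and> X u = y"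
    and orth: "\<And>v. (\<And>u. u \<in> D \<Longrightarrow> inner v (X u) = 0) \<Longrightarrow> v = 0"
  shows "X ` D = UNIV"
proof (rule subspace_eq_UNIV_if_no_orthogonal)
  have diff: "X (u - v) = X u - X v" if "u \<in> D" "v \<in> D" for u v
    using add[OF that(1), of "(-1) *\<^sub>R v"] scale[OF that(2), of "-1"] that D
    by (simp add: subspace_neg)
  show "closed (X ` D)"
    by (rule closed_image_if_bounded_below[OF D c]) (fact diff below graph)+
  show "subspace (X ` D)"
    unfolding subspace_def
  proof (intro conjI ballI allI)
    show "0 \<in> X ` D" using scale[OF subspace_0[OF D], of 0] subspace_0[OF D] by force
    show "x + y \<in> X ` D" if "x \<in> X ` D" "y \<in> X ` D" for x y
      using that add subspace_add[OF D] by (auto simp flip: add)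
    show "c *\<^sub>R x \<in> X ` D" if "x \<in> X ` D" for x c
      using that subspace_scale[OF D] by (auto simp flip: scale)
  qed
  show "v = 0" if "\<And>m. m \<in> X ` D \<Longrightarrow> inner v m = 0" for v
    using that by (intro orth) blast
qed

section \<open>Complex scalars and the real inner product\<close>

lemma scaleC_one [simp]: "1 *\<^sub>C (x :: 'a::complex_inner) = x"
  using scaleR_scaleC[of 1 x] by simp

lemma scaleC_zero_left [simp]: "0 *\<^sub>C (x :: 'a::complex_inner) = 0"
  using scaleR_scaleC[of 0 x] by simp

lemma scaleC_zero_right [simp]: "c *\<^sub>C (0 :: 'a::complex_inner) = 0"
  using scaleC_add_right[of c "0::'a" 0] by simp

lemma scaleC_minus_right: "c *\<^sub>C (- x :: 'a::complex_inner) = - (c *\<^sub>C x)"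
  using scaleC_add_right[of c x "- x"] by (simp add: eq_neg_iff_add_eq_0 add.commute)

lemma scaleC_minus_left: "(- c) *\<^sub>C (x :: 'a::complex_inner) = - (c *\<^sub>C x)"
  using scaleC_add_left[of c "- c" x] by (simp add: eq_neg_iff_add_eq_0 add.commute)

lemma scaleC_diff_right: "c *\<^sub>C (x - y :: 'a::complex_inner) = c *\<^sub>C x - c *\<^sub>C y"
  using scaleC_add_right[of c x "- y"] by (simp add: scaleC_minus_right)

lemma scaleC_diff_left: "(c - d) *\<^sub>C (x :: 'a::complex_inner) = c *\<^sub>C x - d *\<^sub>C x"
  using scaleC_add_left[of c "- d" x] by (simp add: scaleC_minus_left)

lemma scaleC_scaleR: "c *\<^sub>C (r *\<^sub>R x :: 'a::complex_inner) = r *\<^sub>R c *\<^sub>C x"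
  by (simp add: scaleR_scaleC scaleC_scaleC mult.commute)

lemma scaleC_sum_right: "c *\<^sub>C sum f I = (\<Sum>i\<in>I. c *\<^sub>C f i :: 'a::complex_inner)"
  by (induction I rule: infinite_finite_induct) (auto simp: scaleC_add_right)

lemma cinner_scaleC_right: "cinner x (c *\<^sub>C y) = cnj c * cinner x y"
  by (metis cinner_commute cinner_scaleC_left complex_cnj_mult)

lemma inner_scaleC_left: "inner (c *\<^sub>C x) y = inner x (cnj c *\<^sub>C y)" for x :: "'a::complex_inner"
  by (simp flip: Re_cinner add: cinner_scaleC_left cinner_scaleC_right)

lemma inner_scaleC_right: "inner x (c *\<^sub>C y) = inner (cnj c *\<^sub>C x) y" for x :: "'a::complex_inner"
  by (simp add: inner_scaleC_left)

lemma Im_cinner: "Im (cinner x y) = inner x (\<i> *\<^sub>C y)"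
  by (simp flip: Re_cinner add: cinner_scaleC_right)

lemma norm_scaleC: "norm (c *\<^sub>C x :: 'a::complex_inner) = norm c * norm x"
proof -
  have "(norm (c *\<^sub>C x))\<^sup>2 = inner x ((cnj c * c) *\<^sub>C x)"
    unfolding power2_norm_eq_inner inner_scaleC_left by (simp add: scaleC_scaleC)
  also have "cnj c * c = complex_of_real ((norm c)\<^sup>2)"
    by (simp only: complex_norm_square mult.commute)
  finally have "(norm (c *\<^sub>C x))\<^sup>2 = (norm c * norm x)\<^sup>2"
    by (simp flip: scaleR_scaleC add: power_mult_distrib power2_norm_eq_inner)
  then show ?thesis by (simp add: power2_eq_iff_nonneg)
qed

lemma bounded_linear_scaleC: "bounded_linear (\<lambda>x :: 'a::complex_inner. c *\<^sub>C x)"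
  by (rule bounded_linear_intro[where K = "norm c"])
    (auto simp: scaleC_add_right scaleC_scaleR norm_scaleC mult.commute)

lemma tendsto_scaleC: "(f \<longlongrightarrow> l) F \<Longrightarrow> ((\<lambda>x. c *\<^sub>C f x :: 'a::complex_inner) \<longlongrightarrow> c *\<^sub>C l) F"
  by (rule bounded_linear.tendsto[OF bounded_linear_scaleC])

section \<open>The space of square-integrable spinors\<close>

lemma L2_rep: obtains f where "square_integrable f" "F = abs_L2 f"
proof
  show "square_integrable (rep_L2 F)"
    using Quotient_rep_reflp[OF Quotient_L2] L2_rel_refl_iff by blast
  show "F = abs_L2 (rep_L2 F)"
    by (simp add: Quotient_abs_rep[OF Quotient_L2])
qed

lemma abs_L2_eq_iff:
  assumes "square_integrable f" "square_integrable g"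
  shows "abs_L2 f = abs_L2 g \<longleftrightarrow> (AE x in lebesgue. f x = g x)"
  using Quotient_rel[OF Quotient_L2, of f g] assms by (simp add: L2_rel_def)

lemma square_integrable_diff:
  assumes "square_integrable f" "square_integrable g"
  shows "square_integrable (\<lambda>x. f x - g x)"
  using square_integrable_add[OF assms(1) square_integrable_scaleC[OF assms(2), of "-1"]] by simp

lemma square_integrable_scaleR: "square_integrable f \<Longrightarrow> square_integrable (\<lambda>x. r *\<^sub>R f x)"
  by (rule square_integrable_bound[of f _ "\<bar>r\<bar>"]) (auto simp: square_integrable_def)

lemma vec_scaleR_complex: "complex_of_real r *s u = r *\<^sub>R (u :: complex^'n)"
  by (simp add: vec_eq_iff complex_eq_iff)

lemma abs_L2_zero: "0 = abs_L2 (\<lambda>x. 0)"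
  by (simp add: zero_L2_def)

lemma abs_L2_add:
  "square_integrable f \<Longrightarrow> square_integrable g \<Longrightarrow> abs_L2 f + abs_L2 g = abs_L2 (\<lambda>x. f x + g x)"
  by (rule plus_L2.abs_eq) (simp_all add: L2_rel_refl_iff)

lemma abs_L2_scaleC: "square_integrable f \<Longrightarrow> c *\<^sub>C abs_L2 f = abs_L2 (\<lambda>x. c *s f x)"
  by (rule scaleC_L2.abs_eq) (simp add: L2_rel_refl_iff)

lemma abs_L2_scaleR: "square_integrable f \<Longrightarrow> r *\<^sub>R abs_L2 f = abs_L2 (\<lambda>x. r *\<^sub>R f x)"
  by (simp add: scaleR_L2_def abs_L2_scaleC vec_scaleR_complex)

lemma abs_L2_diff:
  assumes "square_integrable f" "square_integrable g"
  shows "abs_L2 f - abs_L2 g = abs_L2 (\<lambda>x. f x - g x)"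
  using abs_L2_add[OF square_integrable_diff[OF assms] assms(2)] by (simp add: diff_eq_eq)

lemma abs_L2_matrix: "square_integrable f \<Longrightarrow> L2_matrix M (abs_L2 f) = abs_L2 (\<lambda>x. M *v f x)"
  by (rule L2_matrix.abs_eq) (simp add: L2_rel_refl_iff)

lemma abs_L2_mult:
  "V \<in> L_infinity \<Longrightarrow> square_integrable f \<Longrightarrow> L2_mult V (abs_L2 f) = abs_L2 (\<lambda>x. V x *s f x)"
  using L2_mult.abs_eq[of f V] by (simp add: L2_rel_refl_iff)

lemma cinner_abs_L2:
  assumes "square_integrable f" "square_integrable g"
  shows "cinner (abs_L2 f) (abs_L2 g) = (\<integral>x. cdot (f x) (g x) \<partial>lebesgue)"
  unfolding cdot_def by (rule cinner_L2.abs_eq) (simp_all add: L2_rel_refl_iff assms)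

lemma inner_abs_L2:
  assumes "square_integrable f" "square_integrable g"
  shows "inner (abs_L2 f) (abs_L2 g) = (\<integral>x. inner (f x) (g x) \<partial>lebesgue)"
  using integral_Re[OF integrable_cdot[OF assms]]
  by (simp add: Re_cdot cinner_abs_L2[OF assms] flip: Re_cinner)

lemma norm_abs_L2:
  assumes "square_integrable f"
  shows "(norm (abs_L2 f))\<^sup>2 = (\<integral>x. (norm (f x))\<^sup>2 \<partial>lebesgue)"
  unfolding power2_norm_eq_inner by (rule inner_abs_L2) fact+

lemma norm_abs_L2_nn:
  assumes "square_integrable f"
  shows "(\<integral>\<^sup>+x. ennreal ((norm (f x))\<^sup>2) \<partial>lebesgue) = ennreal ((norm (abs_L2 f))\<^sup>2)"
  using assms by (subst nn_integral_eq_integral) (auto simp: norm_abs_L2 square_integrable_def)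

section \<open>Completeness of the space of spinors\<close>

text \<open>An integral estimate controls squares of increments only. The weight
  \<open>2 ^ k\<close> makes up for the missing square root: terms tending to 0 force the increments
  below the geometric sequence \<open>(1 / sqrt 2) ^ k\<close>.\<close>

lemma convergent_if_sum_weighted_squares:
  fixes f :: "nat \<Rightarrow> 'a::banach"
  assumes "summable (\<lambda>k. 2 ^ k * (norm (f (Suc k) - f k))\<^sup>2)"
  shows "convergent f"
proof -
  have "(\<lambda>k. 2 ^ k * (norm (f (Suc k) - f k))\<^sup>2) \<longlonglongrightarrow> 0"
    by (rule summable_LIMSEQ_zero[OF assms])
  then have "\<forall>\<^sub>F k in sequentially. 2 ^ k * (norm (f (Suc k) - f k))\<^sup>2 < 1"
    by (rule order_tendstoD) simp
  then have "\<forall>\<^sub>F k in sequentially. norm (f (Suc k) - f k) \<le> (1 / sqrt 2) ^ k"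
  proof eventually_elim
    case (elim k)
    have "(norm (f (Suc k) - f k))\<^sup>2 \<le> 1 / 2 ^ k"
      using elim by (simp add: pos_le_divide_eq mult.commute)
    also have "\<dots> = ((1 / sqrt 2) ^ k)\<^sup>2"
      by (simp add: power_divide power_mult_distrib flip: power_mult)
        (simp add: mult.commute[of k] power_mult)
    finally show ?case by (rule power2_le_imp_le) simp
  qed
  then have "summable (\<lambda>k. f (Suc k) - f k)"
    by (rule summable_comparison_test_ev) (simp add: summable_geometric)
  then have "convergent (\<lambda>n. (\<Sum>k<n. f (Suc k) - f k))"
    by (simp add: summable_iff_convergent)
  then have "convergent (\<lambda>n. (f n - f 0) + f 0)"
    by (intro convergent_add convergent_const) (simp add: sum_lessThan_telescope)
  then show ?thesis by simp
qed

instance L2 :: complete_space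
proof
  fix X :: "nat \<Rightarrow> L2" assume X: "Cauchy X"
  have "\<forall>k. \<exists>N. \<forall>m\<ge>N. \<forall>n\<ge>N. dist (X m) (X n) < (1/4) ^ k"
    using X by (intro allI metric_CauchyD) auto
  then obtain N where N: "\<And>k m n. m \<ge> N k \<Longrightarrow> n \<ge> N k \<Longrightarrow> dist (X m) (X n) < (1/4) ^ k"
    by metis
  \<comment> \<open>Summing \<open>N\<close> up to \<open>k\<close> and adding \<open>k\<close>
    gives a strictly increasing index that still dominates \<open>N k\<close>.\<close>
  define r where "r k = (\<Sum>i\<le>k. N i) + k" for k
  have r: "strict_mono r" unfolding strict_mono_Suc_iff by (simp add: r_def)
  have rN: "N k \<le> r k" for k
    unfolding r_def using member_le_sum[of k "{..k}" N] by simp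
  have Xr: "dist (X (r m)) (X (r k)) < (1/4) ^ k" if "k \<le> m" for k m
    using rN[of k] strict_mono_less_eq[OF r, of k m] that by (intro N) auto
  have "\<forall>k. \<exists>f. square_integrable f \<and> X (r k) = abs_L2 f" by (metis L2_rep)
  then obtain f where f: "\<And>k. square_integrable (f k)" "\<And>k. X (r k) = abs_L2 (f k)" by metis
  have fm [measurable]: "f k \<in> borel_measurable lebesgue" for k
    using f(1)[of k] by (simp add: square_integrable_def)
  have fd: "(\<integral>\<^sup>+x. ennreal ((norm (f m x - f k x))\<^sup>2) \<partial>lebesgue) \<le> ennreal (((1/4) ^ k)\<^sup>2)"
    if "k \<le> m" for k m
    using Xr[OF that] norm_abs_L2_nn[OF square_integrable_diff[OF f(1)[of m] f(1)[of k]]] f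
    by (auto simp: dist_norm abs_L2_diff intro!: ennreal_leI power_mono)
  \<comment> \<open>The squared increments integrate to at most \<open>(1/16) ^ k\<close>, so after
    weighting the bound is \<open>(1/8) ^ k\<close>, still summable.\<close>
  define h where "h k x = 2 ^ k * (norm (f (Suc k) x - f k x))\<^sup>2" for k x
  have hm [measurable]: "h k \<in> borel_measurable lebesgue" for k
    unfolding h_def by measurable
  have "(\<integral>\<^sup>+x. (\<Sum>k. ennreal (h k x)) \<partial>lebesgue) = (\<Sum>k. \<integral>\<^sup>+x. ennreal (h k x) \<partial>lebesgue)"
    by (rule nn_integral_suminf) measurable
  also have "\<dots> \<le> (\<Sum>k. ennreal ((1/8) ^ k))"
  proof (intro suminf_le summableI)
    fix k
    have "(\<integral>\<^sup>+x. ennreal (h k x) \<partial>lebesgue)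
        = (\<integral>\<^sup>+x. ennreal (2 ^ k) * ennreal ((norm (f (Suc k) x - f k x))\<^sup>2) \<partial>lebesgue)"
      by (simp add: h_def ennreal_mult)
    also have "\<dots> = ennreal (2 ^ k) * (\<integral>\<^sup>+x. ennreal ((norm (f (Suc k) x - f k x))\<^sup>2) \<partial>lebesgue)"
      by (rule nn_integral_cmult) measurable
    also have "\<dots> \<le> ennreal (2 ^ k) * ennreal (((1/4) ^ k)\<^sup>2)"
      by (intro mult_left_mono fd) auto
    also have "\<dots> = ennreal ((1/8) ^ k)"
    proof -
      have "(2::real) ^ k * ((1/4) ^ k)\<^sup>2 = (2 * (1/4)\<^sup>2) ^ k"
        by (simp only: power_mult_distrib power_mult[symmetric] mult.commute)
      also have "\<dots> = (1/8) ^ k" by (simp add: power2_eq_square)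
      finally show ?thesis by (simp flip: ennreal_mult)
    qed
    finally show "(\<integral>\<^sup>+x. ennreal (h k x) \<partial>lebesgue) \<le> ennreal ((1/8) ^ k)" .
  qed
  also have "\<dots> = ennreal (\<Sum>k. (1/8) ^ k)"
    by (rule suminf_ennreal2) (auto intro: summable_geometric)
  finally have "(\<integral>\<^sup>+x. (\<Sum>k. ennreal (h k x)) \<partial>lebesgue) \<noteq> \<infinity>"
    by (auto simp: top_unique)
  then have "AE x in lebesgue. (\<Sum>k. ennreal (h k x)) \<noteq> \<infinity>"
    by (intro nn_integral_PInf_AE) measurable
  then have conv: "AE x in lebesgue. convergent (\<lambda>k. f k x)"
  proof eventually_elim
    case (elim x)
    then have "summable (\<lambda>k. h k x)"
      by (intro summable_suminf_not_top) (auto simp: h_def)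
    then show ?case unfolding h_def by (rule convergent_if_sum_weighted_squares)
  qed
  define g where "g x = lim (\<lambda>k. f k x)" for x
  have gm [measurable]: "g \<in> borel_measurable lebesgue"
    unfolding g_def by (rule borel_measurable_lim_metric) measurable
  \<comment> \<open>Fatou's lemma carries the Cauchy estimate over from \<open>f m\<close> to the
    pointwise limit \<open>g\<close>.\<close>
  have gd: "(\<integral>\<^sup>+x. ennreal ((norm (g x - f k x))\<^sup>2) \<partial>lebesgue) \<le> ennreal (((1/4) ^ k)\<^sup>2)" for k
  proof -
    have "(\<integral>\<^sup>+x. ennreal ((norm (g x - f k x))\<^sup>2) \<partial>lebesgue)
        = (\<integral>\<^sup>+x. liminf (\<lambda>m. ennreal ((norm (f m x - f k x))\<^sup>2)) \<partial>lebesgue)"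
    proof (rule nn_integral_cong_AE)
      show "AE x in lebesgue. ennreal ((norm (g x - f k x))\<^sup>2)
          = liminf (\<lambda>m. ennreal ((norm (f m x - f k x))\<^sup>2))"
        using conv
      proof eventually_elim
        case (elim x)
        then have "(\<lambda>m. f m x) \<longlonglongrightarrow> g x"
          unfolding g_def by (simp add: convergent_LIMSEQ_iff)
        then have "(\<lambda>m. ennreal ((norm (f m x - f k x))\<^sup>2)) \<longlonglongrightarrow> ennreal ((norm (g x - f k x))\<^sup>2)"
          by (intro tendsto_ennrealI tendsto_intros)
        from lim_imp_Liminf[OF _ this] show ?case by simp
      qed
    qed
    also have "\<dots> \<le> liminf (\<lambda>m. \<integral>\<^sup>+x. ennreal ((norm (f m x - f k x))\<^sup>2) \<partial>lebesgue)"
      by (rule nn_integral_liminf) measurable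
    also have "\<dots> \<le> limsup (\<lambda>m. \<integral>\<^sup>+x. ennreal ((norm (f m x - f k x))\<^sup>2) \<partial>lebesgue)"
      by (rule Liminf_le_Limsup) simp
    also have "\<dots> \<le> ennreal (((1/4) ^ k)\<^sup>2)"
      by (rule Limsup_bounded) (use fd in \<open>auto simp: eventually_sequentially\<close>)
    finally show ?thesis .
  qed
  have gi: "square_integrable (\<lambda>x. g x - f k x)" for k
    unfolding square_integrable_def
  proof
    show "integrable lebesgue (\<lambda>x. (norm (g x - f k x))\<^sup>2)"
      unfolding integrable_iff_bounded using gd[of k] by (auto simp: le_less_trans)
  qed measurable
  have g: "square_integrable g"
    using square_integrable_add[OF gi[of 0] f(1)[of 0]] by simp
  have gX: "norm (X (r k) - abs_L2 g) \<le> (1/4) ^ k" for k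
  proof -
    have "ennreal ((norm (abs_L2 g - X (r k)))\<^sup>2) \<le> ennreal (((1/4) ^ k)\<^sup>2)"
      using gd[of k] norm_abs_L2_nn[OF gi[of k]] by (simp add: f abs_L2_diff[OF g])
    then have "norm (abs_L2 g - X (r k)) \<le> (1/4) ^ k"
      by (simp add: ennreal_le_iff power2_le_iff_abs_le)
    then show ?thesis by (simp add: norm_minus_commute)
  qed
  have "(X \<circ> r) \<longlonglongrightarrow> abs_L2 g"
  proof (rule LIM_zero_cancel, rule Lim_null_comparison)
    show "\<forall>\<^sub>F k in sequentially. norm ((X \<circ> r) k - abs_L2 g) \<le> (1/4) ^ k"
      using gX by simp
    show "(\<lambda>k. (1/4 :: real) ^ k) \<longlonglongrightarrow> 0" by (rule LIMSEQ_power_zero) simp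
  qed
  then have "X \<longlonglongrightarrow> abs_L2 g"
    using Cauchy_converges_subseq[OF X r] by (simp add: comp_def)
  then show "convergent X" by (auto simp: convergent_def)
qed

section \<open>Test functions\<close>

text \<open>The whole sequence of derivatives is the witness, which suits the induction in
  \<open>C_k_smooth_real\<close>, where the order of differentiation varies.\<close>

definition smooth_real :: "(real \<Rightarrow> real) \<Rightarrow> bool" where
  "smooth_real g \<longleftrightarrow>
     (\<exists>d. d 0 = g \<and> (\<forall>n t. (d n has_real_derivative d (Suc n) t) (at t)))"

lemma tendsto_poly_times_exp_minus:
  "((\<lambda>u. poly p u * exp (- u)) \<longlongrightarrow> (0::real)) at_top"
proof -
  have "((\<lambda>u. \<Sum>i\<le>degree p. coeff p i * (u ^ i / exp u)) \<longlongrightarrow> (\<Sum>i\<le>degree p. coeff p i * 0)) at_top"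
    by (intro tendsto_intros tendsto_power_div_exp_0)
  then show ?thesis
    by (simp add: poly_altdef sum_distrib_right sum_divide_distrib exp_minus field_simps)
qed

text \<open>A class containing \<open>bump\<close> and closed under differentiation: in the variable
  \<open>u = 1 / t\<close>, differentiating replaces \<open>p\<close> by \<open>u\<^sup>2\<close>
  times the difference of \<open>p\<close> and its derivative.\<close>

definition poly_exp_cutoff :: "real poly \<Rightarrow> real \<Rightarrow> real" where
  "poly_exp_cutoff p t = (if t > 0 then poly p (1 / t) * exp (- (1 / t)) else 0)"

lemma poly_exp_cutoff_deriv:
  "(poly_exp_cutoff p has_real_derivative poly_exp_cutoff (monom 1 2 * (p - pderiv p)) t) (at t)"
proof -
  consider "t > 0" | "t < 0" | "t = 0" by linarith
  then show ?thesis
  proof cases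
    case 1
    have "((\<lambda>t. poly p (1 / t) * exp (- (1 / t))) has_real_derivative
        poly_exp_cutoff (monom 1 2 * (p - pderiv p)) t) (at t)"
      using 1 by (auto intro!: derivative_eq_intros DERIV_chain2[OF poly_DERIV]
          simp: poly_exp_cutoff_def poly_monom power2_eq_square field_simps)
    then show ?thesis
      by (rule has_field_derivative_transform_within_open[of _ _ _ "{0<..}"])
        (use 1 in \<open>auto simp: poly_exp_cutoff_def\<close>)
  next
    case 2
    have "((\<lambda>t. 0) has_real_derivative poly_exp_cutoff (monom 1 2 * (p - pderiv p)) t) (at t)"
      using 2 by (simp add: poly_exp_cutoff_def)
    then show ?thesis
      by (rule has_field_derivative_transform_within_open[of _ _ _ "{..<0}"])
        (use 2 in \<open>auto simp: poly_exp_cutoff_def\<close>)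
  next
    case 3
    have r: "((\<lambda>h. poly_exp_cutoff p h / h) \<longlongrightarrow> 0) (at_right 0)"
    proof -
      \<comment> \<open>With \<open>u = 1 / h\<close> the difference quotient at 0 is
        \<open>u * poly p u * exp (- u)\<close>; \<open>pCons 0 p\<close> supplies the factor
        \<open>u\<close>.\<close>
      have "((\<lambda>h::real. poly (pCons 0 p) (inverse h) * exp (- inverse h)) \<longlongrightarrow> 0) (at_right 0)"
        by (rule filterlim_compose[OF tendsto_poly_times_exp_minus filterlim_inverse_at_top_right])
      then show ?thesis
        by (rule Lim_transform_eventually)
          (auto simp: eventually_at_filter poly_exp_cutoff_def field_simps)
    qed
    have l: "((\<lambda>h. poly_exp_cutoff p h / h) \<longlongrightarrow> 0) (at_left 0)"
      by (rule Lim_transform_eventually[OF tendsto_const])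
        (auto simp: eventually_at_filter poly_exp_cutoff_def)
    have "((\<lambda>h. poly_exp_cutoff p h / h) \<longlongrightarrow> 0) (at 0)"
      using r l by (simp add: filterlim_split_at)
    then show ?thesis using 3 by (simp add: DERIV_def poly_exp_cutoff_def)
  qed
qed

definition bump :: "real \<Rightarrow> real" where
  "bump t = (if t > 0 then exp (- (1 / t)) else 0)"

lemma smooth_real_bump: "smooth_real bump"
proof -
  define d where "d n = poly_exp_cutoff (((\<lambda>p. monom 1 2 * (p - pderiv p)) ^^ n) 1)" for n
  have "d 0 = bump" by (simp add: d_def fun_eq_iff poly_exp_cutoff_def bump_def)
  moreover have "(d n has_real_derivative d (Suc n) t) (at t)" for n t
    unfolding d_def using poly_exp_cutoff_deriv by simp
  ultimately show ?thesis unfolding smooth_real_def by blast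
qed

lemma bump_bounds: "0 \<le> bump t" "bump t \<le> 1"
  by (auto simp: bump_def)

lemma tendsto_bump: "t > 0 \<Longrightarrow> (\<lambda>n. bump (real n * t)) \<longlonglongrightarrow> 1"
proof -
  assume t: "t > 0"
  have "(\<lambda>n. exp (- (inverse (real n) * (1 / t)))) \<longlonglongrightarrow> exp (- (0 * (1 / t)))"
    by (intro tendsto_intros lim_inverse_n)
  then have "(\<lambda>n. exp (- (inverse (real n) * (1 / t)))) \<longlonglongrightarrow> 1" by simp
  then show ?thesis
  proof (rule Lim_transform_eventually)
    show "\<forall>\<^sub>F n in sequentially. exp (- (inverse (real n) * (1 / t))) = bump (real n * t)"
      using eventually_gt_at_top[of "0::nat"]
      by eventually_elim (use t in \<open>simp add: bump_def field_simps\<close>)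
  qed
qed

section \<open>Partial derivatives and stability of test functions\<close>

lemma partial_deriv_eq:
  "(\<phi> has_derivative D) (at x) \<Longrightarrow> partial_deriv j \<phi> x = D (axis j 1)"
  by (simp add: partial_deriv_def frechet_derivative_at[symmetric])

lemma differentiable_has_derivative:
  "\<phi> differentiable_on UNIV \<Longrightarrow> (\<phi> has_derivative frechet_derivative \<phi> (at x)) (at x)"
  by (simp add: differentiable_on_def frechet_derivative_works)

lemma partial_deriv_add:
  assumes "\<phi> differentiable_on UNIV" "\<psi> differentiable_on UNIV"
  shows "partial_deriv j (\<lambda>x. \<phi> x + \<psi> x) = (\<lambda>x. partial_deriv j \<phi> x + partial_deriv j \<psi> x)"
proof
  fix x
  show "partial_deriv j (\<lambda>x. \<phi> x + \<psi> x) x = partial_deriv j \<phi> x + partial_deriv j \<psi> x"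
    using partial_deriv_eq[OF has_derivative_add[OF differentiable_has_derivative[OF assms(1)]
          differentiable_has_derivative[OF assms(2)]]]
    by (simp add: partial_deriv_def)
qed

lemma partial_deriv_mult:
  assumes "\<phi> differentiable_on UNIV" "\<psi> differentiable_on UNIV"
  shows "partial_deriv j (\<lambda>x. \<phi> x * \<psi> x)
    = (\<lambda>x. \<phi> x * partial_deriv j \<psi> x + partial_deriv j \<phi> x * \<psi> x)"
proof
  fix x
  show "partial_deriv j (\<lambda>x. \<phi> x * \<psi> x) x
      = \<phi> x * partial_deriv j \<psi> x + partial_deriv j \<phi> x * \<psi> x"
    using partial_deriv_eq[OF has_derivative_mult[OF differentiable_has_derivative[OF assms(1)]
          differentiable_has_derivative[OF assms(2)]]]
    by (simp add: partial_deriv_def)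
qed

lemma partial_deriv_translate:
  assumes "\<phi> differentiable_on UNIV"
  shows "partial_deriv j (\<lambda>x. \<phi> (x + a)) = (\<lambda>x. partial_deriv j \<phi> (x + a))"
proof
  fix x
  have "((\<lambda>x. \<phi> (x + a)) has_derivative (\<lambda>h. frechet_derivative \<phi> (at (x + a)) h)) (at x)"
    by (rule has_derivative_compose[of "\<lambda>x. x + a" "\<lambda>h. h"])
      (auto intro!: derivative_eq_intros differentiable_has_derivative[OF assms])
  then show "partial_deriv j (\<lambda>x. \<phi> (x + a)) x = partial_deriv j \<phi> (x + a)"
    by (simp add: partial_deriv_eq) (simp add: partial_deriv_def)
qed

lemma C_k_continuous: "C_k k \<phi> \<Longrightarrow> continuous_on UNIV \<phi>"
  by (cases k) (auto intro: differentiable_imp_continuous_on)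

lemma C_k_Suc_D: "C_k (Suc k) \<phi> \<Longrightarrow> C_k k \<phi>"
  by (induction k arbitrary: \<phi>) (auto intro: differentiable_imp_continuous_on)

lemma C_k_add: "C_k k \<phi> \<Longrightarrow> C_k k \<psi> \<Longrightarrow> C_k k (\<lambda>x. \<phi> x + \<psi> x)"
  by (induction k arbitrary: \<phi> \<psi>)
    (auto simp: partial_deriv_add intro: continuous_on_add differentiable_on_add)

lemma C_k_mult: "C_k k \<phi> \<Longrightarrow> C_k k \<psi> \<Longrightarrow> C_k k (\<lambda>x. \<phi> x * \<psi> x)"
proof (induction k arbitrary: \<phi> \<psi>)
  case (Suc k)
  have "C_k k \<phi>" "C_k k \<psi>" using Suc.prems by (auto dest: C_k_Suc_D simp del: C_k.simps)
  then show ?case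
    using Suc by (auto simp: partial_deriv_mult intro!: C_k_add differentiable_on_mult)
qed (auto intro: continuous_on_mult)

lemma C_k_const: "C_k k (\<lambda>x :: real^'n::finite. c)"
proof (induction k arbitrary: c)
  case (Suc k)
  have "partial_deriv j (\<lambda>x :: real^'n. c) = (\<lambda>x. 0)" for j
    by (rule ext) (subst partial_deriv_eq[OF has_derivative_const], simp)
  then show ?case using Suc by simp
qed simp

lemma C_k_prod:
  "finite I \<Longrightarrow> (\<And>i. i \<in> I \<Longrightarrow> C_k k (\<phi> i)) \<Longrightarrow> C_k k (\<lambda>x. \<Prod>i\<in>I. \<phi> i x)"
  by (induction I rule: finite_induct) (auto simp: C_k_const C_k_mult)

lemma C_k_translate: "C_k k \<phi> \<Longrightarrow> C_k k (\<lambda>x. \<phi> (x + a))"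
proof (induction k arbitrary: \<phi>)
  case 0
  then show ?case by (auto intro!: continuous_on_compose2[of UNIV \<phi>] continuous_intros)
next
  case (Suc k)
  have "(\<lambda>x. \<phi> (x + a)) differentiable_on UNIV"
    using Suc.prems by (auto simp: differentiable_on_def intro!: differentiable_chain_at[of "\<lambda>x. x + a" _ \<phi>, unfolded comp_def])
  then show ?case using Suc by (simp add: partial_deriv_translate)
qed

lemma C_k_smooth_real:
  fixes i :: "'n::finite"
  assumes "smooth_real g"
  shows "C_k k (\<lambda>x :: real^'n. g (c * x $ i + b))"
proof -
  obtain d where d: "d 0 = g" "\<And>n t. (d n has_real_derivative d (Suc n) t) (at t)"
    using assms by (auto simp: smooth_real_def)
  \<comment> \<open>The factor \<open>r\<close> is kept general because each partial derivative
    multiplies it by \<open>c * axis j 1 $ i\<close> and raises \<open>n\<close> by one.\<close>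
  have "C_k k (\<lambda>x :: real^'n. r * d n (c * x $ i + b))" for r n
  proof (induction k arbitrary: r n)
    case 0
    have "continuous_on UNIV (d n)"
      using d(2) DERIV_continuous_on[of UNIV "d n"] by (meson has_field_derivative_at_within)
    then show ?case
      by (auto intro!: continuous_intros continuous_on_compose2[of UNIV "d n"])
  next
    case (Suc k)
    have D: "((\<lambda>x :: real^'n. r * d n (c * x $ i + b)) has_derivative
        (\<lambda>h. r * (d (Suc n) (c * x $ i + b) * (c * h $ i)))) (at x)" for x
      by (intro has_derivative_mult_right
          has_derivative_compose[OF _ d(2)[unfolded has_field_derivative_def]])
        (auto intro!: derivative_eq_intros bounded_linear_imp_has_derivative bounded_linear_vec_nth)
    have "partial_deriv j (\<lambda>x :: real^'n. r * d n (c * x $ i + b))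
        = (\<lambda>x. (r * c * axis j 1 $ i) * d (Suc n) (c * x $ i + b))" for j
      by (rule ext) (simp add: partial_deriv_eq[OF D])
    moreover have "(\<lambda>x :: real^'n. r * d n (c * x $ i + b)) differentiable_on UNIV"
      using D by (auto simp: differentiable_on_def differentiable_def)
    ultimately show ?case using Suc by simp
  qed
  from this[of 1 0] show ?thesis using d by simp
qed

lemma test_function_continuous: "test_function \<phi> \<Longrightarrow> continuous_on UNIV \<phi>"
  by (auto simp: test_function_def intro: C_k_continuous)

lemma test_function_differentiable: "test_function \<phi> \<Longrightarrow> \<phi> differentiable_on UNIV"
  unfolding test_function_def using C_k.simps(2) by blast

lemma test_function_partial_deriv:
  assumes "test_function \<phi>"
  shows "test_function (partial_deriv j \<phi>)"
  unfolding test_function_def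
proof
  show "\<forall>k. C_k k (partial_deriv j \<phi>)"
    using assms unfolding test_function_def using C_k.simps(2) by blast
  have "partial_deriv j \<phi> x = 0" if "x \<notin> closure {x. \<phi> x \<noteq> 0}" for x
  proof -
    have "((\<lambda>x. 0) has_derivative (\<lambda>h. 0)) (at x)" by simp
    then have "(\<phi> has_derivative (\<lambda>h. 0)) (at x)"
      by (rule has_derivative_transform_within_open[of _ _ _ _ "- closure {x. \<phi> x \<noteq> 0}"])
        (use that closure_subset[of "{x. \<phi> x \<noteq> 0}"] in auto)
    then show ?thesis by (simp add: partial_deriv_eq)
  qed
  then have "{x. partial_deriv j \<phi> x \<noteq> 0} \<subseteq> closure {x. \<phi> x \<noteq> 0}" by blast
  then have "bounded {x. partial_deriv j \<phi> x \<noteq> 0}"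
    using assms bounded_subset compact_imp_bounded unfolding test_function_def by blast
  then show "compact (closure {x. partial_deriv j \<phi> x \<noteq> 0})" by simp
qed

lemma test_function_translate:
  assumes "test_function \<phi>"
  shows "test_function (\<lambda>x. \<phi> (x + a))"
proof -
  have "{x. \<phi> (x + a) \<noteq> 0} = (\<lambda>x. - a + x) ` {x. \<phi> x \<noteq> 0}"
  proof (intro equalityI subsetI)
    fix x assume "x \<in> {x. \<phi> (x + a) \<noteq> 0}"
    then show "x \<in> (\<lambda>x. - a + x) ` {x. \<phi> x \<noteq> 0}" by (intro image_eqI[of _ _ "x + a"]) auto
  qed auto
  moreover have "bounded {x. \<phi> x \<noteq> 0}"
    using assms by (simp add: test_function_def)
  ultimately have "bounded {x. \<phi> (x + a) \<noteq> 0}"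
    using bounded_translation by metis
  then show ?thesis using assms by (auto simp: test_function_def C_k_translate)
qed

lemma test_function_bounded:
  assumes "test_function \<phi>"
  obtains C where "0 \<le> C" "\<And>x. \<bar>\<phi> x\<bar> \<le> C"
proof -
  let ?K = "closure {x. \<phi> x \<noteq> 0}"
  have "compact (\<phi> ` ?K)"
    using assms test_function_continuous[OF assms]
    by (intro compact_continuous_image) (auto simp: test_function_def intro: continuous_on_subset)
  then obtain C where C: "\<And>y. y \<in> \<phi> ` ?K \<Longrightarrow> norm y \<le> C"
    using compact_imp_bounded bounded_iff by metis
  have "\<bar>\<phi> x\<bar> \<le> max C 0" for x
  proof (cases "\<phi> x = 0")
    case False
    then have "x \<in> ?K" by (intro subsetD[OF closure_subset]) simp
    then have "norm (\<phi> x) \<le> C" by (intro C imageI)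
    then show ?thesis by simp
  qed simp
  then show ?thesis using that[of "max C 0"] by simp
qed

lemma test_function_support_bounded:
  assumes "test_function \<phi>"
  obtains a where "\<And>x. norm x > a \<Longrightarrow> \<phi> x = 0"
proof -
  have "bounded {x. \<phi> x \<noteq> 0}"
    using assms bounded_subset[OF compact_imp_bounded closure_subset] by (auto simp: test_function_def)
  then obtain a where "\<And>x. \<phi> x \<noteq> 0 \<Longrightarrow> norm x \<le> a" unfolding bounded_iff by blast
  then show ?thesis by (intro that[of a]) force
qed

section \<open>The fundamental lemma of the calculus of variations\<close>

text \<open>Test functions approximating the indicator of an open box from below. Each factor has
  the form of a smooth function of one affine coordinate, and scaling by \<open>n\<close> drives it
  to 1 at interior points.\<close>

definition box_bump :: "real^'n \<Rightarrow> real^'n \<Rightarrow> nat \<Rightarrow> real^'n::finite \<Rightarrow> real" where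
  "box_bump a b n x = (\<Prod>i\<in>UNIV. bump (real n * (x $ i - a $ i)) * bump (real n * (b $ i - x $ i)))"

lemma box_bump_nonzero: "box_bump a b n x \<noteq> 0 \<Longrightarrow> x \<in> box a b"
  unfolding box_bump_def prod_zero_iff[OF finite]
  by (auto simp: mem_box_cart bump_def zero_less_mult_iff split: if_splits)

lemma box_bump_bounds: "0 \<le> box_bump a b n x" "box_bump a b n x \<le> 1"
  unfolding box_bump_def using bump_bounds
  by (auto intro!: prod_nonneg prod_le_1 mult_nonneg_nonneg mult_le_one)

lemma test_function_box_bump: "test_function (box_bump a b n)"
  unfolding test_function_def
proof
  \<comment> \<open>Writes the arguments of \<open>bump\<close> as \<open>c * x $ i + b\<close>, the
    shape \<open>C_k_smooth_real\<close> expects.\<close>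
  have "(\<lambda>x. \<Prod>i\<in>UNIV. bump (real n * x $ i + (- (real n * a $ i))) * bump ((- real n) * x $ i + real n * b $ i))
      = box_bump a b n"
    by (simp add: box_bump_def[abs_def] right_diff_distrib)
  moreover have "C_k k (\<lambda>x. \<Prod>i\<in>UNIV. bump (real n * x $ i + (- (real n * a $ i))) * bump ((- real n) * x $ i + real n * b $ i))" for k
    by (intro C_k_prod C_k_mult C_k_smooth_real smooth_real_bump) simp
  ultimately show "\<forall>k. C_k k (box_bump a b n)" by simp
  have "{x. box_bump a b n x \<noteq> 0} \<subseteq> box a b" using box_bump_nonzero by blast
  then show "compact (closure {x. box_bump a b n x \<noteq> 0})"
    by (meson bounded_box bounded_subset compact_closure)
qed

lemma tendsto_box_bump:
  fixes x :: "real^'n::finite"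
  shows "(\<lambda>n. box_bump a b n x) \<longlonglongrightarrow> indicator (box a b) x"
proof (cases "x \<in> box a b")
  case True
  then have "(\<lambda>n. box_bump a b n x) \<longlonglongrightarrow> (\<Prod>i\<in>(UNIV::'n set). 1 * 1)"
    unfolding box_bump_def by (intro tendsto_prod tendsto_mult tendsto_bump) (auto simp: mem_box_cart)
  then show ?thesis using True by simp
next
  case False
  then have "box_bump a b n x = 0" for n using box_bump_nonzero by blast
  then show ?thesis using False by simp
qed

lemma sigma_finite_lebesgue: "sigma_finite_measure (lebesgue :: 'a::euclidean_space measure)"
proof
  obtain A :: "'a set set" where "countable A" "A \<subseteq> sets lborel" "\<Union>A = space lborel"
      "\<forall>a\<in>A. emeasure lborel a \<noteq> \<infinity>"
    using lborel.sigma_finite_countable by blast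
  then show "\<exists>A :: 'a set set. countable A \<and> A \<subseteq> sets lebesgue \<and> \<Union>A = space lebesgue
      \<and> (\<forall>a\<in>A. emeasure lebesgue a \<noteq> \<infinity>)"
    by (intro exI[of _ A]) auto
qed

text \<open>Boxes form an intersection-stable generator of the Borel sets, so a Dynkin argument
  extends vanishing integrals from boxes to Borel sets; a function all of whose set integrals vanish
  is zero almost everywhere.\<close>

lemma AE_zero_if_box_integrals_zero:
  fixes f :: "'a::euclidean_space \<Rightarrow> 'b::{banach, second_countable_topology}"
  assumes int: "\<And>a b. set_integrable lebesgue (box a b) f"
    and zero: "\<And>a b. set_lebesgue_integral lebesgue (box a b) f = 0"
  shows "AE x in lebesgue. f x = 0"
proof -
  have box0: "AE x in lebesgue. x \<in> box a b \<longrightarrow> f x = 0" for a b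
  proof -
    \<comment> \<open>Cutting off by one fixed box yields an integrable function with total integral
      0, which the complement step of the Dynkin argument requires. The boxes exhaust the space only
      at the very end.\<close>
    let ?f = "\<lambda>x. indicator (box a b) x *\<^sub>R f x"
    have fi: "integrable lebesgue ?f" using int by (simp add: set_integrable_def)
    then have fiA: "set_integrable lebesgue A ?f" if "A \<in> sets lebesgue" for A
      unfolding set_integrable_def by (rule integrable_mult_indicator[OF that])
    have total: "integral\<^sup>L lebesgue ?f = 0" using zero by (simp add: set_lebesgue_integral_def)
    have borel: "set_lebesgue_integral lebesgue A ?f = 0" if A: "A \<in> sets borel" for A
    proof -
      have "Int_stable (range (\<lambda>(a, b). box a b :: 'a set))"
        by (auto simp: Int_stable_def box_Int_box)
      moreover have "range (\<lambda>(a, b). box a b :: 'a set) \<subseteq> Pow UNIV" by auto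
      moreover have "A \<in> sigma_sets UNIV (range (\<lambda>(a, b). box a b))"
        using A unfolding borel_eq_box by simp
      ultimately show ?thesis
      proof (induction rule: sigma_sets_induct_disjoint)
        case (basic A)
        then obtain c d where A: "A = box c d" by auto
        obtain p q where pq: "A \<inter> box a b = box p q" unfolding A box_Int_box by blast
        have "(\<lambda>x. indicator A x *\<^sub>R ?f x) = (\<lambda>x. indicator (box p q) x *\<^sub>R f x)"
          by (simp flip: pq add: indicator_inter_arith)
        then show ?case using zero[of p q] by (simp add: set_lebesgue_integral_def)
      next
        case empty
        then show ?case by (simp add: set_lebesgue_integral_def)
      next
        case (compl A)
        then have "A \<in> sets borel" by (simp add: borel_eq_box)
        then have A: "A \<in> sets lebesgue" by simp
        have "set_lebesgue_integral lebesgue (UNIV - A) ?f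
            = (\<integral>x. ?f x - indicator A x *\<^sub>R ?f x \<partial>lebesgue)"
          unfolding set_lebesgue_integral_def
          by (intro Bochner_Integration.integral_cong) (auto simp: indicator_def)
        also have "\<dots> = 0"
          using compl fiA[OF A] fi total
          by (subst Bochner_Integration.integral_diff)
            (auto simp: set_integrable_def set_lebesgue_integral_def)
        finally show ?case .
      next
        case (union F)
        then have F: "F i \<in> sets lebesgue" for i
          by (auto simp: subset_eq borel_eq_box intro!: sets_completionI_sets)
        have "set_lebesgue_integral lebesgue (\<Union>i. F i) ?f = (\<Sum>i. set_lebesgue_integral lebesgue (F i) ?f)"
          using union(1) F by (intro lebesgue_integral_countable_add fiA)
            (auto simp: disjoint_family_on_def)
        then show ?case using union by simp
      qed
    qed
    have "AE x in lebesgue. ?f x = 0"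
    proof (rule sigma_finite_measure.density_unique_banach[OF sigma_finite_lebesgue fi])
      fix A assume A: "A \<in> sets (lebesgue :: 'a measure)"
      \<comment> \<open>A Lebesgue set differs from its Borel main part by a null set, so the Borel
        case settles all of them.\<close>
      have "AE x in lebesgue. x \<notin> null_part lborel A"
        using AE_not_in null_part_null_sets A by blast
      then have "AE x in lebesgue. indicator A x *\<^sub>R ?f x = indicator (main_part lborel A) x *\<^sub>R ?f x"
      proof eventually_elim
        case (elim x)
        then have "x \<in> A \<longleftrightarrow> x \<in> main_part lborel A"
          using main_part_null_part_Un[OF A] by blast
        then show ?case by (simp add: indicator_def)
      qed
      then have "set_lebesgue_integral lebesgue A ?f = set_lebesgue_integral lebesgue (main_part lborel A) ?f"
        unfolding set_lebesgue_integral_def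
        using fiA[OF A] fiA[of "main_part lborel A"] main_part_sets[OF A] A
        by (intro integral_cong_AE) (auto simp: set_integrable_def)
      then show "set_lebesgue_integral lebesgue A ?f = set_lebesgue_integral lebesgue A (\<lambda>x. 0)"
        using borel[of "main_part lborel A"] main_part_sets[OF A] by (simp add: set_lebesgue_integral_def)
    qed simp
    then show ?thesis by eventually_elim (auto simp: indicator_def)
  qed
  have "AE x in lebesgue. \<forall>n::nat. x \<in> box (- (real n *\<^sub>R One)) (real n *\<^sub>R One) \<longrightarrow> f x = 0"
    unfolding AE_all_countable using box0 by blast
  then show ?thesis
  proof eventually_elim
    case (elim x)
    then show ?case using UN_box_eq_UNIV by blast
  qed
qed

lemma AE_zero_if_test_integrals_zero:
  fixes f :: "real^'n::finite \<Rightarrow> 'b::{banach, second_countable_topology}"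
  assumes int: "\<And>a b. set_integrable lebesgue (box a b) f"
    and zero: "\<And>\<phi>. test_function \<phi> \<Longrightarrow> (\<integral>x. \<phi> x *\<^sub>R f x \<partial>lebesgue) = 0"
  shows "AE x in lebesgue. f x = 0"
proof (rule AE_zero_if_box_integrals_zero[OF int])
  fix a b :: "real^'n"
  let ?f = "\<lambda>x. indicator (box a b) x *\<^sub>R f x"
  have fi: "integrable lebesgue ?f" using int by (simp add: set_integrable_def)
  have bm [measurable]: "box_bump a b n \<in> borel_measurable lebesgue" for n
    using borel_measurable_continuous_onI[OF test_function_continuous[OF test_function_box_bump[of a b n]]]
    by (simp add: measurable_completion)
  have "(\<lambda>n. \<integral>x. box_bump a b n x *\<^sub>R ?f x \<partial>lebesgue) \<longlonglongrightarrow> integral\<^sup>L lebesgue ?f"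
  proof (rule integral_dominated_convergence)
    show "?f \<in> borel_measurable lebesgue" using fi by auto
    then show "(\<lambda>x. box_bump a b n x *\<^sub>R ?f x) \<in> borel_measurable lebesgue" for n by measurable
    show "integrable lebesgue (\<lambda>x. norm (?f x))" using fi by (rule integrable_norm)
    have "(\<lambda>n. box_bump a b n x *\<^sub>R ?f x) \<longlonglongrightarrow> ?f x" for x
    proof -
      have "(\<lambda>n. box_bump a b n x *\<^sub>R ?f x) \<longlonglongrightarrow> indicator (box a b) x *\<^sub>R ?f x"
        by (intro tendsto_intros tendsto_box_bump)
      then show ?thesis by (cases "x \<in> box a b") simp_all
    qed
    then show "AE x in lebesgue. (\<lambda>n. box_bump a b n x *\<^sub>R ?f x) \<longlonglongrightarrow> ?f x" by simp
    show "AE x in lebesgue. norm (box_bump a b n x *\<^sub>R ?f x) \<le> norm (?f x)" for n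
      using abs_of_nonneg[OF box_bump_bounds(1)[of a b n]] box_bump_bounds(2)[of a b n]
      by (intro AE_I2) (simp add: indicator_def mult_left_le_one_le box_bump_bounds)
  qed
  \<comment> \<open>\<open>box_bump\<close> vanishes off the box, so the cut-off in
    \<open>?f\<close> may be dropped and the hypothesis on test functions applies.\<close>
  moreover have "(\<lambda>x. box_bump a b n x *\<^sub>R ?f x) = (\<lambda>x. box_bump a b n x *\<^sub>R f x)" for n
    using box_bump_nonzero by (fastforce simp: indicator_def)
  ultimately have "(\<lambda>n. 0) \<longlonglongrightarrow> integral\<^sup>L lebesgue ?f"
    using zero[OF test_function_box_bump] by simp
  then show "set_lebesgue_integral lebesgue (box a b) f = 0"
    by (simp add: set_lebesgue_integral_def LIMSEQ_const_iff)
qed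

section \<open>Translations and test spinors\<close>

lemma lebesgue_translate:
  fixes a :: "'a::euclidean_space"
  shows "(\<lambda>x. x + a) \<in> lebesgue \<rightarrow>\<^sub>M lebesgue" "distr lebesgue lebesgue (\<lambda>x. x + a) = lebesgue"
proof -
  have T: "(\<lambda>x. a + (\<Sum>j\<in>Basis. (1 * (x \<bullet> j)) *\<^sub>R j)) = (\<lambda>x. x + a)"
    by (simp add: euclidean_representation add.commute)
  show "(\<lambda>x. x + a) \<in> lebesgue \<rightarrow>\<^sub>M lebesgue"
    using lebesgue_affine_measurable[of "\<lambda>_. 1" a] unfolding T by simp
  show "distr lebesgue lebesgue (\<lambda>x. x + a) = lebesgue"
    using lebesgue_affine_euclidean[of "\<lambda>_. 1" a] unfolding T by (simp add: density_1)
qed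

lemma AE_translate: "AE x in lebesgue. P x \<Longrightarrow> AE x in lebesgue. P (x + a)"
  using AE_distrD[OF lebesgue_translate(1)[of a], of P] unfolding lebesgue_translate(2) .

lemma integral_translate:
  fixes f :: "'a::euclidean_space \<Rightarrow> 'b::{banach, second_countable_topology}"
  assumes "f \<in> borel_measurable lebesgue"
  shows "(\<integral>x. f (x + a) \<partial>lebesgue) = (\<integral>x. f x \<partial>lebesgue)"
  using integral_distr[OF lebesgue_translate(1)[of a] assms] by (simp add: lebesgue_translate(2))

lemma square_integrable_translate:
  assumes "square_integrable f"
  shows "square_integrable (\<lambda>x. f (x + a))"
  unfolding square_integrable_def
proof
  show "(\<lambda>x. f (x + a)) \<in> borel_measurable lebesgue"
    using assms measurable_compose[OF lebesgue_translate(1)[of a], of f borel] by (simp add: square_integrable_def)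
  show "integrable lebesgue (\<lambda>x. (norm (f (x + a)))\<^sup>2)"
    using assms integrable_distr[OF lebesgue_translate(1)[of a], of "\<lambda>x. (norm (f x))\<^sup>2"]
    by (simp add: lebesgue_translate(2) square_integrable_def)
qed

lift_definition L2_shift :: "real^3 \<Rightarrow> L2 \<Rightarrow> L2" is "\<lambda>a f x. f (x + a)"
proof -
  fix a and f g :: "real^3 \<Rightarrow> complex^2" assume "L2_rel f g"
  then show "L2_rel (\<lambda>x. f (x + a)) (\<lambda>x. g (x + a))"
    using AE_translate[of "\<lambda>x. f x = g x" a] by (simp add: L2_rel_def square_integrable_translate)
qed

lemma abs_L2_shift: "square_integrable f \<Longrightarrow> L2_shift a (abs_L2 f) = abs_L2 (\<lambda>x. f (x + a))"
  by (rule L2_shift.abs_eq) (simp add: L2_rel_refl_iff)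

lemma L2_shift_add: "L2_shift a (F + G) = L2_shift a F + L2_shift a G"
proof -
  obtain f g where "square_integrable f" "F = abs_L2 f" "square_integrable g" "G = abs_L2 g"
    by (metis L2_rep)
  then show ?thesis
    by (simp add: abs_L2_add abs_L2_shift square_integrable_add square_integrable_translate)
qed

lemma L2_shift_scaleC: "L2_shift a (c *\<^sub>C F) = c *\<^sub>C L2_shift a F"
proof -
  obtain f where "square_integrable f" "F = abs_L2 f" by (rule L2_rep)
  then show ?thesis
    by (simp add: abs_L2_scaleC abs_L2_shift square_integrable_scaleC square_integrable_translate)
qed

lemma L2_shift_scaleR: "L2_shift a (r *\<^sub>R F) = r *\<^sub>R L2_shift a F"
  by (simp add: scaleR_scaleC L2_shift_scaleC)

lemma L2_shift_diff: "L2_shift a (F - G) = L2_shift a F - L2_shift a G"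
  using L2_shift_add[of a "F - G" G] by (simp add: algebra_simps)

lemma L2_shift_shift: "L2_shift a (L2_shift b F) = L2_shift (a + b) F"
proof -
  obtain f where "square_integrable f" "F = abs_L2 f" by (rule L2_rep)
  then show ?thesis
    by (simp add: abs_L2_shift square_integrable_translate add.assoc)
qed

lemma L2_shift_0 [simp]: "L2_shift 0 F = F"
  by (rule L2_rep[of F]) (simp add: abs_L2_shift)

lemma inner_L2_shift_shift: "inner (L2_shift a F) (L2_shift a G) = inner F G"
proof -
  obtain f g where fg: "square_integrable f" "F = abs_L2 f" "square_integrable g" "G = abs_L2 g"
    by (metis L2_rep)
  have "(\<lambda>x. inner (f x) (g x)) \<in> borel_measurable lebesgue"
    using fg by (auto simp: square_integrable_def)
  from integral_translate[OF this] show ?thesis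
    by (simp add: fg abs_L2_shift inner_abs_L2 square_integrable_translate)
qed

lemma norm_L2_shift [simp]: "norm (L2_shift a F) = norm F"
  by (simp add: norm_eq_sqrt_inner inner_L2_shift_shift)

lemma inner_L2_shift: "inner (L2_shift a F) G = inner F (L2_shift (- a) G)"
  using inner_L2_shift_shift[of a F "L2_shift (- a) G"] by (simp add: L2_shift_shift)

lemma L2_matrix_shift: "L2_matrix M (L2_shift a F) = L2_shift a (L2_matrix M F)"
proof -
  obtain f where "square_integrable f" "F = abs_L2 f" by (rule L2_rep)
  then show ?thesis
    by (simp add: abs_L2_matrix abs_L2_shift square_integrable_matrix square_integrable_translate)
qed

text \<open>The second part converts a uniform estimate on a fixed ball into a norm estimate of the
  same order; this gives the rate for difference quotients.\<close>

lemma square_integrable_if_bounded_support: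
  assumes f: "f \<in> borel_measurable lebesgue" and C: "0 \<le> C"
    and le: "\<And>x. norm (f x) \<le> C * indicator (cball 0 a) x"
  shows "square_integrable f"
    and "norm (abs_L2 f) \<le> C * sqrt (measure lebesgue (cball 0 a :: (real^3) set))"
proof -
  have i: "integrable lebesgue (\<lambda>x :: real^3. C\<^sup>2 * indicator (cball 0 a) x)"
    using lmeasurable_cball[of "0 :: real^3" a]
    by (intro integrable_mult_right) (auto simp: fmeasurable_def)
  have le2: "(norm (f x))\<^sup>2 \<le> C\<^sup>2 * indicator (cball 0 a) x" for x
    using le[of x] by (cases "x \<in> cball 0 a") (auto intro: power_mono)
  show s: "square_integrable f"
    unfolding square_integrable_def
  proof
    show "integrable lebesgue (\<lambda>x. (norm (f x))\<^sup>2)"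
      by (rule Bochner_Integration.integrable_bound[OF i]) (use f le2 in auto)
  qed fact
  have "(norm (abs_L2 f))\<^sup>2 \<le> (\<integral>x. C\<^sup>2 * indicator (cball 0 a) x \<partial>(lebesgue :: (real^3) measure))"
    unfolding norm_abs_L2[OF s] using s i le2
    by (intro integral_mono) (auto simp: square_integrable_def)
  also have "\<dots> = (C * sqrt (measure lebesgue (cball 0 a :: (real^3) set)))\<^sup>2"
    by (simp add: power_mult_distrib)
  finally show "norm (abs_L2 f) \<le> C * sqrt (measure lebesgue (cball 0 a :: (real^3) set))"
    by (rule power2_le_imp_le) (simp add: C)
qed

lemma test_function_measurable: "test_function \<phi> \<Longrightarrow> \<phi> \<in> borel_measurable lebesgue"
  using borel_measurable_continuous_onI[OF test_function_continuous, of \<phi>] by (simp add: measurable_completion)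

section \<open>Test spinors and weak derivatives as Hilbert space conditions\<close>

text \<open>Weak derivatives are tested with real scalar functions under a vector-valued integral.
  Letting \<open>e\<close> range over all vectors recovers that integral from real inner products
  with these elements.\<close>

definition test_spinor :: "(real^3 \<Rightarrow> real) \<Rightarrow> complex^2 \<Rightarrow> L2" where
  "test_spinor \<phi> e = abs_L2 (\<lambda>x. \<phi> x *\<^sub>R e)"

lemma square_integrable_test:
  assumes "test_function \<phi>"
  shows "square_integrable (\<lambda>x. \<phi> x *\<^sub>R e)"
proof -
  obtain C where C: "0 \<le> C" "\<And>x. \<bar>\<phi> x\<bar> \<le> C" using test_function_bounded[OF assms] by blast
  obtain a where a: "\<And>x. norm x > a \<Longrightarrow> \<phi> x = 0" using test_function_support_bounded[OF assms] by blast
  show ?thesis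
  proof (rule square_integrable_if_bounded_support)
    show "(\<lambda>x. \<phi> x *\<^sub>R e) \<in> borel_measurable lebesgue"
      using test_function_measurable[OF assms] by measurable
    show "norm (\<phi> x *\<^sub>R e) \<le> (C * norm e) * indicator (cball 0 a) x" for x
      using a[of x] C by (auto simp: indicator_def not_le intro!: mult_right_mono)
  qed (use C in simp)
qed

lemma L2_shift_test_spinor:
  assumes "test_function \<phi>"
  shows "L2_shift a (test_spinor \<phi> e) = test_spinor (\<lambda>x. \<phi> (x + a)) e"
  by (simp add: test_spinor_def abs_L2_shift square_integrable_test[OF assms])

lemma partial_deriv_mvt:
  assumes "\<phi> differentiable_on UNIV"
  shows "\<exists>\<xi>. \<bar>\<xi>\<bar> \<le> \<bar>h\<bar> \<and>
    \<phi> (x + h *\<^sub>R axis j 1) - \<phi> x = h * partial_deriv j \<phi> (x + \<xi> *\<^sub>R axis j 1)"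
proof -
  let ?u = "\<lambda>t. \<phi> (x + t *\<^sub>R axis j 1)"
  let ?u' = "\<lambda>t. partial_deriv j \<phi> (x + t *\<^sub>R axis j 1)"
  have d: "(?u has_real_derivative ?u' t) (at t)" for t
  proof -
    have 1: "(\<phi> has_derivative frechet_derivative \<phi> (at (x + t *\<^sub>R axis j 1))) (at (x + t *\<^sub>R axis j 1))"
      by (rule differentiable_has_derivative[OF assms])
    have "(?u has_derivative (\<lambda>s. frechet_derivative \<phi> (at (x + t *\<^sub>R axis j 1)) (s *\<^sub>R axis j 1))) (at t)"
      by (rule has_derivative_compose[where g = \<phi> and f = "\<lambda>t. x + t *\<^sub>R axis j 1"])
        (auto intro!: derivative_eq_intros 1)
    moreover have "frechet_derivative \<phi> (at (x + t *\<^sub>R axis j 1)) (s *\<^sub>R axis j 1) = ?u' t * s" for s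
      using linear_scale[OF has_derivative_linear[OF 1]] by (simp add: partial_deriv_def)
    ultimately show ?thesis by (simp add: has_field_derivative_def)
  qed
  consider "h = 0" | "0 < h" | "h < 0" by linarith
  then show ?thesis
  proof cases
    case 2
    obtain z where "0 < z" "z < h" "?u h - ?u 0 = (h - 0) * ?u' z"
      using MVT2[OF 2, of ?u ?u'] d by blast
    then show ?thesis by (intro exI[of _ z]) auto
  next
    case 3
    obtain z where "h < z" "z < 0" "?u 0 - ?u h = (0 - h) * ?u' z"
      using MVT2[OF 3, of ?u ?u'] d by blast
    then show ?thesis by (intro exI[of _ z]) (auto simp: algebra_simps)
  qed auto
qed

text \<open>A second-order Taylor remainder: the mean value theorem is used twice, the intermediate
  displacement \<xi> of the first use being the step of the second. The bounded second derivative
  then gives the factor \<open>h\<^sup>2\<close>.\<close>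

lemma test_spinor_difference_quotient:
  assumes \<phi>: "test_function \<phi>"
  obtains C where "\<And>h. \<bar>h\<bar> \<le> 1 \<Longrightarrow>
    norm (L2_shift (h *\<^sub>R axis j 1) (test_spinor \<phi> e) - test_spinor \<phi> e
      - h *\<^sub>R test_spinor (partial_deriv j \<phi>) e) \<le> C * h\<^sup>2"
proof -
  note \<phi>' = test_function_partial_deriv[OF \<phi>, of j]
  obtain K where K: "0 \<le> K" "\<And>x. \<bar>partial_deriv j (partial_deriv j \<phi>) x\<bar> \<le> K"
    using test_function_bounded[OF test_function_partial_deriv[OF \<phi>']] by blast
  obtain a where a: "\<And>x. norm x > a \<Longrightarrow> \<phi> x = 0" using test_function_support_bounded[OF \<phi>] by blast
  obtain b where b: "\<And>x. norm x > b \<Longrightarrow> partial_deriv j \<phi> x = 0"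
    using test_function_support_bounded[OF \<phi>'] by blast
  \<comment> \<open>The extra 1 allows for shifts with \<open>\<bar>h\<bar> \<le> 1\<close>: outside
    the ball of radius \<open>c\<close>, \<open>\<phi>\<close>, its derivative and its translate all
    vanish.\<close>
  define c where "c = max a b + 1"
  let ?r = "\<lambda>h x. (\<phi> (x + h *\<^sub>R axis j 1) - \<phi> x - h * partial_deriv j \<phi> x) *\<^sub>R e"
  show thesis
  proof (rule that)
    fix h :: real assume h: "\<bar>h\<bar> \<le> 1"
    note \<phi>h = test_function_translate[OF \<phi>, of "h *\<^sub>R axis j 1"]
    have le: "norm (?r h x) \<le> (K * norm e * h\<^sup>2) * indicator (cball 0 c) x" for x
    proof (cases "norm x \<le> c")
      case True
      obtain \<xi> where \<xi>: "\<bar>\<xi>\<bar> \<le> \<bar>h\<bar>"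
          "\<phi> (x + h *\<^sub>R axis j 1) - \<phi> x = h * partial_deriv j \<phi> (x + \<xi> *\<^sub>R axis j 1)"
        using partial_deriv_mvt[OF test_function_differentiable[OF \<phi>]] by blast
      obtain \<eta> where \<eta>: "partial_deriv j \<phi> (x + \<xi> *\<^sub>R axis j 1) - partial_deriv j \<phi> x
          = \<xi> * partial_deriv j (partial_deriv j \<phi>) (x + \<eta> *\<^sub>R axis j 1)"
        using partial_deriv_mvt[OF test_function_differentiable[OF \<phi>']] by blast
      have "\<bar>\<phi> (x + h *\<^sub>R axis j 1) - \<phi> x - h * partial_deriv j \<phi> x\<bar>
          = \<bar>h\<bar> * (\<bar>\<xi>\<bar> * \<bar>partial_deriv j (partial_deriv j \<phi>) (x + \<eta> *\<^sub>R axis j 1)\<bar>)"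
        unfolding \<xi>(2) by (simp flip: right_diff_distrib abs_mult add: \<eta>)
      also have "\<dots> \<le> \<bar>h\<bar> * (\<bar>h\<bar> * K)"
        using \<xi>(1) K by (intro mult_left_mono mult_mono) auto
      also have "\<dots> = K * h\<^sup>2" by (simp add: power2_eq_square flip: abs_mult)
      finally have "\<bar>\<phi> (x + h *\<^sub>R axis j 1) - \<phi> x - h * partial_deriv j \<phi> x\<bar> * norm e \<le> K * h\<^sup>2 * norm e"
        by (rule mult_right_mono) simp
      then show ?thesis using True by (simp add: mult_ac)
    next
      case False
      have "norm x \<le> norm (x + h *\<^sub>R axis j 1) + norm (h *\<^sub>R (axis j 1 :: real^3))"
        using norm_triangle_ineq4[of "x + h *\<^sub>R axis j 1" "h *\<^sub>R axis j 1"] by simp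
      then have "norm (x + h *\<^sub>R axis j 1) > a" using False h by (simp add: c_def)
      then show ?thesis using False a[of x] b[of x] a[of "x + h *\<^sub>R axis j 1"] by (simp add: c_def)
    qed
    have "L2_shift (h *\<^sub>R axis j 1) (test_spinor \<phi> e) - test_spinor \<phi> e
        - h *\<^sub>R test_spinor (partial_deriv j \<phi>) e = abs_L2 (?r h)"
      unfolding L2_shift_test_spinor[OF \<phi>] unfolding test_spinor_def
      by (simp add: abs_L2_diff abs_L2_scaleR square_integrable_diff square_integrable_scaleR
          square_integrable_test \<phi> \<phi>' \<phi>h scaleR_diff_left
          square_integrable_scaleR[OF square_integrable_test[OF \<phi>'], of h e, simplified])
    moreover have "norm (abs_L2 (?r h))
        \<le> (K * norm e * h\<^sup>2) * sqrt (measure lebesgue (cball 0 c :: (real^3) set))"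
    proof (rule square_integrable_if_bounded_support(2)[OF _ _ le])
      show "?r h \<in> borel_measurable lebesgue"
        using test_function_measurable[OF \<phi>] test_function_measurable[OF \<phi>']
          test_function_measurable[OF \<phi>h] by measurable
    qed (use K in simp)
    ultimately show "norm (L2_shift (h *\<^sub>R axis j 1) (test_spinor \<phi> e) - test_spinor \<phi> e
        - h *\<^sub>R test_spinor (partial_deriv j \<phi>) e)
        \<le> (K * norm e * sqrt (measure lebesgue (cball 0 c :: (real^3) set))) * h\<^sup>2"
      by (simp add: mult_ac)
  qed
qed

lemma integrable_test:
  assumes \<phi>: "test_function \<phi>" and f: "square_integrable f"
  shows "integrable lebesgue (\<lambda>x. \<phi> x *\<^sub>R f x)"
proof (rule Bochner_Integration.integrable_bound)
  have "integrable lebesgue (\<lambda>x. (norm (\<phi> x *\<^sub>R (axis 1 1 :: complex^2)))\<^sup>2)"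
    using square_integrable_test[OF \<phi>] by (simp only: square_integrable_def)
  then show "integrable lebesgue (\<lambda>x. (\<phi> x)\<^sup>2 + (norm (f x))\<^sup>2)"
    using f by (simp add: square_integrable_def)
  show "(\<lambda>x. \<phi> x *\<^sub>R f x) \<in> borel_measurable lebesgue"
    using f test_function_measurable[OF \<phi>] by (auto simp: square_integrable_def)
  have "\<bar>s\<bar> * t \<le> s\<^sup>2 + t\<^sup>2" if "0 \<le> t" for s t :: real
    using sum_squares_bound[of "\<bar>s\<bar>" t] mult_nonneg_nonneg[OF abs_ge_zero[of s] that]
    unfolding power2_abs by linarith
  then show "AE x in lebesgue. norm (\<phi> x *\<^sub>R f x) \<le> norm ((\<phi> x)\<^sup>2 + (norm (f x))\<^sup>2)"
    by (intro AE_I2) simp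
qed

lemma inner_test_spinor:
  assumes \<phi>: "test_function \<phi>" and f: "square_integrable f"
  shows "inner (abs_L2 f) (test_spinor \<phi> e) = inner (\<integral>x. \<phi> x *\<^sub>R f x \<partial>lebesgue) e"
  using integral_inner_left[OF integrable_test[OF assms], of e]
  by (simp add: test_spinor_def inner_abs_L2 f square_integrable_test[OF \<phi>])

text \<open>Turns the definition into linear equations for the pair \<open>(F, G)\<close> that are
  continuous in both entries, so linearity, uniqueness and passage to limits become short.\<close>

lemma has_weak_partial_iff:
  "has_weak_partial j F G \<longleftrightarrow> (\<forall>\<phi> e. test_function \<phi> \<longrightarrow>
     inner F (test_spinor (partial_deriv j \<phi>) e) = - inner G (test_spinor \<phi> e))"
proof -
  obtain f g where fg: "square_integrable f" "F = abs_L2 f" "square_integrable g" "G = abs_L2 g"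
    by (metis L2_rep)
  have "has_weak_partial j F G = has_weak_partial_fun j f g"
    unfolding fg by (rule has_weak_partial.abs_eq) (simp_all add: fg L2_rel_refl_iff)
  also have "\<dots> \<longleftrightarrow> (\<forall>\<phi>. test_function \<phi> \<longrightarrow> (\<forall>e.
      inner (\<integral>x. partial_deriv j \<phi> x *\<^sub>R f x \<partial>lebesgue) e = inner (- (\<integral>x. \<phi> x *\<^sub>R g x \<partial>lebesgue)) e))"
    unfolding has_weak_partial_fun_def vector_eq_rdot ..
  also have "\<dots> \<longleftrightarrow> (\<forall>\<phi> e. test_function \<phi> \<longrightarrow>
     inner F (test_spinor (partial_deriv j \<phi>) e) = - inner G (test_spinor \<phi> e))"
    by (auto simp: inner_test_spinor fg test_function_partial_deriv)
  finally show ?thesis .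
qed

text \<open>Density of the span of test spinors, phrased through its orthogonal complement. Square
  integrability implies integrability on boxes because these have finite measure.\<close>

lemma zero_if_orthogonal_to_test_spinors:
  assumes "\<And>\<phi> e. test_function \<phi> \<Longrightarrow> inner F (test_spinor \<phi> e) = 0"
  shows "F = 0"
proof -
  obtain f where f: "square_integrable f" "F = abs_L2 f" by (rule L2_rep)
  have "AE x in lebesgue. f x = 0"
  proof (rule AE_zero_if_test_integrals_zero)
    fix a b :: "real^3"
    show "set_integrable lebesgue (box a b) f"
      unfolding set_integrable_def
    proof (rule Bochner_Integration.integrable_bound)
      show "integrable lebesgue (\<lambda>x. indicator (box a b) x + (norm (f x))\<^sup>2)"
        using f lmeasurable_box[of a b]
        by (intro Bochner_Integration.integrable_add) (auto simp: square_integrable_def fmeasurable_def)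
      show "(\<lambda>x. indicator (box a b) x *\<^sub>R f x) \<in> borel_measurable lebesgue"
        using f by (auto simp: square_integrable_def intro!: borel_measurable_scaleR borel_measurable_indicator)
      have "t \<le> 1 + t\<^sup>2" for t :: real
        using sum_squares_bound[of t 1] zero_le_power2[of t] unfolding one_power2 mult_1_right by linarith
      then show "AE x in lebesgue. norm (indicator (box a b) x *\<^sub>R f x)
          \<le> norm (indicator (box a b) x + (norm (f x))\<^sup>2)"
        by (intro AE_I2) (auto simp: indicator_def)
    qed
  next
    fix \<phi> :: "real^3 \<Rightarrow> real" assume "test_function \<phi>"
    then have "inner (\<integral>x. \<phi> x *\<^sub>R f x \<partial>lebesgue) e = inner 0 e" for e
      using assms[of \<phi> e] f by (simp add: inner_test_spinor)
    then show "(\<integral>x. \<phi> x *\<^sub>R f x \<partial>lebesgue) = 0" using vector_eq_rdot by blast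
  qed
  then show ?thesis
    unfolding f(2) abs_L2_zero by (subst abs_L2_eq_iff) (simp_all add: f square_integrable_zero)
qed

section \<open>Weak derivatives as generators of translations\<close>

text \<open>The value at \<open>h = 0\<close> is 0, so bounds on the quotient can be stated for
  every real \<open>h\<close>.\<close>

definition diff_quot :: "3 \<Rightarrow> real \<Rightarrow> L2 \<Rightarrow> L2" where
  "diff_quot j h F = (1 / h) *\<^sub>R (L2_shift (h *\<^sub>R axis j 1) F - F)"

text \<open>Discrete integration by parts: translations preserve inner products, so the adjoint of a
  shift is the opposite shift.\<close>

lemma inner_diff_quot: "inner (diff_quot j h F) G = - inner F (diff_quot j (- h) G)"
  by (simp add: diff_quot_def inner_diff_left inner_diff_right inner_L2_shift)

lemma filterlim_uminus_at_0: "filterlim uminus (at (0::real)) (at 0)"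
  using filtermap_at_minus[of "0::real"] by (simp add: filterlim_def)

lemma has_weak_partial_shift:
  assumes "has_weak_partial j F G"
  shows "has_weak_partial j (L2_shift a F) (L2_shift a G)"
  unfolding has_weak_partial_iff
proof (intro allI impI)
  fix \<phi> :: "real^3 \<Rightarrow> real" and e assume \<phi>: "test_function \<phi>"
  have "L2_shift (- a) (test_spinor (partial_deriv j \<phi>) e)
      = test_spinor (partial_deriv j (\<lambda>x. \<phi> (x + - a))) e"
    using partial_deriv_translate[OF test_function_differentiable[OF \<phi>], of j "- a"]
    by (simp add: L2_shift_test_spinor test_function_partial_deriv \<phi>)
  then show "inner (L2_shift a F) (test_spinor (partial_deriv j \<phi>) e)
      = - inner (L2_shift a G) (test_spinor \<phi> e)"
    using assms test_function_translate[OF \<phi>, of "- a"]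
    by (simp add: inner_L2_shift has_weak_partial_iff L2_shift_test_spinor \<phi>)
qed

lemma has_weak_partial_add:
  "has_weak_partial j F G \<Longrightarrow> has_weak_partial j F' G' \<Longrightarrow> has_weak_partial j (F + F') (G + G')"
  by (simp add: has_weak_partial_iff inner_add_left)

lemma has_weak_partial_scaleR: "has_weak_partial j F G \<Longrightarrow> has_weak_partial j (r *\<^sub>R F) (r *\<^sub>R G)"
  by (simp add: has_weak_partial_iff)

lemma has_weak_partial_0: "has_weak_partial j 0 0"
  by (simp add: has_weak_partial_iff)

lemma has_weak_partial_unique:
  assumes "has_weak_partial j F G" "has_weak_partial j F H"
  shows "G = H"
proof -
  have "G - H = 0"
    by (rule zero_if_orthogonal_to_test_spinors)
      (use assms in \<open>simp add: has_weak_partial_iff inner_diff_left\<close>)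
  then show ?thesis by simp
qed

lemma weak_partial_eq: "has_weak_partial j F G \<Longrightarrow> weak_partial j F = G"
  unfolding weak_partial_def using has_weak_partial_unique by (intro the_equality) auto

lemma has_weak_partial_limit:
  assumes lim: "\<And>n. has_weak_partial j (s n) (t n)" "s \<longlonglongrightarrow> F" "t \<longlonglongrightarrow> G"
  shows "has_weak_partial j F G"
  unfolding has_weak_partial_iff
proof (intro allI impI)
  fix \<phi> :: "real^3 \<Rightarrow> real" and e assume \<phi>: "test_function \<phi>"
  let ?\<psi> = "test_spinor \<phi> e" and ?\<psi>' = "test_spinor (partial_deriv j \<phi>) e"
  have "(\<lambda>n. inner (s n) ?\<psi>') \<longlonglongrightarrow> inner F ?\<psi>'" by (intro tendsto_intros lim)
  moreover have "(\<lambda>n. - inner (t n) ?\<psi>) \<longlonglongrightarrow> - inner G ?\<psi>" by (intro tendsto_intros lim)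
  moreover have "inner (s n) ?\<psi>' = - inner (t n) ?\<psi>" for n
    using lim(1) \<phi> by (simp add: has_weak_partial_iff)
  ultimately show "inner F ?\<psi>' = - inner G ?\<psi>" by (simp add: LIMSEQ_unique)
qed

text \<open>Collects the two properties of test spinors that later arguments use. A sum of test
  spinors need not be a test spinor, but both properties are linear; the elements having them
  therefore form a subspace, which is dense.\<close>

definition weak_core :: "3 \<Rightarrow> L2 \<Rightarrow> L2 \<Rightarrow> bool" where
  "weak_core j \<psi> \<psi>' \<longleftrightarrow> ((\<lambda>h. diff_quot j h \<psi>) \<longlongrightarrow> \<psi>') (at 0)
     \<and> (\<forall>F G. has_weak_partial j F G \<longrightarrow> inner F \<psi>' = - inner G \<psi>)"

lemma weak_core_test_spinor:
  assumes \<phi>: "test_function \<phi>"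
  shows "weak_core j (test_spinor \<phi> e) (test_spinor (partial_deriv j \<phi>) e)"
  unfolding weak_core_def
proof
  let ?\<psi> = "test_spinor \<phi> e" and ?\<psi>' = "test_spinor (partial_deriv j \<phi>) e"
  obtain C where C: "\<And>h. \<bar>h\<bar> \<le> 1 \<Longrightarrow>
      norm (L2_shift (h *\<^sub>R axis j 1) ?\<psi> - ?\<psi> - h *\<^sub>R ?\<psi>') \<le> C * h\<^sup>2"
    using test_spinor_difference_quotient[OF \<phi>] by blast
  show "((\<lambda>h. diff_quot j h ?\<psi>) \<longlongrightarrow> ?\<psi>') (at 0)"
  proof (rule LIM_zero_cancel, rule Lim_null_comparison)
    have "\<forall>\<^sub>F h in at (0::real). \<bar>h\<bar> < 1 \<and> h \<noteq> 0"
      by (auto simp: eventually_at intro!: exI[of _ 1])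
    then show "\<forall>\<^sub>F h in at 0. norm (diff_quot j h ?\<psi> - ?\<psi>') \<le> C * \<bar>h\<bar>"
    proof eventually_elim
      case (elim h)
      have "diff_quot j h ?\<psi> - ?\<psi>' = (1 / h) *\<^sub>R (L2_shift (h *\<^sub>R axis j 1) ?\<psi> - ?\<psi> - h *\<^sub>R ?\<psi>')"
        using elim by (simp add: diff_quot_def scaleR_diff_right)
      then have "norm (diff_quot j h ?\<psi> - ?\<psi>')
          = norm (L2_shift (h *\<^sub>R axis j 1) ?\<psi> - ?\<psi> - h *\<^sub>R ?\<psi>') / \<bar>h\<bar>"
        by simp
      also have "\<dots> \<le> C * h\<^sup>2 / \<bar>h\<bar>" using C elim by (intro divide_right_mono) auto
      also have "\<dots> = C * \<bar>h\<bar>" using elim by (simp add: field_simps power2_eq_square)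
      finally show ?case .
    qed
    show "((\<lambda>h. C * \<bar>h\<bar>) \<longlongrightarrow> 0) (at (0::real))"
      by (auto intro!: tendsto_eq_intros)
  qed
  show "\<forall>F G. has_weak_partial j F G \<longrightarrow> inner F ?\<psi>' = - inner G ?\<psi>"
    using \<phi> by (simp add: has_weak_partial_iff)
qed

lemma subspace_closure:
  fixes S :: "'a::real_normed_vector set"
  assumes S: "subspace S"
  shows "subspace (closure S)"
  unfolding subspace_def
proof (intro conjI ballI allI)
  show "0 \<in> closure S" using subspace_0[OF S] closure_subset by blast
  show "x + y \<in> closure S" if xy: "x \<in> closure S" "y \<in> closure S" for x y
  proof -
    obtain f g where "\<And>n. f n \<in> S" "f \<longlonglongrightarrow> x" "\<And>n. g n \<in> S" "g \<longlonglongrightarrow> y"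
      using xy unfolding closure_sequential by blast
    then show ?thesis
      unfolding closure_sequential using subspace_add[OF S]
      by (intro exI[of _ "\<lambda>n. f n + g n"] conjI allI tendsto_add) auto
  qed
  show "c *\<^sub>R x \<in> closure S" if x: "x \<in> closure S" for c x
  proof -
    obtain f where "\<And>n. f n \<in> S" "f \<longlonglongrightarrow> x"
      using x unfolding closure_sequential by blast
    then show ?thesis
      unfolding closure_sequential using subspace_scale[OF S]
      by (intro exI[of _ "\<lambda>n. c *\<^sub>R f n"] conjI allI tendsto_scaleR tendsto_const) auto
  qed
qed

lemma closure_weak_core: "closure {\<psi>. \<exists>\<psi>'. weak_core j \<psi> \<psi>'} = UNIV"
proof (rule subspace_eq_UNIV_if_no_orthogonal)
  have add: "diff_quot j h (x + y) = diff_quot j h x + diff_quot j h y" for h x y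
    by (simp add: diff_quot_def L2_shift_add flip: scaleR_add_right)
  have scale: "diff_quot j h (c *\<^sub>R x) = c *\<^sub>R diff_quot j h x" for h c x
    by (simp add: diff_quot_def L2_shift_scaleR scaleR_diff_right mult.commute)
  have zero: "diff_quot j h 0 = 0" for h using scale[of h 0 0] by simp
  have "subspace {\<psi>. \<exists>\<psi>'. weak_core j \<psi> \<psi>'}"
    unfolding subspace_def
  proof (intro conjI ballI allI)
    show "0 \<in> {\<psi>. \<exists>\<psi>'. weak_core j \<psi> \<psi>'}"
      by (auto simp: weak_core_def zero intro!: exI[of _ 0])
    show "x + y \<in> {\<psi>. \<exists>\<psi>'. weak_core j \<psi> \<psi>'}"
      if xy: "x \<in> {\<psi>. \<exists>\<psi>'. weak_core j \<psi> \<psi>'}" "y \<in> {\<psi>. \<exists>\<psi>'. weak_core j \<psi> \<psi>'}" for x y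
    proof -
      obtain x' y' where "weak_core j x x'" "weak_core j y y'" using xy by blast
      then have "weak_core j (x + y) (x' + y')"
        by (auto simp: weak_core_def add inner_add_right intro!: tendsto_add)
      then show ?thesis by blast
    qed
    show "c *\<^sub>R x \<in> {\<psi>. \<exists>\<psi>'. weak_core j \<psi> \<psi>'}"
      if x: "x \<in> {\<psi>. \<exists>\<psi>'. weak_core j \<psi> \<psi>'}" for c x
    proof -
      obtain x' where "weak_core j x x'" using x by blast
      then have "weak_core j (c *\<^sub>R x) (c *\<^sub>R x')"
        by (auto simp: weak_core_def scale intro!: tendsto_scaleR)
      then show ?thesis by blast
    qed
  qed
  then show "subspace (closure {\<psi>. \<exists>\<psi>'. weak_core j \<psi> \<psi>'})" by (rule subspace_closure)
  fix v assume "\<And>m. m \<in> closure {\<psi>. \<exists>\<psi>'. weak_core j \<psi> \<psi>'} \<Longrightarrow> inner v m = 0"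
  then show "v = 0"
    using weak_core_test_spinor subsetD[OF closure_subset[of "{\<psi>. \<exists>\<psi>'. weak_core j \<psi> \<psi>'}"]]
    by (intro zero_if_orthogonal_to_test_spinors) blast
qed simp

lemma norm_le_if_inner_le_on_dense:
  fixes x :: "'a::real_inner"
  assumes D: "closure D = UNIV" and K: "0 \<le> K"
    and le: "\<And>y. y \<in> D \<Longrightarrow> inner x y \<le> K * norm y"
  shows "norm x \<le> K"
proof (cases "x = 0")
  case False
  have "closed {y. inner x y \<le> K * norm y}"
    by (intro closed_Collect_le continuous_intros)
  then have "closure D \<subseteq> {y. inner x y \<le> K * norm y}"
    using le by (intro closure_minimal) auto
  then have "inner x x \<le> K * norm x" unfolding D by blast
  then have "norm x * norm x \<le> K * norm x" by (simp add: norm_eq_sqrt_inner)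
  then show ?thesis using False by simp
qed (simp add: K)

lemma tendsto_inner_zero_if_on_dense:
  fixes f :: "real \<Rightarrow> 'a::real_inner"
  assumes D: "closure D = UNIV" and K: "\<And>h. norm (f h) \<le> K"
    and lim: "\<And>y. y \<in> D \<Longrightarrow> ((\<lambda>h. inner (f h) y) \<longlongrightarrow> 0) F"
  shows "((\<lambda>h. inner (f h) y) \<longlongrightarrow> 0) F"
proof (rule tendstoI)
  fix e :: real assume e: "0 < e"
  have K0: "0 \<le> K" using norm_ge_zero K order_trans by blast
  have "y \<in> closure D" using D by simp
  \<comment> \<open>\<open>K + 1\<close> rather than \<open>K\<close> keeps the approximation radius
    meaningful for \<open>K = 0\<close>.\<close>
  then obtain z where z: "z \<in> D" "dist z y < e / (2 * (K + 1))"
    using e K0 by (auto simp: closure_approachable elim!: allE[of _ "e / (2 * (K + 1))"])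
  have "\<forall>\<^sub>F h in F. dist (inner (f h) z) 0 < e / 2"
    using lim[OF z(1)] e by (intro tendstoD) auto
  then show "\<forall>\<^sub>F h in F. dist (inner (f h) y) 0 < e"
  proof eventually_elim
    case (elim h)
    have "\<bar>inner (f h) (y - z)\<bar> \<le> K * norm (y - z)"
      using Cauchy_Schwarz_ineq2[of "f h" "y - z"] K[of h]
      by (meson mult_right_mono norm_ge_zero order_trans)
    also have "\<dots> \<le> (K + 1) * norm (y - z)" by (simp add: mult_right_mono)
    also have "\<dots> < (K + 1) * (e / (2 * (K + 1)))"
      using z(2) K0 by (intro mult_strict_left_mono) (auto simp: dist_norm norm_minus_commute)
    also have "\<dots> = e / 2"
    proof -
      have "K + 1 \<noteq> 0" using K0 by simp
      then show ?thesis by (simp add: divide_simps)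
    qed
    finally have "\<bar>inner (f h) (y - z)\<bar> < e / 2" .
    then show ?case using elim unfolding inner_diff_right dist_real_def by linarith
  qed
qed

text \<open>Tested against a core element \<open>\<psi>\<close>, the quotient is a difference
  quotient of \<open>m\<close>, the pairing of \<open>F\<close> with translates of
  \<open>\<psi>\<close>. Its derivative is bounded by \<open>norm G * norm \<psi>\<close> because
  translations are isometric, and the mean value inequality concludes.\<close>

lemma norm_diff_quot_le:
  assumes FG: "has_weak_partial j F G"
  shows "norm (diff_quot j h F) \<le> norm G"
proof (cases "h = 0")
  case False
  show ?thesis
  proof (rule norm_le_if_inner_le_on_dense[OF closure_weak_core[of j] norm_ge_zero])
    fix \<psi> assume "\<psi> \<in> {\<psi>. \<exists>\<psi>'. weak_core j \<psi> \<psi>'}"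
    then obtain \<psi>' where c: "weak_core j \<psi> \<psi>'" by blast
    define m where "m s = inner F (L2_shift (s *\<^sub>R axis j 1) \<psi>)" for s
    define m' where "m' s = - inner G (L2_shift (s *\<^sub>R axis j 1) \<psi>)" for s
    have m': "(m has_real_derivative m' s) (at s)" for s
    proof -
      \<comment> \<open>Moving the translation onto \<open>F\<close> brings the differentiation back
        to the untranslated \<open>\<psi>\<close>; the translate of \<open>F\<close> keeps a weak
        derivative, so the core condition applies to it.\<close>
      let ?S = "L2_shift (- (s *\<^sub>R axis j 1))"
      have "((\<lambda>h. inner (?S F) (diff_quot j h \<psi>)) \<longlongrightarrow> inner (?S F) \<psi>') (at 0)"
        using c unfolding weak_core_def by (intro tendsto_intros) blast
      also have "inner (?S F) \<psi>' = m' s"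
      proof -
        have "inner (?S F) \<psi>' = - inner (?S G) \<psi>"
          using c has_weak_partial_shift[OF FG] unfolding weak_core_def by blast
        then show ?thesis by (simp add: m'_def inner_L2_shift)
      qed
      also have "(\<lambda>h. inner (?S F) (diff_quot j h \<psi>)) = (\<lambda>h. (m (s + h) - m s) / h)"
        by (simp add: fun_eq_iff diff_quot_def m_def inner_L2_shift L2_shift_diff L2_shift_shift
            L2_shift_scaleR inner_diff_right scaleR_add_left diff_divide_distrib)
      finally show ?thesis by (simp add: DERIV_def)
    qed
    have m'_le: "\<bar>m' s\<bar> \<le> norm G * norm \<psi>" for s
      using Cauchy_Schwarz_ineq2[of G "L2_shift (s *\<^sub>R axis j 1) \<psi>"] by (simp add: m'_def)
    have "norm (m (- h) - m 0) \<le> (norm G * norm \<psi>) * norm (- h - 0)"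
      by (rule field_differentiable_bound[of UNIV m m']) (use m' m'_le in \<open>auto intro: has_field_derivative_at_within\<close>)
    moreover have "inner (diff_quot j h F) \<psi> = (m (- h) - m 0) / h"
      by (simp add: diff_quot_def m_def inner_diff_left inner_L2_shift)
    ultimately have "\<bar>inner (diff_quot j h F) \<psi>\<bar> \<le> norm G * norm \<psi>"
      using False by (simp add: pos_divide_le_eq)
    then show "inner (diff_quot j h F) \<psi> \<le> norm G * norm \<psi>" by simp
  qed
qed (simp add: diff_quot_def)

text \<open>The uniform bound reduces the claim to the dense core. There the quotient is moved onto
  the core element, where it converges in norm.\<close>

lemma diff_quot_weak_limit:
  assumes FG: "has_weak_partial j F G"
  shows "((\<lambda>h. inner (diff_quot j h F) y) \<longlongrightarrow> inner G y) (at 0)"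
proof (rule LIM_zero_cancel)
  have "((\<lambda>h. inner (diff_quot j h F - G) y) \<longlongrightarrow> 0) (at 0)"
  proof (rule tendsto_inner_zero_if_on_dense[OF closure_weak_core[of j]])
    show "norm (diff_quot j h F - G) \<le> norm G + norm G" for h
      using norm_diff_quot_le[OF FG, of h] norm_triangle_ineq4[of "diff_quot j h F" G] by linarith
    fix \<psi> assume "\<psi> \<in> {\<psi>. \<exists>\<psi>'. weak_core j \<psi> \<psi>'}"
    then obtain \<psi>' where c: "weak_core j \<psi> \<psi>'" by blast
    then have "((\<lambda>h. diff_quot j (- h) \<psi>) \<longlongrightarrow> \<psi>') (at 0)"
      unfolding weak_core_def using filterlim_compose[OF _ filterlim_uminus_at_0] by blast
    then have "((\<lambda>h. - inner F (diff_quot j (- h) \<psi>) - inner G \<psi>) \<longlongrightarrow> - inner F \<psi>' - inner G \<psi>) (at 0)"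
      by (intro tendsto_intros)
    then show "((\<lambda>h. inner (diff_quot j h F - G) \<psi>) \<longlongrightarrow> 0) (at 0)"
      using c FG by (simp add: weak_core_def inner_diff_left inner_diff_quot)
  qed
  then show "((\<lambda>h. inner (diff_quot j h F) y - inner G y) \<longlongrightarrow> 0) (at 0)"
    by (simp add: inner_diff_left)
qed

lemma has_weak_partial_if_weak_limit:
  assumes "\<And>y. ((\<lambda>h. inner (diff_quot j h F) y) \<longlongrightarrow> inner G y) (at 0)"
  shows "has_weak_partial j F G"
  unfolding has_weak_partial_iff
proof (intro allI impI)
  fix \<phi> :: "real^3 \<Rightarrow> real" and e assume \<phi>: "test_function \<phi>"
  let ?\<psi> = "test_spinor \<phi> e" and ?\<psi>' = "test_spinor (partial_deriv j \<phi>) e"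
  have "((\<lambda>h. diff_quot j (- h) ?\<psi>) \<longlongrightarrow> ?\<psi>') (at 0)"
    using weak_core_test_spinor[OF \<phi>] filterlim_compose[OF _ filterlim_uminus_at_0]
    unfolding weak_core_def by blast
  then have "((\<lambda>h. - inner F (diff_quot j (- h) ?\<psi>)) \<longlongrightarrow> - inner F ?\<psi>') (at 0)"
    by (intro tendsto_intros)
  then have "((\<lambda>h. inner (diff_quot j h F) ?\<psi>) \<longlongrightarrow> - inner F ?\<psi>') (at 0)"
    by (simp add: inner_diff_quot)
  then have "inner G ?\<psi> = - inner F ?\<psi>'"
    using tendsto_unique[OF _ assms[of ?\<psi>]] by simp
  then show "inner F ?\<psi>' = - inner G ?\<psi>" by simp
qed

text \<open>Discrete integration by parts leaves one factor fixed on each side, so weak limits on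
  both sides suffice. This removes the restriction to test functions from integration by
  parts.\<close>

lemma has_weak_partial_skew:
  assumes FG: "has_weak_partial j F G" and FG': "has_weak_partial j F' G'"
  shows "inner G F' = - inner F G'"
proof -
  have "((\<lambda>h. inner (diff_quot j (- h) F') F) \<longlongrightarrow> inner G' F) (at 0)"
    using filterlim_compose[OF diff_quot_weak_limit[OF FG'] filterlim_uminus_at_0] .
  then have "((\<lambda>h. - inner (diff_quot j (- h) F') F) \<longlongrightarrow> - inner G' F) (at 0)"
    by (rule tendsto_minus)
  moreover have "- inner (diff_quot j (- h) F') F = inner (diff_quot j h F) F'" for h
    unfolding inner_diff_quot[of j h F F'] by (simp add: inner_commute)
  ultimately have "((\<lambda>h. inner (diff_quot j h F) F') \<longlongrightarrow> - inner F G') (at 0)"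
    by (simp add: inner_commute[of G' F])
  then show ?thesis
    using tendsto_unique[OF _ diff_quot_weak_limit[OF FG, of F']] by simp
qed

lemma has_weak_partial_test_spinor:
  assumes "test_function \<phi>"
  shows "has_weak_partial j (test_spinor \<phi> e) (test_spinor (partial_deriv j \<phi>) e)"
  using weak_core_test_spinor[OF assms]
  by (intro has_weak_partial_if_weak_limit tendsto_intros) (simp add: weak_core_def)

section \<open>Operators commuting with translations\<close>

text \<open>The adjoint \<open>K'\<close> does two jobs: its existence yields linearity of
  \<open>K\<close>, and it moves \<open>K\<close> across inner products inside weak limits, where
  continuity would otherwise be invoked.\<close>

definition translation_invariant :: "(L2 \<Rightarrow> L2) \<Rightarrow> (L2 \<Rightarrow> L2) \<Rightarrow> bool" where
  "translation_invariant K K' \<longleftrightarrow> (\<forall>x y. inner (K x) y = inner x (K' y))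
     \<and> (\<forall>a x. K (L2_shift a x) = L2_shift a (K x))"

lemma eq_if_inner_eq: "(\<And>y. inner x y = inner z y) \<Longrightarrow> x = (z :: 'a::real_inner)"
  using vector_eq_rdot by blast

lemma adjoint_imp_linear:
  assumes "\<And>x y. inner (K x) y = inner x (K' y :: 'a::real_inner)"
  shows "linear K"
  by (rule linearI; rule eq_if_inner_eq) (simp_all add: assms inner_add_left)

lemma translation_invariant_linear: "translation_invariant K K' \<Longrightarrow> linear K"
  unfolding translation_invariant_def by (rule adjoint_imp_linear) blast

lemma translation_invariant_sym:
  assumes "translation_invariant K K'"
  shows "translation_invariant K' K"
proof -
  have 1: "inner (K' x) y = inner x (K y)" for x y
    using assms by (simp add: translation_invariant_def inner_commute)
  have "K' (L2_shift a x) = L2_shift a (K' x)" for a x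
    by (rule eq_if_inner_eq)
      (use assms in \<open>simp add: translation_invariant_def inner_L2_shift 1\<close>)
  with 1 show ?thesis by (simp add: translation_invariant_def)
qed

lemma translation_invariant_comp:
  "translation_invariant K K' \<Longrightarrow> translation_invariant L L' \<Longrightarrow>
    translation_invariant (\<lambda>x. K (L x)) (\<lambda>x. L' (K' x))"
  by (simp add: translation_invariant_def)

lemma translation_invariant_diff_quot_commute:
  assumes "translation_invariant K K'"
  shows "K (diff_quot j h x) = diff_quot j h (K x)"
  using assms translation_invariant_linear[OF assms]
  by (simp add: diff_quot_def linear_scale linear_diff translation_invariant_def)

lemma translation_invariant_diff_quot:
  "translation_invariant (diff_quot j h) (\<lambda>x. - diff_quot j (- h) x)"
  by (simp add: translation_invariant_def inner_diff_quot)
    (simp add: diff_quot_def L2_shift_scaleR L2_shift_diff L2_shift_shift add.commute)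

lemma translation_invariant_scaleC: "translation_invariant (\<lambda>x. c *\<^sub>C x) (\<lambda>x. cnj c *\<^sub>C x)"
  by (simp add: translation_invariant_def L2_shift_scaleC inner_scaleC_left)

lemma has_weak_partial_map:
  assumes K: "translation_invariant K K'" and FG: "has_weak_partial j F G"
  shows "has_weak_partial j (K F) (K G)"
proof (rule has_weak_partial_if_weak_limit)
  fix y
  have "((\<lambda>h. inner (diff_quot j h F) (K' y)) \<longlongrightarrow> inner G (K' y)) (at 0)"
    by (rule diff_quot_weak_limit[OF FG])
  then show "((\<lambda>h. inner (diff_quot j h (K F)) y) \<longlongrightarrow> inner (K G) y) (at 0)"
    using K by (simp add: translation_invariant_def
        flip: translation_invariant_diff_quot_commute[OF K])
qed

text \<open>Formally both sides integrate by parts to the same second derivatives. To stay with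
  first derivatives, \<open>H\<close> is replaced by difference quotients of \<open>F\<close>, the
  two derivatives are exchanged, and the step tends to 0 afterwards. Needed for the off-diagonal
  terms of \<open>norm_sigma_p\<close>.\<close>

lemma has_weak_partial_mixed:
  assumes M: "translation_invariant M M'"
    and FG: "has_weak_partial j F G" and FH: "has_weak_partial k F H"
  shows "inner (M G) H = inner (M H) G"
proof -
  have adj: "inner (M x) y = inner x (M' y)" for x y
    using M by (simp add: translation_invariant_def)
  have "inner (diff_quot k h F) (M G) = inner (diff_quot k (- h) F) (M' G)" for h
  proof -
    have "inner (M G) (diff_quot k h F) = - inner (M F) (diff_quot k h G)"
      by (rule has_weak_partial_skew[OF has_weak_partial_map[OF M FG]
            has_weak_partial_map[OF translation_invariant_diff_quot FG]])
    also have "\<dots> = inner (diff_quot k (- h) (M F)) G"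
      by (simp add: inner_diff_quot)
    also have "\<dots> = inner (diff_quot k (- h) F) (M' G)"
      by (simp flip: translation_invariant_diff_quot_commute[OF M] adj)
    finally show ?thesis by (simp add: inner_commute)
  qed
  moreover have "((\<lambda>h. inner (diff_quot k (- h) F) (M' G)) \<longlongrightarrow> inner H (M' G)) (at 0)"
    using filterlim_compose[OF diff_quot_weak_limit[OF FH] filterlim_uminus_at_0] .
  ultimately have "((\<lambda>h. inner (diff_quot k h F) (M G)) \<longlongrightarrow> inner H (M' G)) (at 0)"
    by simp
  then have "inner H (M G) = inner H (M' G)"
    using tendsto_unique[OF _ diff_quot_weak_limit[OF FH, of "M G"]] by simp
  then show ?thesis by (metis adj inner_commute)
qed

section \<open>Resolvents of the weak partial derivatives\<close>

text \<open>Skewness makes \<open>F\<close> orthogonal to its derivative, so Pythagoras applies. The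
  condition \<open>s * s = 1\<close> covers both signs, which are adjoint to each other.\<close>

lemma weak_partial_resolvent_bound:
  assumes s: "s * s = (1::real)" and FG: "has_weak_partial j F G"
  shows "norm F \<le> norm (F - s *\<^sub>R G)"
proof -
  have "inner F G = 0" using has_weak_partial_skew[OF FG FG] by (simp add: inner_commute)
  then have "(norm (F - s *\<^sub>R G))\<^sup>2 = (norm F)\<^sup>2 + (norm G)\<^sup>2"
    using s by (simp add: power2_norm_eq_inner inner_diff_left inner_diff_right inner_commute
        flip: mult.assoc)
  then have "(norm F)\<^sup>2 \<le> (norm (F - s *\<^sub>R G))\<^sup>2" by simp
  then show ?thesis by (rule power2_le_imp_le) simp
qed

lemma weak_partial_resolvent_exists:
  assumes s: "s * s = (1::real)"
  shows "\<exists>F G. has_weak_partial j F G \<and> F - s *\<^sub>R G = y"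
proof -
  let ?D = "{F. \<exists>G. has_weak_partial j F G}"
  let ?X = "\<lambda>F. F - s *\<^sub>R weak_partial j F"
  have wp: "has_weak_partial j F (weak_partial j F)" if "F \<in> ?D" for F
    using that weak_partial_eq by auto
  have ss: "s *\<^sub>R s *\<^sub>R x = x" for x :: L2 using s by simp
  have "?X ` ?D = UNIV"
  proof (rule surj_if_bounded_below[where c = 1])
    show "subspace ?D"
      unfolding subspace_def
      using has_weak_partial_0 has_weak_partial_add has_weak_partial_scaleR by blast
    show "?X (u + v) = ?X u + ?X v" if "u \<in> ?D" "v \<in> ?D" for u v
      using weak_partial_eq[OF has_weak_partial_add[OF wp[OF that(1)] wp[OF that(2)]]]
      by (simp add: scaleR_add_right)
    show "?X (r *\<^sub>R u) = r *\<^sub>R ?X u" if "u \<in> ?D" for r u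
      using weak_partial_eq[OF has_weak_partial_scaleR[OF wp[OF that]]]
      by (simp add: scaleR_diff_right mult.commute)
    show "1 * norm u \<le> norm (?X u)" if "u \<in> ?D" for u
      using weak_partial_resolvent_bound[OF s wp[OF that]] by simp
    show "u \<in> ?D \<and> ?X u = z"
      if S: "\<And>n. S n \<in> ?D" "S \<longlonglongrightarrow> u" "(\<lambda>n. ?X (S n)) \<longlonglongrightarrow> z" for S u z
    proof -
      \<comment> \<open>The derivatives are read off from the convergent data by solving
        \<open>?X\<close> for them, using \<open>s * s = 1\<close>.\<close>
      have "(\<lambda>n. s *\<^sub>R (S n - ?X (S n))) \<longlonglongrightarrow> s *\<^sub>R (u - z)"
        by (intro tendsto_intros S)
      then have "(\<lambda>n. weak_partial j (S n)) \<longlonglongrightarrow> s *\<^sub>R (u - z)" by (simp add: s)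
      then have "has_weak_partial j u (s *\<^sub>R (u - z))"
        by (rule has_weak_partial_limit[OF wp[OF S(1)] S(2)])
      then show ?thesis by (auto simp: weak_partial_eq s)
    qed
    fix v assume v: "\<And>u. u \<in> ?D \<Longrightarrow> inner v (?X u) = 0"
    \<comment> \<open>Orthogonality to \<open>?X\<close> of test spinors is the weak equation saying
      that the derivative of \<open>v\<close> is \<open>- s *\<^sub>R v\<close>. Hence
      \<open>v\<close> lies in \<open>?D\<close>, its image under \<open>?X\<close> is twice
      \<open>v\<close>, and it is orthogonal to that image.\<close>
    have "has_weak_partial j v (- s *\<^sub>R v)"
      unfolding has_weak_partial_iff
    proof (intro allI impI)
      fix \<phi> :: "real^3 \<Rightarrow> real" and e assume \<phi>: "test_function \<phi>"
      let ?\<psi> = "test_spinor \<phi> e" and ?\<psi>' = "test_spinor (partial_deriv j \<phi>) e"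
      have "inner v (?\<psi> - s *\<^sub>R ?\<psi>') = 0"
        using v[of ?\<psi>] has_weak_partial_test_spinor[OF \<phi>, of j e] by (auto simp: weak_partial_eq)
      then have "s * inner v ?\<psi> = s * s * inner v ?\<psi>'" by (simp add: inner_diff_right)
      then show "inner v ?\<psi>' = - inner (- s *\<^sub>R v) ?\<psi>" by (simp add: s)
    qed
    then have "inner v (v - s *\<^sub>R (- s *\<^sub>R v)) = 0"
      using v[of v] weak_partial_eq by auto
    then show "v = 0" by (simp add: ss s inner_add_right)
  qed simp
  then have "y \<in> ?X ` ?D" by simp
  then show ?thesis using wp by auto
qed

lemma has_weak_partial_diff:
  "has_weak_partial j F G \<Longrightarrow> has_weak_partial j F' G' \<Longrightarrow> has_weak_partial j (F - F') (G - G')"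
  by (simp add: has_weak_partial_iff inner_diff_left)

text \<open>\<open>R\<close> and \<open>R'\<close> solve the equations with \<open>s = 1\<close> and
  \<open>s = - 1\<close>; skewness makes them mutually adjoint. They commute with every
  translation-invariant \<open>K\<close> because applying \<open>K\<close> to a solution solves the
  equation with data \<open>K y\<close>, and solutions are unique.\<close>

lemma weak_partial_resolvent:
  obtains R R' where "translation_invariant R R'"
    "\<And>y. \<exists>G. has_weak_partial j (R y) G" "\<And>y. \<exists>G. has_weak_partial j (R' y) G"
    "\<And>y. R y = 0 \<Longrightarrow> y = 0"
    "\<And>K K' y. translation_invariant K K' \<Longrightarrow> R (K y) = K (R y)"
    "\<And>K K' y. translation_invariant K K' \<Longrightarrow> R' (K y) = K (R' y)"
proof -
  have "\<forall>y. \<exists>F G. has_weak_partial j F G \<and> F - s *\<^sub>R G = y" if "s * s = 1" for s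
    using weak_partial_resolvent_exists[OF that] by blast
  then have ex: "\<exists>R D. \<forall>y. has_weak_partial j (R y) (D y) \<and> R y - s *\<^sub>R D y = y" if "s * s = 1" for s
    using that by metis
  obtain R D where R: "\<And>y. has_weak_partial j (R y) (D y)" "\<And>y. R y - 1 *\<^sub>R D y = y"
    using ex[of 1] by (metis mult_1)
  obtain R' D' where R': "\<And>y. has_weak_partial j (R' y) (D' y)" "\<And>y. R' y - (- 1) *\<^sub>R D' y = y"
    using ex[of "- 1"] by (metis mult_minus1 minus_minus)
  have unique: "F = S y"
    if s: "s * s = 1" and S: "\<And>y. has_weak_partial j (S y) (E y)" "\<And>y. S y - s *\<^sub>R E y = y"
      and F: "has_weak_partial j F G" "F - s *\<^sub>R G = y" for s S E F G y
  proof -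
    have "norm (F - S y) \<le> norm ((F - S y) - s *\<^sub>R (G - E y))"
      by (rule weak_partial_resolvent_bound[OF s has_weak_partial_diff[OF F(1) S(1)]])
    also have "(F - S y) - s *\<^sub>R (G - E y) = (F - s *\<^sub>R G) - (S y - s *\<^sub>R E y)"
      by (simp add: scaleR_diff_right)
    also have "\<dots> = 0" unfolding F(2) S(2) by simp
    finally show ?thesis by simp
  qed
  have commute: "S (K y) = K (S y)"
    if s: "s * s = 1" and S: "\<And>y. has_weak_partial j (S y) (E y)" "\<And>y. S y - s *\<^sub>R E y = y"
      and K: "translation_invariant K K'" for s S E K K' y
  proof -
    note lin = translation_invariant_linear[OF K]
    have "K (S y) - s *\<^sub>R K (E y) = K y"
      using S(2)[of y] by (simp flip: linear_diff[OF lin] linear_scale[OF lin])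
    then show ?thesis
      by (rule unique[OF s S has_weak_partial_map[OF K S(1)], symmetric])
  qed
  note comm = commute[of 1, OF _ R] and comm' = commute[of "- 1", OF _ R']
  have adj: "inner (R x) y = inner x (R' y)" for x y
  proof -
    have "inner (D x) (R' y) = - inner (R x) (D' y)" by (rule has_weak_partial_skew[OF R(1) R'(1)])
    then have "inner (R x) (R' y - (- 1) *\<^sub>R D' y) = inner (R x - 1 *\<^sub>R D x) (R' y)"
      by (simp add: inner_diff_left inner_add_right)
    then show ?thesis unfolding R(2) R'(2) .
  qed
  \<comment> \<open>Translations commute with each other, so the commutation result specializes to
    the invariance of \<open>R\<close> itself.\<close>
  have shift: "translation_invariant (L2_shift a) (L2_shift (- a))" for a
    by (simp add: translation_invariant_def inner_L2_shift L2_shift_shift add.commute)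
  show thesis
  proof (rule that)
    show "translation_invariant R R'"
      unfolding translation_invariant_def using adj comm[OF _ shift] by simp
    show "y = 0" if "R y = 0" for y
      using R(1)[of y] R(2)[of y] has_weak_partial_unique[OF has_weak_partial_0] that by fastforce
    show "\<exists>G. has_weak_partial j (R y) G" "\<exists>G. has_weak_partial j (R' y) G" for y
      using R(1) R'(1) by blast+
    show "R (K y) = K (R y)" "R' (K y) = K (R' y)" if "translation_invariant K K'" for K K' y
      using comm[OF _ that] comm'[OF _ that] by simp_all
  qed
qed

text \<open>The product of the three one-dimensional resolvents maps into the Sobolev space; being
  translation invariant it takes over the role of mollification.\<close>

lemma smoothing_operator:
  obtains J J' where "translation_invariant J J'"
    "\<And>y. J y \<in> W12" "\<And>y. J' y \<in> W12" "\<And>y. J y = 0 \<Longrightarrow> y = 0"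
    "\<And>K K' y. translation_invariant K K' \<Longrightarrow> J' (K y) = K (J' y)"
proof -
  obtain R1 R1' where 1: "translation_invariant R1 R1'"
    "\<And>y. \<exists>G. has_weak_partial 1 (R1 y) G" "\<And>y. \<exists>G. has_weak_partial 1 (R1' y) G"
    "\<And>y. R1 y = 0 \<Longrightarrow> y = 0"
    "\<And>K K' y. translation_invariant K K' \<Longrightarrow> R1 (K y) = K (R1 y)"
    "\<And>K K' y. translation_invariant K K' \<Longrightarrow> R1' (K y) = K (R1' y)"
    by (rule weak_partial_resolvent[of 1]) blast
  obtain R2 R2' where 2: "translation_invariant R2 R2'"
    "\<And>y. \<exists>G. has_weak_partial 2 (R2 y) G" "\<And>y. \<exists>G. has_weak_partial 2 (R2' y) G"
    "\<And>y. R2 y = 0 \<Longrightarrow> y = 0"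
    "\<And>K K' y. translation_invariant K K' \<Longrightarrow> R2 (K y) = K (R2 y)"
    "\<And>K K' y. translation_invariant K K' \<Longrightarrow> R2' (K y) = K (R2' y)"
    by (rule weak_partial_resolvent[of 2]) blast
  obtain R3 R3' where 3: "translation_invariant R3 R3'"
    "\<And>y. \<exists>G. has_weak_partial 3 (R3 y) G" "\<And>y. \<exists>G. has_weak_partial 3 (R3' y) G"
    "\<And>y. R3 y = 0 \<Longrightarrow> y = 0"
    "\<And>K K' y. translation_invariant K K' \<Longrightarrow> R3 (K y) = K (R3 y)"
    "\<And>K K' y. translation_invariant K K' \<Longrightarrow> R3' (K y) = K (R3' y)"
    by (rule weak_partial_resolvent[of 3]) blast
  note sym = translation_invariant_sym[OF 1(1)] translation_invariant_sym[OF 2(1)]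
    translation_invariant_sym[OF 3(1)]
  show thesis
  proof (rule that)
    show "translation_invariant (\<lambda>x. R1 (R2 (R3 x))) (\<lambda>x. R3' (R2' (R1' x)))"
      using translation_invariant_comp[OF translation_invariant_comp[OF 1(1) 2(1)] 3(1)] .
    \<comment> \<open>Each factor supplies the derivative in its own direction, and the factors
      applied after it preserve that derivative by \<open>has_weak_partial_map\<close>.\<close>
    show "R1 (R2 (R3 y)) \<in> W12" for y
      unfolding W12_def forall_3 mem_Collect_eq
      using 1(2)[of "R2 (R3 y)"] 2(2)[of "R3 y"] 3(2)[of y]
        has_weak_partial_map[OF 1(1)] has_weak_partial_map[OF 2(1)] by meson
    show "R3' (R2' (R1' y)) \<in> W12" for y
      unfolding W12_def forall_3 mem_Collect_eq
      using 1(3)[of y] 2(3)[of "R1' y"] 3(3)[of "R2' (R1' y)"]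
        has_weak_partial_map[OF sym(2)] has_weak_partial_map[OF sym(3)] by meson
    show "y = 0" if "R1 (R2 (R3 y)) = 0" for y
      using that 1(4) 2(4) 3(4) by blast
    show "R3' (R2' (R1' (K y))) = K (R3' (R2' (R1' y)))" if "translation_invariant K K'" for K K' y
      using 1(6)[OF that] 2(6)[OF that] 3(6)[OF that] by simp
  qed
qed

section \<open>The operator \<open>\<sigma> \<cdot> (- i \<nabla>)\<close>\<close>

lemma has_weak_partial_weak_partial: "F \<in> W12 \<Longrightarrow> has_weak_partial j F (weak_partial j F)"
  using weak_partial_eq by (auto simp: W12_def)

lemma weak_partial_map:
  "translation_invariant K K' \<Longrightarrow> F \<in> W12 \<Longrightarrow> weak_partial j (K F) = K (weak_partial j F)"
  by (rule weak_partial_eq) (rule has_weak_partial_map[OF _ has_weak_partial_weak_partial])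

lemma W12_map: "translation_invariant K K' \<Longrightarrow> F \<in> W12 \<Longrightarrow> K F \<in> W12"
  using has_weak_partial_map[OF _ has_weak_partial_weak_partial, of K K' F]
  by (auto simp: W12_def)

lemma W12_add: "F \<in> W12 \<Longrightarrow> G \<in> W12 \<Longrightarrow> F + G \<in> W12"
  using has_weak_partial_add unfolding W12_def by blast

lemma W12_0: "0 \<in> W12"
  using has_weak_partial_0 unfolding W12_def by blast

lemma W12_scaleC: "F \<in> W12 \<Longrightarrow> c *\<^sub>C F \<in> W12"
  by (rule W12_map[OF translation_invariant_scaleC])

lemma subspace_W12: "subspace W12"
  using W12_0 W12_add W12_scaleC by (simp add: subspace_def scaleR_scaleC)

section \<open>Pauli matrices acting on spinors\<close>

lemma inner_L2_matrix:
  assumes "\<And>u v. inner (M *v u) v = inner u (M' *v v)"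
  shows "inner (L2_matrix M F) G = inner F (L2_matrix M' G)"
proof -
  obtain f g where "square_integrable f" "F = abs_L2 f" "square_integrable g" "G = abs_L2 g"
    by (metis L2_rep)
  then show ?thesis
    by (simp add: abs_L2_matrix inner_abs_L2 square_integrable_matrix assms)
qed

lemma pauli_hermitian: "inner (pauli j *v u) v = inner u (pauli j *v v)"
  using exhaust_3[of j]
  by (auto simp: pauli_def inner_vec_def matrix_vector_mult_def sum_2 vector_2 inner_complex_def
      algebra_simps)

lemma pauli_square: "pauli j *v (pauli j *v u) = u"
  using exhaust_3[of j]
  by (auto simp: pauli_def vec_eq_iff matrix_vector_mult_def sum_2 vector_2 forall_2 algebra_simps)

lemma pauli_anticommute: "j \<noteq> k \<Longrightarrow> pauli j *v (pauli k *v u) = - (pauli k *v (pauli j *v u))"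
  using exhaust_3[of j] exhaust_3[of k]
  by (auto simp: pauli_def vec_eq_iff matrix_vector_mult_def sum_2 vector_2 forall_2 algebra_simps)

lemma abs_L2_minus: "square_integrable f \<Longrightarrow> - abs_L2 f = abs_L2 (\<lambda>x. - f x)"
  using abs_L2_scaleR[of f "- 1"] by simp

lemma L2_pauli_square: "L2_matrix (pauli j) (L2_matrix (pauli j) F) = F"
proof -
  obtain f where "square_integrable f" "F = abs_L2 f" by (rule L2_rep)
  then show ?thesis by (simp add: abs_L2_matrix square_integrable_matrix pauli_square)
qed

lemma L2_pauli_anticommute:
  assumes "j \<noteq> k"
  shows "L2_matrix (pauli j) (L2_matrix (pauli k) F) = - L2_matrix (pauli k) (L2_matrix (pauli j) F)"
proof -
  obtain f where f: "square_integrable f" "F = abs_L2 f" by (rule L2_rep)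
  then show ?thesis
    by (simp add: abs_L2_matrix square_integrable_matrix pauli_anticommute[OF assms] abs_L2_minus)
qed

lemma L2_matrix_scaleC: "L2_matrix M (c *\<^sub>C F) = c *\<^sub>C L2_matrix M F"
proof -
  obtain f where f: "square_integrable f" "F = abs_L2 f" by (rule L2_rep)
  have "M *v (c *s u) = c *s (M *v u)" for u
    by (simp add: vec_eq_iff matrix_vector_mult_def sum_distrib_left mult_ac)
  then show ?thesis
    by (simp add: f abs_L2_matrix abs_L2_scaleC square_integrable_matrix square_integrable_scaleC)
qed

lemma inner_pauli: "inner (L2_matrix (pauli j) F) G = inner F (L2_matrix (pauli j) G)"
  by (rule inner_L2_matrix) (rule pauli_hermitian)

lemma translation_invariant_pauli: "translation_invariant (L2_matrix (pauli j)) (L2_matrix (pauli j))"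
  by (simp add: translation_invariant_def inner_pauli L2_matrix_shift)

lemmas linear_pauli = translation_invariant_linear[OF translation_invariant_pauli]

lemma norm_pauli: "norm (L2_matrix (pauli j) F) = norm F"
  by (simp add: norm_eq_sqrt_inner inner_pauli L2_pauli_square)

lemma tendsto_pauli:
  assumes "(f \<longlongrightarrow> l) A"
  shows "((\<lambda>x. L2_matrix (pauli j) (f x)) \<longlongrightarrow> L2_matrix (pauli j) l) A"
proof -
  have "bounded_linear (L2_matrix (pauli j))"
    by (rule bounded_linear_intro[where K = 1])
      (simp_all add: linear_add linear_scale linear_pauli norm_pauli)
  then show ?thesis using assms by (rule bounded_linear.tendsto)
qed

lemma sigma_p_add: "F \<in> W12 \<Longrightarrow> G \<in> W12 \<Longrightarrow> sigma_p (F + G) = sigma_p F + sigma_p G"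
  by (simp add: sigma_p_def linear_add[OF linear_pauli] sum.distrib scaleC_add_right
      weak_partial_eq[OF has_weak_partial_add[OF has_weak_partial_weak_partial
          has_weak_partial_weak_partial]])

text \<open>An adjoint for the real inner product gives only real linearity of \<open>K\<close>,
  hence the separate assumption on multiplication by \<open>\<i>\<close>.\<close>

lemma sigma_p_map:
  assumes K: "translation_invariant K K'" and F: "F \<in> W12"
    and comm: "\<And>j x. K (L2_matrix (pauli j) x) = L2_matrix (pauli j) (K x)"
      "\<And>x. K (\<i> *\<^sub>C x) = \<i> *\<^sub>C K x"
  shows "sigma_p (K F) = K (sigma_p F)"
proof -
  note lin = translation_invariant_linear[OF K]
  show ?thesis
    by (simp add: sigma_p_def weak_partial_map[OF K F] scaleC_minus_left linear_neg[OF lin]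
        linear_sum[OF lin] comm)
qed

lemma sigma_p_scaleC: "F \<in> W12 \<Longrightarrow> sigma_p (c *\<^sub>C F) = c *\<^sub>C sigma_p F"
  by (rule sigma_p_map[OF translation_invariant_scaleC])
    (simp_all add: L2_matrix_scaleC scaleC_scaleC mult.commute)

lemma sigma_p_scaleR: "F \<in> W12 \<Longrightarrow> sigma_p (r *\<^sub>R F) = r *\<^sub>R sigma_p F"
  by (simp add: scaleR_scaleC sigma_p_scaleC)

lemma sigma_p_diff: "F \<in> W12 \<Longrightarrow> G \<in> W12 \<Longrightarrow> sigma_p (F - G) = sigma_p F - sigma_p G"
  using sigma_p_add[of F "(-1) *\<^sub>C G"] sigma_p_scaleC[of G "-1"] W12_scaleC[of G "-1"]
  by (simp add: scaleC_minus_left)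

text \<open>Multiplication by \<open>\<i>\<close> composed with a Pauli matrix is skew, and so is
  the weak derivative; the two signs cancel.\<close>

lemma inner_sigma_p:
  assumes F: "F \<in> W12" and G: "G \<in> W12"
  shows "inner (sigma_p F) G = inner F (sigma_p G)"
proof -
  have "inner (L2_matrix (pauli j) (weak_partial j F)) (\<i> *\<^sub>C G)
      = - inner F (\<i> *\<^sub>C L2_matrix (pauli j) (weak_partial j G))" for j
  proof -
    have "has_weak_partial j (L2_matrix (pauli j) (\<i> *\<^sub>C G))
        (L2_matrix (pauli j) (\<i> *\<^sub>C weak_partial j G))"
      by (intro has_weak_partial_map[OF translation_invariant_pauli]
          has_weak_partial_map[OF translation_invariant_scaleC] has_weak_partial_weak_partial G)
    from has_weak_partial_skew[OF has_weak_partial_weak_partial[OF F] this]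
    show ?thesis by (simp add: inner_pauli L2_matrix_scaleC)
  qed
  then show ?thesis
    by (simp add: sigma_p_def inner_scaleC_left inner_sum_left scaleC_minus_left scaleC_sum_right
        inner_sum_right sum_negf)
qed

lemma cinner_sigma_p:
  assumes "F \<in> W12" "G \<in> W12"
  shows "cinner (sigma_p F) G = cinner F (sigma_p G)"
  using inner_sigma_p[OF assms] inner_sigma_p[OF assms(1) W12_scaleC[OF assms(2)], of \<i>]
  by (simp add: complex_eq_iff Re_cinner Im_cinner sigma_p_scaleC assms)

text \<open>For different indices, exchanging the derivatives is symmetric while exchanging the
  Pauli matrices is antisymmetric, so the cross term equals its own negative. The summands are
  therefore orthogonal, and each Pauli matrix is an isometry.\<close>

lemma norm_sigma_p:
  assumes F: "F \<in> W12"
  shows "(norm (sigma_p F))\<^sup>2 = (\<Sum>j\<in>UNIV. (norm (weak_partial j F))\<^sup>2)"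
proof -
  let ?A = "\<lambda>j. weak_partial j F" and ?S = "\<lambda>j. L2_matrix (pauli j)"
  note hwp = has_weak_partial_weak_partial[OF F]
  have off: "inner (?S j (?A j)) (?S k (?A k)) = 0" if "j \<noteq> k" for j k
  proof -
    have "inner (?S j (?A j)) (?S k (?A k)) = inner (?S k (?S j (?A j))) (?A k)"
      by (simp add: inner_pauli)
    also have "\<dots> = inner (?S k (?S j (?A k))) (?A j)"
      using has_weak_partial_mixed[OF translation_invariant_comp[OF translation_invariant_pauli
            translation_invariant_pauli] hwp hwp] .
    also have "\<dots> = - inner (?S k (?A k)) (?S j (?A j))"
      using that by (simp add: L2_pauli_anticommute[of k j] inner_pauli)
    finally show ?thesis by (simp add: inner_commute)
  qed
  have "(norm (sigma_p F))\<^sup>2 = (norm (\<Sum>j\<in>UNIV. ?S j (?A j)))\<^sup>2"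
    by (simp add: sigma_p_def norm_scaleC)
  also have "\<dots> = (\<Sum>j\<in>UNIV. (norm (?S j (?A j)))\<^sup>2)"
    using off by (intro norm_sum_Pythagorean) (auto simp: pairwise_def orthogonal_def)
  finally show ?thesis by (simp add: norm_pauli)
qed

text \<open>By \<open>norm_sigma_p\<close> every partial derivative is dominated by
  \<open>sigma_p\<close>, so convergence of the images forces convergence of all derivatives
  separately.\<close>

lemma sigma_p_closed:
  assumes s: "\<And>n. s n \<in> W12" "s \<longlonglongrightarrow> F" "(\<lambda>n. sigma_p (s n)) \<longlonglongrightarrow> G"
  shows "F \<in> W12 \<and> sigma_p F = G"
proof -
  have "\<exists>H. (\<lambda>n. weak_partial j (s n)) \<longlonglongrightarrow> H" for j
  proof -
    have "Cauchy (\<lambda>n. weak_partial j (s n))"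
    proof (rule metric_CauchyI)
      fix e :: real assume "0 < e"
      then obtain N where N: "\<forall>m\<ge>N. \<forall>n\<ge>N. dist (sigma_p (s m)) (sigma_p (s n)) < e"
        using LIMSEQ_imp_Cauchy[OF s(3)] metric_CauchyD by blast
      have "dist (weak_partial j (s m)) (weak_partial j (s n)) \<le> dist (sigma_p (s m)) (sigma_p (s n))" for m n
      proof -
        have d: "s m - s n \<in> W12" using s(1) subspace_diff[OF subspace_W12] by blast
        have "(norm (weak_partial j (s m - s n)))\<^sup>2 \<le> (norm (sigma_p (s m - s n)))\<^sup>2"
          unfolding norm_sigma_p[OF d] by (rule member_le_sum) auto
        then have "norm (weak_partial j (s m - s n)) \<le> norm (sigma_p (s m - s n))"
          by (rule power2_le_imp_le) simp
        moreover have "weak_partial j (s m - s n) = weak_partial j (s m) - weak_partial j (s n)"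
          by (intro weak_partial_eq has_weak_partial_diff has_weak_partial_weak_partial s)
        ultimately show ?thesis by (simp add: dist_norm sigma_p_diff s(1))
      qed
      then show "\<exists>N. \<forall>m\<ge>N. \<forall>n\<ge>N. dist (weak_partial j (s m)) (weak_partial j (s n)) < e"
        using N by (meson order_le_less_trans)
    qed
    then show ?thesis using Cauchy_convergent convergent_def by blast
  qed
  then obtain H where H: "\<And>j. (\<lambda>n. weak_partial j (s n)) \<longlonglongrightarrow> H j" by metis
  have FH: "has_weak_partial j F (H j)" for j
    by (rule has_weak_partial_limit[OF has_weak_partial_weak_partial[OF s(1)] s(2) H])
  have "(\<lambda>n. sigma_p (s n)) \<longlonglongrightarrow> sigma_p F"
    unfolding sigma_p_def weak_partial_eq[OF FH]
    by (intro tendsto_scaleC tendsto_sum tendsto_pauli H)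
  then show ?thesis using FH LIMSEQ_unique[OF s(3)] by (auto simp: W12_def)
qed

text \<open>The quadratic form of a symmetric operator is real; in real terms,
  \<open>sigma_p F\<close> and \<open>\<i> *\<^sub>C F\<close> are orthogonal, as Pythagoras
  requires below.\<close>

lemma inner_sigma_p_i:
  assumes F: "F \<in> W12"
  shows "inner (sigma_p F) (\<i> *\<^sub>C F) = 0"
proof -
  have "inner (sigma_p F) (\<i> *\<^sub>C F) = inner F (\<i> *\<^sub>C sigma_p F)"
    using inner_sigma_p[OF F W12_scaleC[OF F]] by (simp only: sigma_p_scaleC[OF F])
  also have "\<dots> = - inner (\<i> *\<^sub>C F) (sigma_p F)"
    unfolding inner_scaleC_right[of F] by (simp add: scaleC_minus_left)
  finally show ?thesis by (simp add: inner_commute)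
qed

section \<open>Self-adjointness of the momentum operator\<close>

lemma sigma_p_minus_i_surj:
  assumes s: "s * s = (1::real)"
  shows "\<exists>F\<in>W12. sigma_p F - s *\<^sub>R \<i> *\<^sub>C F = G"
proof -
  let ?X = "\<lambda>F. sigma_p F - s *\<^sub>R \<i> *\<^sub>C F"
  have "?X ` W12 = UNIV"
  proof (rule surj_if_bounded_below[where c = 1])
    show "?X (u + v) = ?X u + ?X v" if "u \<in> W12" "v \<in> W12" for u v
      by (simp add: sigma_p_add[OF that] scaleC_add_right scaleR_add_right)
    show "?X (r *\<^sub>R u) = r *\<^sub>R ?X u" if "u \<in> W12" for r u
      by (simp add: sigma_p_scaleR[OF that] scaleC_scaleR scaleR_diff_right mult.commute)
    show "1 * norm u \<le> norm (?X u)" if u: "u \<in> W12" for u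
    proof -
      have "(norm (?X u))\<^sup>2 = (norm (sigma_p u))\<^sup>2 + (norm (s *\<^sub>R \<i> *\<^sub>C u))\<^sup>2"
      proof -
        have pyth: "(norm (x - y))\<^sup>2 = (norm x)\<^sup>2 + (norm y)\<^sup>2" if "inner x y = 0" for x y :: L2
          using that by (simp add: power2_norm_eq_inner inner_diff_left inner_diff_right inner_commute)
        show ?thesis by (rule pyth) (simp add: inner_sigma_p_i[OF u])
      qed
      also have "(norm (s *\<^sub>R \<i> *\<^sub>C u))\<^sup>2 = (norm u)\<^sup>2"
        using s by (simp add: norm_scaleC power_mult_distrib power2_eq_square)
      finally have "(norm u)\<^sup>2 \<le> (norm (?X u))\<^sup>2" by simp
      then have "norm u \<le> norm (?X u)" by (rule power2_le_imp_le) simp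
      then show ?thesis by simp
    qed
    show "u \<in> W12 \<and> ?X u = y"
      if S: "\<And>n. S n \<in> W12" "S \<longlonglongrightarrow> u" "(\<lambda>n. ?X (S n)) \<longlonglongrightarrow> y" for S u y
    proof -
      have "(\<lambda>n. ?X (S n) + s *\<^sub>R \<i> *\<^sub>C S n) \<longlonglongrightarrow> y + s *\<^sub>R \<i> *\<^sub>C u"
        by (intro tendsto_intros tendsto_scaleC S)
      then have "(\<lambda>n. sigma_p (S n)) \<longlonglongrightarrow> y + s *\<^sub>R \<i> *\<^sub>C u" by simp
      from sigma_p_closed[OF S(1,2) this] show ?thesis by simp
    qed
    fix v assume v: "\<And>u. u \<in> W12 \<Longrightarrow> inner v (?X u) = 0"
    \<comment> \<open>The vector \<open>v\<close> need not lie in \<open>W12\<close>, so symmetry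
      cannot be used on it directly. \<open>J v\<close> does lie there, and it is again orthogonal
      to the range, because \<open>J'\<close> preserves \<open>W12\<close> and commutes with
      \<open>?X\<close>.\<close>
    obtain J J' where J: "translation_invariant J J'"
      "\<And>y. J y \<in> W12" "\<And>y. J' y \<in> W12" "\<And>y. J y = 0 \<Longrightarrow> y = 0"
      "\<And>K K' y. translation_invariant K K' \<Longrightarrow> J' (K y) = K (J' y)"
      by (rule smoothing_operator) blast
    have J'i: "J' (\<i> *\<^sub>C x) = \<i> *\<^sub>C J' x" for x by (rule J(5)[OF translation_invariant_scaleC])
    have orth: "inner (J v) (?X f) = 0" if f: "f \<in> W12" for f
    proof -
      note lin = translation_invariant_linear[OF translation_invariant_sym[OF J(1)]]
      have "inner (J v) (?X f) = inner v (J' (?X f))"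
        using J(1) by (simp add: translation_invariant_def)
      also have "J' (?X f) = ?X (J' f)"
        by (simp add: linear_diff[OF lin] linear_scale[OF lin] J'i
            sigma_p_map[OF translation_invariant_sym[OF J(1)] f J(5)[OF translation_invariant_pauli] J'i])
      finally show ?thesis using v[OF J(3)] by simp
    qed
    \<comment> \<open>Testing with \<open>\<i>\<close> times \<open>J v\<close> turns the term
      \<open>- s *\<^sub>R \<i>\<close> into \<open>s\<close>, while the contribution of
      \<open>sigma_p\<close> vanishes by symmetry. Injectivity of \<open>J\<close> then gives
      \<open>v = 0\<close>.\<close>
    have "inner (J v) (?X (\<i> *\<^sub>C J v)) = 0" by (rule orth[OF W12_scaleC[OF J(2)]])
    moreover have "inner (J v) (\<i> *\<^sub>C sigma_p (J v)) = 0"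
      using inner_sigma_p_i[OF J(2)[of v]] inner_sigma_p[OF J(2)[of v] W12_scaleC[OF J(2)[of v]]]
      by (simp add: sigma_p_scaleC J(2))
    ultimately have "s * inner (J v) (J v) = 0"
      by (simp add: sigma_p_scaleC J(2) scaleC_scaleC inner_add_right inner_diff_right scaleC_minus_left)
    then show "v = 0" using s J(4) by auto
  qed (simp_all add: subspace_W12)
  then have "G \<in> ?X ` W12" by simp
  then show ?thesis by blast
qed

text \<open>Von Neumann's criterion. Surjectivity of \<open>P - \<i>\<close> gives \<open>u\<close>
  in the domain with the image that \<open>v\<close> would formally have; then \<open>v - u\<close>
  is orthogonal to the range of \<open>P + \<i>\<close>, which is everything, so
  \<open>v = u\<close>.\<close>

lemma sigma_p_adjoint_domain:
  assumes adj: "\<And>F. F \<in> W12 \<Longrightarrow> inner v (sigma_p F) = inner w F"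
  shows "v \<in> W12"
proof -
  obtain u where u: "u \<in> W12" "sigma_p u - 1 *\<^sub>R \<i> *\<^sub>C u = w - \<i> *\<^sub>C v"
    using sigma_p_minus_i_surj[of 1 "w - \<i> *\<^sub>C v"] by auto
  obtain F where F: "F \<in> W12" "sigma_p F - (- 1) *\<^sub>R \<i> *\<^sub>C F = v - u"
    using sigma_p_minus_i_surj[of "- 1" "v - u"] by auto
  have "inner x (\<i> *\<^sub>C F) = - inner (\<i> *\<^sub>C x) F" for x
    by (simp add: inner_scaleC_right scaleC_minus_left)
  then have "inner (v - u) (sigma_p F - (- 1) *\<^sub>R \<i> *\<^sub>C F)
      = inner ((w - \<i> *\<^sub>C v) - (sigma_p u - 1 *\<^sub>R \<i> *\<^sub>C u)) F"
    using adj[OF F(1)] inner_sigma_p[OF u(1) F(1)]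
    by (simp add: inner_diff_left inner_add_right scaleC_diff_right)
  then have "inner (v - u) (v - u) = 0" unfolding F(2) u(2) by simp
  then show ?thesis using u(1) by simp
qed

section \<open>The shifted Dirac operator\<close>

lemma L_infinity_cnj: "V \<in> L_infinity \<Longrightarrow> (\<lambda>x. cnj (V x)) \<in> L_infinity"
  using measurable_compose[of V lebesgue borel cnj borel] borel_measurable_continuous_onI[of cnj]
  by (auto simp: L_infinity_def continuous_on_cnj continuous_on_id)

lemma L_infinity_affine:
  assumes "V \<in> L_infinity"
  shows "(\<lambda>x. c * (a + V x)) \<in> L_infinity"
proof -
  obtain C where C: "AE x in lebesgue. norm (V x) \<le> C" using assms by (auto simp: L_infinity_def)
  then have "AE x in lebesgue. norm (c * (a + V x)) \<le> norm c * (norm a + C)"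
  proof eventually_elim
    case (elim x)
    then show ?case unfolding norm_mult
      by (intro mult_left_mono order_trans[OF norm_triangle_ineq]) auto
  qed
  then show ?thesis using assms by (auto simp: L_infinity_def)
qed

lemma inner_L2_mult:
  assumes V: "V \<in> L_infinity"
  shows "inner (L2_mult V F) G = inner F (L2_mult (\<lambda>x. cnj (V x)) G)"
proof -
  obtain f g where "square_integrable f" "F = abs_L2 f" "square_integrable g" "G = abs_L2 g"
    by (metis L2_rep)
  moreover have "inner (c *s u) v = inner u (cnj c *s v)" for c and u v :: "complex^2"
    by (simp add: inner_vec_def inner_complex_def algebra_simps)
  ultimately show ?thesis
    by (simp add: abs_L2_mult inner_abs_L2 square_integrable_mult V L_infinity_cnj)
qed

lemma bounded_linear_L2_mult:
  assumes V: "V \<in> L_infinity"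
  shows "bounded_linear (L2_mult V)"
proof -
  obtain C where C: "AE x in lebesgue. norm (V x) \<le> C" using V by (auto simp: L_infinity_def)
  have lin: "linear (L2_mult V)" by (rule adjoint_imp_linear) (rule inner_L2_mult[OF V])
  have "norm (L2_mult V F) \<le> norm F * \<bar>C\<bar>" for F
  proof -
    obtain f where f: "square_integrable f" "F = abs_L2 f" by (rule L2_rep)
    note Vf = square_integrable_mult[OF V f(1)]
    have "(norm (abs_L2 (\<lambda>x. V x *s f x)))\<^sup>2 \<le> (\<integral>x. C\<^sup>2 * (norm (f x))\<^sup>2 \<partial>lebesgue)"
      unfolding norm_abs_L2[OF Vf]
    proof (rule integral_mono_AE)
      show "AE x in lebesgue. (norm (V x *s f x))\<^sup>2 \<le> C\<^sup>2 * (norm (f x))\<^sup>2"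
        using C
      proof eventually_elim
        case (elim x)
        then have "(norm (V x))\<^sup>2 \<le> C\<^sup>2" by (intro power_mono) auto
        then show ?case
          by (simp add: norm_vector_scalar_mult power_mult_distrib mult_right_mono)
      qed
    qed (use f Vf in \<open>auto simp: square_integrable_def\<close>)
    also have "\<dots> = (norm F * \<bar>C\<bar>)\<^sup>2"
      by (simp add: f norm_abs_L2 power_mult_distrib mult.commute)
    finally have "norm (abs_L2 (\<lambda>x. V x *s f x)) \<le> norm F * \<bar>C\<bar>"
      by (rule power2_le_imp_le) simp
    then show ?thesis by (simp add: f abs_L2_mult[OF V])
  qed
  then show ?thesis
    by (intro bounded_linear_intro[where K = "\<bar>C\<bar>"]) (simp_all add: linear_add[OF lin] linear_scale[OF lin])
qed

lemma L2_mult_scaleC: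
  assumes V: "V \<in> L_infinity"
  shows "L2_mult V (c *\<^sub>C F) = c *\<^sub>C L2_mult V F"
proof -
  obtain f where f: "square_integrable f" "F = abs_L2 f" by (rule L2_rep)
  then show ?thesis
    by (simp add: abs_L2_mult V abs_L2_scaleC square_integrable_scaleC square_integrable_mult
        vector_smult_assoc mult.commute)
qed

text \<open>Absorbs the scalar terms and the rotation into one multiplier, so that a pointwise bound
  on its imaginary part controls the whole diagonal entry of the form.\<close>

lemma L2_mult_affine:
  assumes V: "V \<in> L_infinity"
  shows "L2_mult (\<lambda>x. c * (a + V x)) F = c *\<^sub>C (a *\<^sub>C F + L2_mult V F)"
proof -
  obtain f where f: "square_integrable f" "F = abs_L2 f" by (rule L2_rep)
  have "(c * (a + v)) *s u = c *s (a *s u + v *s u)" for v and u :: "complex^2"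
    by (simp add: vec_eq_iff algebra_simps)
  then show ?thesis
    by (simp add: f abs_L2_mult V L_infinity_affine abs_L2_scaleC abs_L2_add square_integrable_scaleC
        square_integrable_mult square_integrable_add)
qed

lemma Im_cinner_L2_mult_le:
  assumes W: "W \<in> L_infinity" and le: "AE x in lebesgue. s * Im (W x) \<le> - d"
  shows "s * Im (cinner (L2_mult W F) F) \<le> - d * (norm F)\<^sup>2"
proof -
  obtain f where f: "square_integrable f" "F = abs_L2 f" by (rule L2_rep)
  have dot: "cdot (w *s u) u = w * complex_of_real ((norm u)\<^sup>2)" for w u
    by (simp add: cdot_def norm_vec_sq sum_distrib_left mult.assoc complex_norm_square del: of_real_power)
  note int = integrable_cdot[OF square_integrable_mult[OF W f(1)] f(1)]
  have "s * Im (cinner (L2_mult W F) F) = (\<integral>x. s * Im (cdot (W x *s f x) (f x)) \<partial>lebesgue)"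
    using integral_Im[OF int] by (simp add: f abs_L2_mult[OF W] cinner_abs_L2 square_integrable_mult W)
  also have "\<dots> \<le> (\<integral>x. - d * (norm (f x))\<^sup>2 \<partial>lebesgue)"
  proof (rule integral_mono_AE)
    show "integrable lebesgue (\<lambda>x. s * Im (cdot (W x *s f x) (f x)))"
      by (intro integrable_mult_right integrable_Im int)
    show "integrable lebesgue (\<lambda>x. - d * (norm (f x))\<^sup>2)"
      using f by (simp add: square_integrable_def)
    show "AE x in lebesgue. s * Im (cdot (W x *s f x) (f x)) \<le> - d * (norm (f x))\<^sup>2"
      using le
    proof eventually_elim
      case (elim x)
      have "s * Im (cdot (W x *s f x) (f x)) = (s * Im (W x)) * (norm (f x))\<^sup>2"
        by (simp add: dot)
      also have "\<dots> \<le> - d * (norm (f x))\<^sup>2" using elim by (intro mult_right_mono) auto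
      finally show ?case .
    qed
  qed
  also have "\<dots> = - d * (norm F)\<^sup>2" by (simp add: f norm_abs_L2)
  finally show ?thesis .
qed

section \<open>Form estimate and range of the shifted Dirac operator\<close>

definition dirac_shifted :: "(real^3 \<Rightarrow> complex) \<Rightarrow> complex \<Rightarrow> L2 \<times> L2 \<Rightarrow> L2 \<times> L2" where
  "dirac_shifted V l u =
     ((1 - l) *\<^sub>C fst u + L2_mult V (fst u) + sigma_p (snd u),
      sigma_p (fst u) + ((- 1 - l) *\<^sub>C snd u + L2_mult V (snd u)))"

lemma op_app_dirac_diff: "op_app (dirac V) u - l *\<^sub>C u = dirac_shifted V l u"
  by (cases u) (simp add: dirac_def dirac_shifted_def scaleC_prod_def scaleC_diff_left scaleC_minus_left)

definition rot :: "real \<Rightarrow> L2 \<times> L2 \<Rightarrow> L2 \<times> L2" where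
  "rot \<theta> u = (exp (- (\<i> * complex_of_real \<theta>)) *\<^sub>C fst u, exp (\<i> * complex_of_real \<theta>) *\<^sub>C snd u)"

lemma B_rot_eq: "B_rot \<theta> = Operator UNIV (rot \<theta>)"
  by (auto simp: B_rot_def rot_def)

lemma norm_rot: "norm (rot \<theta> u) = norm u"
  by (cases u) (simp add: rot_def norm_prod_def norm_scaleC norm_exp_eq_Re)

lemma inner_rot: "inner (rot \<theta> u) (rot \<theta> v) = inner u v"
proof -
  have "norm (exp (\<i> * complex_of_real t)) = 1" for t by simp
  then have "cnj (exp (\<i> * complex_of_real t)) * exp (\<i> * complex_of_real t) = 1" for t
    by (simp add: exp_cnj flip: exp_add)
  from this[of \<theta>] this[of "- \<theta>"] show ?thesis
    by (simp add: rot_def inner_prod_def inner_scaleC_left scaleC_scaleC)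
qed

lemma rot_diff_scaleC: "rot \<theta> u - l *\<^sub>C rot \<theta> v = rot \<theta> (u - l *\<^sub>C v)"
  by (simp add: rot_def scaleC_prod_def scaleC_diff_right scaleC_scaleC mult.commute)

lemma dirac_shifted_add:
  assumes V: "V \<in> L_infinity" and "u \<in> W12 \<times> W12" "v \<in> W12 \<times> W12"
  shows "dirac_shifted V l (u + v) = dirac_shifted V l u + dirac_shifted V l v"
  using assms(2,3)
  by (auto simp: dirac_shifted_def sigma_p_add scaleC_add_right
      linear_add[OF bounded_linear.linear[OF bounded_linear_L2_mult[OF V]]])

lemma dirac_shifted_scaleC:
  assumes V: "V \<in> L_infinity" and "u \<in> W12 \<times> W12"
  shows "dirac_shifted V l (c *\<^sub>C u) = c *\<^sub>C dirac_shifted V l u"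
  using assms(2)
  by (auto simp: dirac_shifted_def scaleC_prod_def sigma_p_scaleC scaleC_add_right scaleC_scaleC
      L2_mult_scaleC[OF V] mult.commute)

lemma subspace_W12_prod: "subspace (W12 \<times> W12)"
  using subspace_W12 by (rule subspace_Times[OF _ subspace_W12])

lemma W12_prod_scaleC: "u \<in> W12 \<times> W12 \<Longrightarrow> c *\<^sub>C u \<in> W12 \<times> W12"
  by (auto simp: scaleC_prod_def W12_scaleC)

lemma rot_in_W12: "u \<in> W12 \<times> W12 \<Longrightarrow> rot \<theta> u \<in> W12 \<times> W12"
  by (auto simp: rot_def W12_scaleC)

lemma dirac_shifted_closed:
  assumes V: "V \<in> L_infinity"
    and S: "\<And>n. S n \<in> W12 \<times> W12" "S \<longlonglongrightarrow> u" "(\<lambda>n. dirac_shifted V l (S n)) \<longlonglongrightarrow> y"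
  shows "u \<in> W12 \<times> W12 \<and> dirac_shifted V l u = y"
proof -
  note tendsto_V = bounded_linear.tendsto[OF bounded_linear_L2_mult[OF V]]
  have fS: "(\<lambda>n. fst (S n)) \<longlonglongrightarrow> fst u" and sS: "(\<lambda>n. snd (S n)) \<longlonglongrightarrow> snd u"
    using S(2) by (auto intro: tendsto_fst tendsto_snd)
  have "(\<lambda>n. fst (dirac_shifted V l (S n)) - ((1 - l) *\<^sub>C fst (S n) + L2_mult V (fst (S n))))
      \<longlonglongrightarrow> fst y - ((1 - l) *\<^sub>C fst u + L2_mult V (fst u))"
    by (intro tendsto_diff tendsto_add tendsto_fst S tendsto_scaleC tendsto_V)
  then have "(\<lambda>n. sigma_p (snd (S n))) \<longlonglongrightarrow> fst y - ((1 - l) *\<^sub>C fst u + L2_mult V (fst u))"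
    by (simp add: dirac_shifted_def)
  from sigma_p_closed[OF _ sS this] S(1)
  have 1: "snd u \<in> W12" "sigma_p (snd u) = fst y - ((1 - l) *\<^sub>C fst u + L2_mult V (fst u))"
    by (auto simp: mem_Times_iff)
  have "(\<lambda>n. snd (dirac_shifted V l (S n)) - ((- 1 - l) *\<^sub>C snd (S n) + L2_mult V (snd (S n))))
      \<longlonglongrightarrow> snd y - ((- 1 - l) *\<^sub>C snd u + L2_mult V (snd u))"
    by (intro tendsto_diff tendsto_add tendsto_snd S tendsto_scaleC tendsto_V)
  then have "(\<lambda>n. sigma_p (fst (S n))) \<longlonglongrightarrow> snd y - ((- 1 - l) *\<^sub>C snd u + L2_mult V (snd u))"
    by (simp add: dirac_shifted_def)
  from sigma_p_closed[OF _ fS this] S(1)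
  have 2: "fst u \<in> W12" "sigma_p (fst u) = snd y - ((- 1 - l) *\<^sub>C snd u + L2_mult V (snd u))"
    by (auto simp: mem_Times_iff)
  show ?thesis using 1 2 by (simp add: dirac_shifted_def mem_Times_iff)
qed

lemma Im_dirac_form_le:
  assumes V: "V \<in> L_infinity" and u: "u \<in> W12 \<times> W12"
    and up: "AE x in lebesgue. s * Im (exp (- (\<i> * complex_of_real \<theta>)) * (1 - l + V x)) \<le> - d"
    and dn: "AE x in lebesgue. s * Im (exp (\<i> * complex_of_real \<theta>) * (- 1 - l + V x)) \<le> - d"
  shows "s * Im (cinner (rot \<theta> (dirac_shifted V l u)) u) \<le> - d * (norm u)\<^sup>2"
proof -
  obtain f g where fg: "u = (f, g)" "f \<in> W12" "g \<in> W12" using u by blast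
  let ?e = "exp (\<i> * complex_of_real \<theta>)" and ?e' = "exp (- (\<i> * complex_of_real \<theta>))"
  let ?w = "?e * cinner (sigma_p f) g"
  have e': "?e' = cnj ?e" by (simp add: exp_cnj)
  have "cinner (sigma_p g) f = cnj (cinner (sigma_p f) g)"
    using cinner_sigma_p[OF fg(2,3)] cinner_commute[of "sigma_p g" f] by simp
  \<comment> \<open>The two off-diagonal contributions are complex conjugates of each other, so
    their sum has no imaginary part.\<close>
  then have w: "?e' * cinner (sigma_p g) f = cnj ?w" by (simp add: e')
  have "cinner (rot \<theta> (dirac_shifted V l u)) u
      = cinner (L2_mult (\<lambda>x. ?e' * (1 - l + V x)) f) f + cinner (L2_mult (\<lambda>x. ?e * (- 1 - l + V x)) g) g
        + (?w + ?e' * cinner (sigma_p g) f)"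
    by (simp add: fg rot_def dirac_shifted_def cinner_prod_def L2_mult_affine[OF V]
        cinner_scaleC_left cinner_add_left) (simp add: algebra_simps)
  then have "s * Im (cinner (rot \<theta> (dirac_shifted V l u)) u)
      = s * Im (cinner (L2_mult (\<lambda>x. ?e' * (1 - l + V x)) f) f)
        + s * Im (cinner (L2_mult (\<lambda>x. ?e * (- 1 - l + V x)) g) g)"
    unfolding w by (simp add: distrib_left)
  also have "\<dots> \<le> - d * (norm f)\<^sup>2 + - d * (norm g)\<^sup>2"
    by (intro add_mono Im_cinner_L2_mult_le L_infinity_affine V up dn)
  also have "\<dots> = - d * (norm u)\<^sup>2"
    by (simp add: fg norm_prod_def algebra_simps)
  finally show ?thesis .
qed

lemma norm_dirac_shifted_ge:
  assumes s: "\<bar>s\<bar> = 1" and form: "s * Im (cinner (rot \<theta> (dirac_shifted V l u)) u) \<le> - d * (norm u)\<^sup>2"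
  shows "d * norm u \<le> norm (dirac_shifted V l u)"
proof (cases "u = 0")
  case False
  have "d * (norm u)\<^sup>2 \<le> \<bar>Im (cinner (rot \<theta> (dirac_shifted V l u)) u)\<bar>"
    using form s by (cases "s \<ge> 0") (auto simp: abs_if split: if_splits)
  also have "\<dots> \<le> norm (rot \<theta> (dirac_shifted V l u)) * norm (\<i> *\<^sub>C u)"
    unfolding Im_cinner by (rule Cauchy_Schwarz_ineq2)
  finally have "(d * norm u) * norm u \<le> norm (dirac_shifted V l u) * norm u"
    by (simp add: norm_rot norm_scaleC power2_eq_square mult.assoc)
  then show ?thesis using False by simp
qed simp

text \<open>Testing with pairs having one zero component isolates \<open>sigma_p\<close> acting
  against a single component of \<open>v\<close>; the bounded terms pass to their adjoints and form
  the right-hand side for \<open>sigma_p_adjoint_domain\<close>.\<close>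

lemma dirac_shifted_range_orthogonal:
  assumes V: "V \<in> L_infinity" and v: "\<And>u. u \<in> W12 \<times> W12 \<Longrightarrow> inner v (dirac_shifted V l u) = 0"
  shows "v \<in> W12 \<times> W12"
proof -
  let ?V' = "L2_mult (\<lambda>x. cnj (V x))"
  have adj: "inner x (c *\<^sub>C F + L2_mult V F) = inner (cnj c *\<^sub>C x + ?V' x) F" for x c F
  proof -
    have "inner x (L2_mult V F) = inner (?V' x) F"
      using inner_L2_mult[OF V, of F x] by (simp add: inner_commute)
    then show ?thesis by (simp add: inner_add_left inner_add_right inner_scaleC_right)
  qed
  have "inner (fst v) (sigma_p F) = inner (- (cnj (- 1 - l) *\<^sub>C snd v + ?V' (snd v))) F"
    if "F \<in> W12" for F
    using v[of "(0, F)"] that adj[of "snd v" "- 1 - l" F] W12_0 sigma_p_scaleC[OF W12_0, of 0]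
      linear_0[OF bounded_linear.linear[OF bounded_linear_L2_mult[OF V]]]
    by (simp add: dirac_shifted_def inner_prod_def inner_add_left inner_diff_left inner_minus_left; linarith)
  then have 1: "fst v \<in> W12" by (rule sigma_p_adjoint_domain)
  have "inner (snd v) (sigma_p F) = inner (- (cnj (1 - l) *\<^sub>C fst v + ?V' (fst v))) F"
    if "F \<in> W12" for F
    using v[of "(F, 0)"] that adj[of "fst v" "1 - l" F] W12_0 sigma_p_scaleC[OF W12_0, of 0]
      linear_0[OF bounded_linear.linear[OF bounded_linear_L2_mult[OF V]]]
    by (simp add: dirac_shifted_def inner_prod_def inner_add_left inner_diff_left inner_minus_left; linarith)
  then have 2: "snd v \<in> W12" by (rule sigma_p_adjoint_domain)
  show ?thesis using 1 2 by (simp add: mem_Times_iff)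
qed

lemma dirac_shifted_surj:
  assumes V: "V \<in> L_infinity" and s: "\<bar>s\<bar> = 1" and d: "0 < d"
    and form: "\<And>u. u \<in> W12 \<times> W12 \<Longrightarrow>
      s * Im (cinner (rot \<theta> (dirac_shifted V l u)) u) \<le> - d * (norm u)\<^sup>2"
  shows "dirac_shifted V l ` (W12 \<times> W12) = UNIV"
proof (rule surj_if_bounded_below[where c = d])
  show "dirac_shifted V l (r *\<^sub>R u) = r *\<^sub>R dirac_shifted V l u" if "u \<in> W12 \<times> W12" for r u
    using dirac_shifted_scaleC[OF V that] by (simp add: scaleR_scaleC)
  fix v assume v: "\<And>u. u \<in> W12 \<times> W12 \<Longrightarrow> inner v (dirac_shifted V l u) = 0"
  \<comment> \<open>Since \<open>rot\<close> is an isometry, pairing \<open>v\<close> with the image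
    of \<open>?u\<close> is the same as evaluating the rotated form at \<open>?u\<close>. Inserting
    \<open>\<i>\<close> selects its imaginary part, which is strictly definite.\<close>
  let ?u = "rot \<theta> v"
  have u: "?u \<in> W12 \<times> W12" by (intro rot_in_W12 dirac_shifted_range_orthogonal[OF V v])
  have "inner v (\<i> *\<^sub>C dirac_shifted V l ?u) = 0"
    using v[OF W12_prod_scaleC[OF u], of \<i>] by (simp add: dirac_shifted_scaleC[OF V u])
  then have "inner ?u (rot \<theta> (\<i> *\<^sub>C dirac_shifted V l ?u)) = 0" by (simp add: inner_rot)
  also have "rot \<theta> (\<i> *\<^sub>C dirac_shifted V l ?u) = \<i> *\<^sub>C rot \<theta> (dirac_shifted V l ?u)"
    by (simp add: rot_def scaleC_prod_def scaleC_scaleC mult.commute)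
  finally have "Im (cinner (rot \<theta> (dirac_shifted V l ?u)) ?u) = 0"
    using cinner_commute[of "rot \<theta> (dirac_shifted V l ?u)" ?u] by (simp add: Im_cinner)
  then have "d * (norm v)\<^sup>2 \<le> 0" using form[OF u] by (simp add: norm_rot)
  then show "v = 0" using d by (simp add: mult_le_0_iff)
next
  show "u \<in> W12 \<times> W12 \<and> dirac_shifted V l u = y"
    if "\<And>n. S n \<in> W12 \<times> W12" "S \<longlonglongrightarrow> u" "(\<lambda>n. dirac_shifted V l (S n)) \<longlonglongrightarrow> y" for S u y
    using that by (rule dirac_shifted_closed[OF V])
qed (use d norm_dirac_shifted_ge[OF s form] in
    \<open>simp_all add: subspace_W12_prod dirac_shifted_add[OF V]\<close>)

lemma dirac_resolvent:
  assumes V: "V \<in> L_infinity" and s: "\<bar>s\<bar> = 1" and d: "0 < d"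
    and up: "AE x in lebesgue. s * Im (exp (- (\<i> * complex_of_real \<theta>)) * (1 - l + V x)) \<le> - d"
    and dn: "AE x in lebesgue. s * Im (exp (\<i> * complex_of_real \<theta>) * (- 1 - l + V x)) \<le> - d"
  shows "l \<notin> pencil_numerical_range (op_mult (B_rot \<theta>) (dirac V)) (B_rot \<theta>)"
    and "l \<in> resolvent_set (dirac V)"
    and "onorm (resolvent (dirac V) l) \<le> 1 / d"
proof -
  note form = Im_dirac_form_le[OF V _ up dn]
  have dom: "op_dom (dirac V) = W12 \<times> W12" by (simp add: dirac_def)
  have app: "op_app (op_diff (dirac V) (op_scale l op_ident)) = dirac_shifted V l"
    "op_dom (op_diff (dirac V) (op_scale l op_ident)) = W12 \<times> W12"
    by (simp_all add: op_diff_def op_scale_def op_ident_def op_app_dirac_diff dom)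
  show "l \<notin> pencil_numerical_range (op_mult (B_rot \<theta>) (dirac V)) (B_rot \<theta>)"
  proof
    let ?S = "op_diff (op_mult (B_rot \<theta>) (dirac V)) (op_scale l (B_rot \<theta>))"
    assume "l \<in> pencil_numerical_range (op_mult (B_rot \<theta>) (dirac V)) (B_rot \<theta>)"
    then have "0 \<in> closure (numerical_range ?S)" by (simp add: pencil_numerical_range_def)
    \<comment> \<open>The form estimate on unit vectors confines the numerical range to a closed
      half-plane that misses 0, so its closure misses 0 as well.\<close>
    moreover have "numerical_range ?S \<subseteq> {z. s * Im z \<le> - d}"
    proof
      fix z assume "z \<in> numerical_range ?S"
      then obtain x where x: "z = cinner (rot \<theta> (dirac_shifted V l x)) x" "x \<in> W12 \<times> W12" "norm x = 1"
        by (auto simp: numerical_range_def op_diff_def op_mult_def op_scale_def B_rot_eq dom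
            rot_diff_scaleC op_app_dirac_diff)
      then show "z \<in> {z. s * Im z \<le> - d}" using form[OF x(2)] by simp
    qed
    moreover have "closed {z. s * Im z \<le> - d}"
      by (intro closed_Collect_le continuous_intros)
    ultimately have "0 \<in> {z. s * Im z \<le> - d}" using closure_minimal by blast
    then show False using d by simp
  qed
  note below = norm_dirac_shifted_ge[OF s form]
  have minus: "dirac_shifted V l (u - v) = dirac_shifted V l u - dirac_shifted V l v"
    if "u \<in> W12 \<times> W12" "v \<in> W12 \<times> W12" for u v
    using dirac_shifted_add[OF V that(1) W12_prod_scaleC[OF that(2), of "- 1"], of l]
      dirac_shifted_scaleC[OF V that(2), of l "- 1"]
    by (simp add: scaleC_minus_left)
  have inj: "inj_on (dirac_shifted V l) (W12 \<times> W12)"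
  proof (rule inj_onI)
    fix u v assume uv: "u \<in> W12 \<times> W12" "v \<in> W12 \<times> W12" "dirac_shifted V l u = dirac_shifted V l v"
    then have "d * norm (u - v) \<le> 0"
      using below[OF subspace_diff[OF subspace_W12_prod uv(1,2)]] by (simp add: minus)
    then show "u = v" using d by (simp add: mult_le_0_iff)
  qed
  have surj: "dirac_shifted V l ` (W12 \<times> W12) = UNIV"
    by (rule dirac_shifted_surj[OF V s d form])
  define Q where "Q = resolvent (dirac V) l"
  have Q_def': "Q = inv_into (W12 \<times> W12) (dirac_shifted V l)"
    by (simp add: Q_def resolvent_def app Let_def)
  have Q: "Q y \<in> W12 \<times> W12" "dirac_shifted V l (Q y) = y" for y
    using surj by (simp_all add: Q_def' inv_into_into f_inv_into_f)
  have Qeq: "Q y = u" if "u \<in> W12 \<times> W12" "dirac_shifted V l u = y" for u y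
    using that inj by (auto simp: Q_def')
  have Qle: "norm (Q y) \<le> (1 / d) * norm y" for y
    using below[OF Q(1)[of y]] d by (simp add: Q(2) field_simps)
  have Qbl: "bounded_linear Q"
  proof (rule bounded_linear_intro)
    show "Q (x + y) = Q x + Q y" for x y
      by (rule Qeq) (simp_all add: subspace_add[OF subspace_W12_prod] Q dirac_shifted_add[OF V])
    show "Q (r *\<^sub>R x) = r *\<^sub>R Q x" for r x
      by (rule Qeq) (simp_all add: W12_prod_scaleC Q
          scaleR_scaleC dirac_shifted_scaleC[OF V])
    show "norm (Q y) \<le> norm y * (1 / d)" for y using Qle by (simp add: mult.commute)
  qed
  show "l \<in> resolvent_set (dirac V)"
    using inj surj Qbl by (simp add: resolvent_set_def app Let_def bij_betw_def Q_def)
  show "onorm (resolvent (dirac V) l) \<le> 1 / d"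
    unfolding Q_def[symmetric] using Qle d by (intro onorm_bound) auto
qed

section \<open>Essential range and sectors\<close>

text \<open>The values outside the essential range are covered by balls with null preimage.
  Lindelof's theorem reduces the cover to countably many balls, whose preimages form a null set
  together.\<close>

lemma AE_essran:
  assumes V: "V \<in> borel_measurable lebesgue"
  shows "AE x in lebesgue. V x \<in> essran V"
proof -
  let ?F = "{ball w \<epsilon> | w \<epsilon>. emeasure lebesgue {x. V x \<in> ball w \<epsilon>} = 0}"
  obtain \<F> where \<F>: "\<F> \<subseteq> ?F" "countable \<F>" "\<Union>\<F> = \<Union>?F"
    using Lindelof[of ?F] by blast
  have "AE x in lebesgue. V x \<notin> B" if B: "B \<in> \<F>" for B
  proof -
    obtain w \<epsilon> where w: "B = ball w \<epsilon>" "emeasure lebesgue {x. V x \<in> ball w \<epsilon>} = 0"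
      using \<F>(1) B by blast
    have "{x. V x \<in> B} \<in> sets lebesgue"
      using measurable_sets[OF V, of B] w(1) by (simp add: vimage_def)
    then have "{x. V x \<in> B} \<in> null_sets lebesgue" using w by (simp add: null_sets_def)
    from AE_not_in[OF this] show ?thesis by simp
  qed
  then have "AE x in lebesgue. \<forall>B\<in>\<F>. V x \<notin> B"
    by (simp add: AE_ball_countable[OF \<F>(2)])
  then show ?thesis
  proof eventually_elim
    case (elim x)
    show ?case
    proof (rule ccontr)
      assume "V x \<notin> essran V"
      then obtain \<epsilon> where \<epsilon>: "\<epsilon> > 0" "emeasure lebesgue {y. dist (V y) (V x) < \<epsilon>} = 0"
        unfolding essran_def by (auto simp: zero_less_iff_neq_zero)
      then have "emeasure lebesgue {y. V y \<in> ball (V x) \<epsilon>} = 0" by (simp add: dist_commute)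
      then have "ball (V x) \<epsilon> \<in> ?F" by blast
      then have "V x \<in> \<Union>\<F>" unfolding \<F>(3) using \<epsilon>(1) by (intro UnionI[of "ball (V x) \<epsilon>"]) auto
      then show False using elim by blast
    qed
  qed
qed

text \<open>Rewrites the supporting line as a sign condition in coordinates rotated along the ray. A
  supporting line does not reveal on which side of the directed ray the set lies, so the sign of
  \<open>c\<close> remains open here.\<close>

lemma tangential_ray:
  assumes "tangential (ray z \<theta>) C"
  obtains c w where "c \<noteq> 0" "w \<in> C"
    "\<And>w. w \<in> C \<Longrightarrow> c * Im (exp (- (\<i> * complex_of_real \<theta>)) * (w - z)) \<le> 0"
proof -
  let ?e = "exp (\<i> * complex_of_real \<theta>)"
  obtain a b where ab: "a \<noteq> 0" "affine hull (ray z \<theta>) = {w. inner a w = b}" "C \<subseteq> {w. inner a w \<le> b}"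
    and ne: "C \<noteq> {}"
    using assms unfolding tangential_def supporting_line_def by blast
  have "z \<in> ray z \<theta>" "z + ?e \<in> ray z \<theta>"
    by (auto simp: ray_def intro: exI[of _ 0] exI[of _ 1])
  then have "inner a z = b" "inner a (z + ?e) = b"
    using hull_subset[of "ray z \<theta>" affine] ab(2) by blast+
  then have z: "inner a z = b" and e: "inner a ?e = 0" by (simp_all add: inner_add_right)
  \<comment> \<open>The ray direction lies in the line with normal \<open>a\<close>, so
    \<open>k\<close> is purely imaginary; its imaginary part is the factor relating the two linear
    functionals.\<close>
  define k where "k = cnj a * ?e"
  have inner_eq: "inner a w = Re (cnj a * w)" for w by (simp add: inner_complex_def)
  have "Re k = 0" using e by (simp add: k_def inner_eq)
  moreover have "k \<noteq> 0" using ab(1) by (simp add: k_def)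
  ultimately have c: "- Im k \<noteq> 0" by (simp add: complex_eq_iff)
  have le: "- Im k * Im (exp (- (\<i> * complex_of_real \<theta>)) * (w - z)) \<le> 0" if "w \<in> C" for w
  proof -
    define u where "u = exp (- (\<i> * complex_of_real \<theta>)) * (w - z)"
    have "w - z = ?e * u" by (simp add: u_def exp_minus)
    then have "inner a (w - z) = Re (k * u)" by (simp add: inner_eq k_def mult.assoc)
    also have "\<dots> = - Im k * Im u" using \<open>Re k = 0\<close> by simp
    finally show ?thesis using that ab(3) z by (auto simp: u_def inner_diff_right)
  qed
  show thesis using that[OF c _ le] ne by blast
qed

lemma mult_neg_if_bounded_ray:
  fixes c m k :: real
  assumes le: "\<And>t. t \<ge> 0 \<Longrightarrow> c * (m + t * k) \<le> 0" and "c \<noteq> 0" "k \<noteq> 0"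
  shows "c * k < 0"
proof (rule ccontr)
  assume "\<not> c * k < 0"
  define q where "q = c * k"
  have q: "q > 0" using \<open>\<not> c * k < 0\<close> assms(2,3) by (simp add: q_def not_less order_less_le)
  \<comment> \<open>Far enough out for the linear term to exceed the absolute value of
    \<open>c * m\<close> by 1.\<close>
  define t where "t = (\<bar>c * m\<bar> + 1) / q"
  have "t \<ge> 0" using q by (simp add: t_def)
  then have "c * m + t * q \<le> 0" using le[of t] by (simp add: q_def algebra_simps)
  moreover have "t * q = \<bar>c * m\<bar> + 1" using q by (simp add: t_def)
  ultimately show False by linarith
qed

section \<open>Sectors as intersections of half-planes\<close>

lemma exp_i_real: "exp (\<i> * complex_of_real t) = cis t" "exp (- (\<i> * complex_of_real t)) = cis (- t)"
  by (simp_all add: cis_conv_exp)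

lemma sign_cases: "\<bar>s\<bar> = 1 \<Longrightarrow> s = 1 \<or> s = (- 1 :: real)"
  by (auto simp: abs_if split: if_splits)

lemma sin_sign: "\<bar>s\<bar> = 1 \<Longrightarrow> sin (s * t) = s * sin (t :: real)"
  using sign_cases[of s] by auto

lemma sign_mult_le_0:
  fixes c s X :: real
  assumes "\<bar>s\<bar> = 1" "0 < c * s" "c * X \<le> 0"
  shows "s * X \<le> 0"
proof -
  have "s * s = 1" using sign_cases[OF assms(1)] by auto
  moreover have "(c * s) * (s * X) = (s * s) * (c * X)" by (simp only: mult_ac)
  ultimately have "(c * s) * (s * X) = c * X" by (simp only: mult_1_left)
  then have "(c * s) * (s * X) \<le> 0" using assms(3) by (simp only:)
  then show ?thesis using mult_pos_pos[OF assms(2), of "s * X"] by linarith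
qed

text \<open>The sign \<open>s\<close> treats the upper (\<open>s = 1\<close>) and the lower (\<open>s = - 1\<close>) sectors simultaneously.\<close>

definition signed_sector :: "real \<Rightarrow> real \<Rightarrow> complex \<Rightarrow> complex set" where
  "signed_sector s \<phi> z = {z + w | w. w \<noteq> 0 \<and> \<phi> < s * Arg w \<and> s * Arg w < pi - \<phi>}"

lemma upper_sector_eq: "upper_sector \<phi> z = signed_sector 1 \<phi> z"
  by (simp add: upper_sector_def sector_def signed_sector_def)

lemma lower_sector_eq: "lower_sector \<phi> z = signed_sector (- 1) \<phi> z"
proof -
  have "(- pi + \<phi> < a \<and> a < - \<phi>) \<longleftrightarrow> (\<phi> < - 1 * a \<and> - 1 * a < pi - \<phi>)" for a by auto
  then show ?thesis unfolding lower_sector_def sector_def signed_sector_def by simp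
qed

lemma Im_cis_mult: "s * Im (cis t * w) = cmod w * (s * sin (Arg w + t))"
proof -
  have "cis t * w = complex_of_real (cmod w) * cis (Arg w + t)"
    using rcis_cmod_Arg[of w] by (metis (no_types, lifting) cis_mult mult.left_commute mult.commute rcis_def)
  then show ?thesis by simp
qed

text \<open>As the opening angle is at most \<open>pi\<close>, the sector is the intersection of the
  open half-planes along its two boundary rays; for \<open>\<phi> = 0\<close> they coincide. All
  later geometry is done with these linear inequalities in place of arguments.\<close>

lemma signed_sector_iff:
  assumes s: "\<bar>s\<bar> = 1" and \<phi>: "0 \<le> \<phi>" "\<phi> < pi / 2"
  shows "l \<in> signed_sector s \<phi> z \<longleftrightarrow>
    0 < s * Im (cis (- (s * \<phi>)) * (l - z)) \<and> 0 < s * Im (cis (s * \<phi>) * (l - z))"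
proof -
  define w where "w = l - z"
  define x where "x = s * Arg w"
  have mem: "l \<in> signed_sector s \<phi> z \<longleftrightarrow> w \<noteq> 0 \<and> \<phi> < x \<and> x < pi - \<phi>"
  proof -
    have "l = z + w" by (simp add: w_def)
    then show ?thesis unfolding signed_sector_def x_def by auto
  qed
  have ss: "s * s = 1" using sign_cases[OF s] by auto
  have sin1: "s * sin (Arg w + - (s * \<phi>)) = sin (x - \<phi>)"
    using sin_sign[OF s, of "Arg w + - (s * \<phi>)"] ss by (simp add: x_def algebra_simps flip: mult.assoc)
  have sin2: "s * sin (Arg w + s * \<phi>) = sin (x + \<phi>)"
    using sin_sign[OF s, of "Arg w + s * \<phi>"] ss by (simp add: x_def algebra_simps flip: mult.assoc)
  have "w \<noteq> 0 \<and> \<phi> < x \<and> x < pi - \<phi> \<longleftrightarrow> w \<noteq> 0 \<and> 0 < sin (x - \<phi>) \<and> 0 < sin (x + \<phi>)"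
  proof safe
    assume "\<phi> < x" "x < pi - \<phi>"
    then show "0 < sin (x - \<phi>)" "0 < sin (x + \<phi>)" using \<phi> by (auto intro!: sin_gt_zero)
  next
    assume w: "w \<noteq> 0" and pos: "0 < sin (x - \<phi>)" "0 < sin (x + \<phi>)"
    \<comment> \<open>Adding the two inequalities leaves \<open>2 * sin x * cos \<phi>\<close>, and
      \<open>cos \<phi>\<close> is positive; this excludes negative \<open>x\<close>.\<close>
    have "0 < 2 * sin x * cos \<phi>" using pos unfolding sin_add sin_diff by linarith
    moreover have "0 < cos \<phi>" using \<phi> by (intro cos_gt_zero_pi) auto
    ultimately have "0 < 2 * sin x" by (rule zero_less_mult_pos2)
    then have sx: "0 < sin x" by simp
    have "\<bar>x\<bar> \<le> pi" using s Arg_bounded[of w] by (simp add: x_def abs_mult abs_le_iff)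
    have x0: "0 < x"
    proof (rule ccontr)
      assume "\<not> 0 < x"
      then have "0 \<le> sin (- x)" using \<open>\<bar>x\<bar> \<le> pi\<close> by (intro sin_ge_zero) auto
      then show False using sx by simp
    qed
    show "\<phi> < x"
    proof (rule ccontr)
      assume "\<not> \<phi> < x"
      then have "0 \<le> sin (\<phi> - x)" using x0 \<phi> by (intro sin_ge_zero) auto
      then show False using pos(1) sin_minus[of "x - \<phi>"] by simp
    qed
    show "x < pi - \<phi>"
    proof (rule ccontr)
      assume "\<not> x < pi - \<phi>"
      then have "0 \<le> sin (x + \<phi> - pi)" using \<open>\<bar>x\<bar> \<le> pi\<close> \<phi> by (intro sin_ge_zero) auto
      then show False using pos(2) by (simp add: sin_diff)
    qed
  qed
  then show ?thesis
    unfolding mem Im_cis_mult w_def[symmetric] sin1 sin2 by (auto simp: zero_less_mult_iff)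
qed

lemma open_signed_sector:
  assumes "\<bar>s\<bar> = 1" "0 \<le> \<phi>" "\<phi> < pi / 2"
  shows "open (signed_sector s \<phi> z)"
proof -
  have "signed_sector s \<phi> z = {l. 0 < s * Im (cis (- (s * \<phi>)) * (l - z))}
      \<inter> {l. 0 < s * Im (cis (s * \<phi>) * (l - z))}"
    using signed_sector_iff[OF assms] by auto
  also have "open \<dots>"
    by (intro open_Int open_Collect_less continuous_intros)
  finally show ?thesis .
qed

text \<open>The rotated imaginary part is the distance from \<open>l\<close> to one of the boundary
  lines, chosen by \<open>t\<close>. The perpendicular to that line leaves the sector and therefore
  meets the frontier on the way.\<close>

lemma infdist_frontier_signed_sector:
  assumes s: "\<bar>s\<bar> = 1" and \<phi>: "0 \<le> \<phi>" "\<phi> < pi / 2" and l: "l \<in> signed_sector s \<phi> z"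
    and t: "t = s * \<phi> \<or> t = - (s * \<phi>)"
  shows "0 < infdist l (frontier (signed_sector s \<phi> z))"
    and "infdist l (frontier (signed_sector s \<phi> z)) \<le> s * Im (cis t * (l - z))"
proof -
  let ?S = "signed_sector s \<phi> z"
  define \<alpha> where "\<alpha> = s * Im (cis t * (l - z))"
  \<comment> \<open>The foot of the perpendicular from \<open>l\<close> to the boundary
    line.\<close>
  define p where "p = l - complex_of_real (s * \<alpha>) * \<i> * cis (- t)"
  have ss: "s * s = 1" using sign_cases[OF s] by auto
  have \<alpha>0: "0 < \<alpha>" using l t unfolding signed_sector_iff[OF s \<phi>] \<alpha>_def by auto
  have "cis t * (p - z) = cis t * (l - z) - complex_of_real (s * \<alpha>) * \<i> * (cis t * cis (- t))"
    by (simp add: p_def algebra_simps)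
  also have "cis t * cis (- t) = 1" by (simp add: cis_mult)
  finally have "s * Im (cis t * (p - z)) = \<alpha> - s * (s * \<alpha>)"
    by (simp add: \<alpha>_def right_diff_distrib)
  also have "\<dots> = 0" using ss by (simp flip: mult.assoc)
  finally have p: "p \<notin> ?S" using t unfolding signed_sector_iff[OF s \<phi>] by auto
  have "closed_segment l p \<inter> frontier ?S \<noteq> {}"
    using l p ends_in_segment[of l p]
    by (intro connected_Int_frontier convex_connected convex_closed_segment) blast+
  then obtain q where q: "q \<in> closed_segment l p" "q \<in> frontier ?S" by blast
  have "infdist l (frontier ?S) \<le> dist l q" by (rule infdist_le[OF q(2)])
  also have "\<dots> \<le> dist l p" using segment_bound(1)[OF q(1)] by (simp add: dist_norm norm_minus_commute)
  also have "\<dots> = \<alpha>" using s \<alpha>0 by (simp add: p_def dist_norm norm_mult abs_mult)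
  finally show "infdist l (frontier ?S) \<le> s * Im (cis t * (l - z))" by (simp add: \<alpha>_def)
  have "l \<notin> frontier ?S"
    using l open_signed_sector[OF s \<phi>, of z] by (simp add: frontier_def interior_open)
  \<comment> \<open>The point \<open>q\<close> shows that the frontier is nonempty;
    \<open>infdist\<close> to the empty set would be 0.\<close>
  then show "0 < infdist l (frontier ?S)"
    using q(2) by (intro infdist_pos_not_in_closed) auto
qed

text \<open>If \<open>\<phi> > 0\<close>, the unboundedness of \<open>Sigma_plus V\<close> and \<open>Sigma_minus V\<close> in the horizontal
  direction determines on which side of the supporting line they lie; for \<open>\<phi> = 0\<close> this follows
  from disjointness with the sector.\<close>

lemma Sigma_plus_below:
  assumes s: "\<bar>s\<bar> = 1" and \<phi>: "0 \<le> \<phi>" "\<phi> < pi / 2"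
    and disj: "signed_sector s \<phi> z \<subseteq> - Sigma_set V"
    and tang: "tangential (ray z (s * \<phi>)) (Sigma_plus V)" and w: "w \<in> Sigma_plus V"
  shows "s * Im (cis (- (s * \<phi>)) * (w - z)) \<le> 0"
proof (cases "\<phi> = 0")
  case True
  have "w \<notin> signed_sector s \<phi> z" using disj w by (auto simp: Sigma_set_def)
  then show ?thesis unfolding signed_sector_iff[OF s \<phi>] using True by auto
next
  case False
  obtain c w0 where c: "c \<noteq> 0" "w0 \<in> Sigma_plus V"
    "\<And>w. w \<in> Sigma_plus V \<Longrightarrow> c * Im (cis (- (s * \<phi>)) * (w - z)) \<le> 0"
    using tangential_ray[OF tang] unfolding exp_i_real by blast
  obtain r v where w0: "w0 = complex_of_real r + v" "1 \<le> r" "v \<in> convex hull essran V"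
    using c(2) by (auto simp: Sigma_plus_def)
  have "c * (- (s * sin \<phi>)) < 0"
  proof (rule mult_neg_if_bounded_ray)
    fix t :: real assume t: "0 \<le> t"
    have "complex_of_real (r + t) + v \<in> Sigma_plus V"
      unfolding Sigma_plus_def using w0 t by (intro CollectI exI[of _ "r + t"] exI[of _ v]) auto
    then have "c * Im (cis (- (s * \<phi>)) * (complex_of_real (r + t) + v - z)) \<le> 0" by (rule c(3))
    also have "complex_of_real (r + t) + v - z = (w0 - z) + complex_of_real t" by (simp add: w0)
    also have "Im (cis (- (s * \<phi>)) * ((w0 - z) + complex_of_real t))
        = Im (cis (- (s * \<phi>)) * (w0 - z)) + t * - (s * sin \<phi>)"
      by (simp add: distrib_left sin_sign[OF s])
    finally show "c * (Im (cis (- (s * \<phi>)) * (w0 - z)) + t * - (s * sin \<phi>)) \<le> 0" .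
  qed (use c(1) s \<phi> False sin_gt_zero[of \<phi>] in auto)
  then have "0 < c * s" using \<phi> False sin_gt_zero[of \<phi>] by (simp add: zero_less_mult_iff flip: mult.assoc)
  then show ?thesis using c(3)[OF w] by (intro sign_mult_le_0[OF s])
qed

lemma Sigma_minus_below:
  assumes s: "\<bar>s\<bar> = 1" and \<phi>: "0 \<le> \<phi>" "\<phi> < pi / 2"
    and disj: "signed_sector s \<phi> z \<subseteq> - Sigma_set V"
    and tang: "tangential (ray z (s * (pi - \<phi>))) (Sigma_minus V)" and w: "w \<in> Sigma_minus V"
  shows "s * Im (cis (s * \<phi>) * (w - z)) \<le> 0"
proof (cases "\<phi> = 0")
  case True
  have "w \<notin> signed_sector s \<phi> z" using disj w by (auto simp: Sigma_set_def)
  then show ?thesis unfolding signed_sector_iff[OF s \<phi>] using True by auto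
next
  case False
  \<comment> \<open>The left ray is directed towards the sector's vertex angle
    \<open>pi - \<phi>\<close>; the half-turn contributes only a sign and leaves the same functional
    as on a line of direction \<open>- (s * \<phi>)\<close>.\<close>
  have cis_eq: "cis (- (s * (pi - \<phi>))) = - cis (s * \<phi>)"
    using sign_cases[OF s] by (auto simp: complex_eq_iff sin_diff cos_diff)
  obtain c w0 where c: "c \<noteq> 0" "w0 \<in> Sigma_minus V"
    "\<And>w. w \<in> Sigma_minus V \<Longrightarrow> c * Im (- cis (s * \<phi>) * (w - z)) \<le> 0"
    using tangential_ray[OF tang] unfolding exp_i_real cis_eq by blast
  obtain r v where w0: "w0 = complex_of_real r + v" "r \<le> - 1" "v \<in> convex hull essran V"
    using c(2) by (auto simp: Sigma_minus_def)
  have "c * (s * sin \<phi>) < 0"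
  proof (rule mult_neg_if_bounded_ray)
    fix t :: real assume t: "0 \<le> t"
    have "complex_of_real (r - t) + v \<in> Sigma_minus V"
      unfolding Sigma_minus_def using w0 t by (intro CollectI exI[of _ "r - t"] exI[of _ v]) auto
    then have "c * Im (- cis (s * \<phi>) * (complex_of_real (r - t) + v - z)) \<le> 0" by (rule c(3))
    also have "complex_of_real (r - t) + v - z = (w0 - z) - complex_of_real t" by (simp add: w0)
    also have "Im (- cis (s * \<phi>) * ((w0 - z) - complex_of_real t))
        = Im (- cis (s * \<phi>) * (w0 - z)) + t * (s * sin \<phi>)"
      by (simp add: right_diff_distrib sin_sign[OF s])
    finally show "c * (Im (- cis (s * \<phi>) * (w0 - z)) + t * (s * sin \<phi>)) \<le> 0" .
  qed (use c(1) s \<phi> False sin_gt_zero[of \<phi>] in auto)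
  then have "0 < - c * s" using \<phi> False sin_gt_zero[of \<phi>] by (simp add: mult_less_0_iff flip: mult.assoc)
  moreover have "- c * Im (cis (s * \<phi>) * (w - z)) \<le> 0"
    using c(3)[OF w] by (simp only: mult_minus_left mult_minus_right uminus_complex.sel)
  ultimately show ?thesis by (rule sign_mult_le_0[OF s])
qed

section \<open>Resolvent estimate inside a sector\<close>

lemma resolvent_in_signed_sector:
  assumes V: "V \<in> L_infinity" and s: "\<bar>s\<bar> = 1" and \<phi>: "0 \<le> \<phi>" "\<phi> < pi / 2"
    and disj: "signed_sector s \<phi> z \<subseteq> - Sigma_set V"
    and tm: "tangential (ray z (s * (pi - \<phi>))) (Sigma_minus V)"
    and tp: "tangential (ray z (s * \<phi>)) (Sigma_plus V)"
    and l: "l \<in> signed_sector s \<phi> z"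
  shows "l \<notin> pencil_numerical_range (op_mult (B_rot (s * \<phi>)) (dirac V)) (B_rot (s * \<phi>))"
    and "l \<in> resolvent_set (dirac V)"
    and "onorm (resolvent (dirac V) l)
      \<le> 1 / (cos \<phi> * infdist l (frontier (signed_sector s \<phi> z)))"
proof -
  define d where "d = infdist l (frontier (signed_sector s \<phi> z))"
  \<comment> \<open>The distance to the frontier bounds from below the distances to both boundary
    lines, so one constant serves both diagonal entries of the form.\<close>
  have d: "0 < d" "d \<le> s * Im (cis (s * \<phi>) * (l - z))" "d \<le> s * Im (cis (- (s * \<phi>)) * (l - z))"
    using infdist_frontier_signed_sector[OF s \<phi> l, of "s * \<phi>"]
      infdist_frontier_signed_sector[OF s \<phi> l, of "- (s * \<phi>)"]
    by (simp_all add: d_def)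
  have ess: "AE x in lebesgue. V x \<in> convex hull essran V"
    using AE_essran[of V] V hull_subset[of "essran V" convex]
    by (auto simp: L_infinity_def elim: eventually_mono)
  have up: "AE x in lebesgue.
      s * Im (exp (- (\<i> * complex_of_real (s * \<phi>))) * (1 - l + V x)) \<le> - d"
    using ess
  proof eventually_elim
    case (elim x)
    then have "complex_of_real 1 + V x \<in> Sigma_plus V" unfolding Sigma_plus_def by blast
    then have "s * Im (cis (- (s * \<phi>)) * (1 + V x - z)) \<le> 0"
      using Sigma_plus_below[OF s \<phi> disj tp] by (simp only: of_real_1)
    moreover have "cis (- (s * \<phi>)) * (1 - l + V x)
        = cis (- (s * \<phi>)) * (1 + V x - z) - cis (- (s * \<phi>)) * (l - z)"
      by (simp add: algebra_simps)
    then have "s * Im (cis (- (s * \<phi>)) * (1 - l + V x))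
        = s * Im (cis (- (s * \<phi>)) * (1 + V x - z)) - s * Im (cis (- (s * \<phi>)) * (l - z))"
      by (simp only: minus_complex.sel right_diff_distrib)
    ultimately show ?case using d(3) unfolding exp_i_real by linarith
  qed
  have dn: "AE x in lebesgue.
      s * Im (exp (\<i> * complex_of_real (s * \<phi>)) * (- 1 - l + V x)) \<le> - d"
    using ess
  proof eventually_elim
    case (elim x)
    then have "complex_of_real (- 1) + V x \<in> Sigma_minus V" unfolding Sigma_minus_def by blast
    then have "s * Im (cis (s * \<phi>) * (- 1 + V x - z)) \<le> 0"
      using Sigma_minus_below[OF s \<phi> disj tm] by (simp only: of_real_minus of_real_1)
    moreover have "cis (s * \<phi>) * (- 1 - l + V x)
        = cis (s * \<phi>) * (- 1 + V x - z) - cis (s * \<phi>) * (l - z)"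
      by (simp add: algebra_simps)
    then have "s * Im (cis (s * \<phi>) * (- 1 - l + V x))
        = s * Im (cis (s * \<phi>) * (- 1 + V x - z)) - s * Im (cis (s * \<phi>) * (l - z))"
      by (simp only: minus_complex.sel right_diff_distrib)
    ultimately show ?case using d(2) unfolding exp_i_real by linarith
  qed
  note res = dirac_resolvent[OF V s d(1) up dn]
  show "l \<notin> pencil_numerical_range (op_mult (B_rot (s * \<phi>)) (dirac V)) (B_rot (s * \<phi>))"
    "l \<in> resolvent_set (dirac V)" by (fact res)+
  have "0 < cos \<phi>" using \<phi> by (intro cos_gt_zero_pi) auto
  \<comment> \<open>The form estimate yields the bound \<open>1 / d\<close>, and
    \<open>cos \<phi> \<le> 1\<close> passes to the stated one.\<close>
  then have "1 / d \<le> 1 / (cos \<phi> * d)"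
    using d(1) by (intro divide_left_mono) (auto simp: mult_left_le_one_le)
  then show "onorm (resolvent (dirac V) l)
      \<le> 1 / (cos \<phi> * infdist l (frontier (signed_sector s \<phi> z)))"
    using res(3) unfolding d_def by linarith
qed

theorem theorem4p12:
  fixes V :: "real^3 \<Rightarrow> complex"
  assumes "V \<in> L_infinity"
  shows
    "(\<forall>z \<phi> S B.
        (upper_admissible V z \<phi> \<and> S = upper_sector \<phi> z \<and> B = B_rot \<phi>
         \<or> lower_admissible V z \<phi> \<and> S = lower_sector \<phi> z \<and> B = B_rot (- \<phi>))
        \<longrightarrow> S \<subseteq> (- pencil_numerical_range (op_mult B (dirac V)) B) \<inter> resolvent_set (dirac V)
            \<and> (\<forall>l\<in>S. onorm (resolvent (dirac V) l)
                  \<le> 1 / (cos \<phi> * infdist l (frontier S))))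
     \<and> spectrum (dirac V) \<subseteq> Sigma_tilde V"
proof -
  have upper: "l \<notin> pencil_numerical_range (op_mult (B_rot \<phi>) (dirac V)) (B_rot \<phi>)"
    "l \<in> resolvent_set (dirac V)"
    "onorm (resolvent (dirac V) l) \<le> 1 / (cos \<phi> * infdist l (frontier (upper_sector \<phi> z)))"
    if "upper_admissible V z \<phi>" "l \<in> upper_sector \<phi> z" for l z \<phi>
    using that resolvent_in_signed_sector[OF assms, of 1 \<phi> z l]
    by (simp_all add: upper_admissible_def upper_sector_eq)
  have lower: "l \<notin> pencil_numerical_range (op_mult (B_rot (- \<phi>)) (dirac V)) (B_rot (- \<phi>))"
    "l \<in> resolvent_set (dirac V)"
    "onorm (resolvent (dirac V) l) \<le> 1 / (cos \<phi> * infdist l (frontier (lower_sector \<phi> z)))"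
    if "lower_admissible V z \<phi>" "l \<in> lower_sector \<phi> z" for l z \<phi>
    using that resolvent_in_signed_sector[OF assms, of "- 1" \<phi> z l]
    by (simp_all add: lower_admissible_def lower_sector_eq)
  have "\<Union> (admissible_sectors V) \<subseteq> resolvent_set (dirac V)"
    unfolding admissible_sectors_def using upper(2) lower(2) by blast
  then have "spectrum (dirac V) \<subseteq> Sigma_tilde V"
    by (simp add: spectrum_def Sigma_tilde_def)
  moreover have "S \<subseteq> (- pencil_numerical_range (op_mult B (dirac V)) B) \<inter> resolvent_set (dirac V)
      \<and> (\<forall>l\<in>S. onorm (resolvent (dirac V) l) \<le> 1 / (cos \<phi> * infdist l (frontier S)))"
    if "upper_admissible V z \<phi> \<and> S = upper_sector \<phi> z \<and> B = B_rot \<phi>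
      \<or> lower_admissible V z \<phi> \<and> S = lower_sector \<phi> z \<and> B = B_rot (- \<phi>)" for z \<phi> S B
    using that upper lower by (elim disjE) auto
  ultimately show ?thesis by blast
qed

end
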